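(* Let $\Gamma$ be a finite simplicial graph, with each vertex $v$ labelled by a group $G_v$ (not necessarily finitely generated). Then the graph product $G_\Gamma$ endowed with the syllable metric is a hierarchically hyperbolic space.
   Context: **Graph products and syllable metric.** Let $\Gamma$ be a finite non-empty simplicial graph with each vertex $v$ labelled by a group $G_v$; vertex groups are always assumed non-trivial. The graph product is $G_\Gamma=\left(\ast_{v\in V(\Gamma)}G_v\right)/\langle\langle [g_v,g_w] : g_v\in G_v,\ g_w\in G_w,\ \{v,w\}\in E(\Gamma)\rangle\rangle$. The syllable metric is the metric of the graph $S(\Gamma)$ with vertex set $G_\Gamma$ and an edge of length 1 between distinct $g,h$ whenever $g^{-1}h\in G_v$ for some $v\in V(\Gamma)$. **Proto-hierarchy structure.** Let $\mathcal X$ be a quasi-geodesic metric space and $E>0$. An $E$-proto-hierarchy structure on $\mathcal X$ is an index set $\mathfrak S$ and geodesic spaces $(C(W),\mathsf d_W)$, $W\in\mathfrak S$, such that (for subsets $A,B$ of $C(W)$, $\mathsf d_W(A,B)$ denotes the infimal distance): - (Projections) For each $W$ there is $\pi_W:\mathcal X\to 2^{C(W)}$ with $\pi_W(x)\ne\emptyset$, $\operatorname{diam}\pi_W(x)\le E$ for all $x$; $\pi_W$ is $(E,E)$-coarsely Lipschitz; and $C(W)$ is contained in the $E$-neighbourhood of $\pi_W(\mathcal X)$. - (Nesting) If $\mathfrak S\neq\emptyset$, it has a partial order $\sqsubseteq$ with a unique maximal element. $\mathfrak S_W=\{V: V\sqsubseteq W\}$. If $V\sqsubsetneq W$ there is a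 specified non-empty $\rho^V_W\subseteq C(W)$ with $\operatorname{diam}\rho^V_W\le E$. - (Orthogonality) There is a symmetric relation $\perp$ on $\mathfrak S$; orthogonal elements are not $\sqsubseteq$-comparable; $V\sqsubseteq W$ and $W\perp U$ imply $V\perp U$. $\mathfrak S_W^\perp=\{V:V\perp W\}$. - (Transversality) If $V,W$ are not orthogonal and neither is nested in the other, write $V\pitchfork W$; then there are specified non-empty $\rho^V_W\subseteq C(W)$, $\rho^W_V\subseteq C(V)$ of diameter at most $E$. **HHS.** $\mathcal X$ is a hierarchically hyperbolic space (HHS) if for some $E>0$ it admits an $E$-proto-hierarchy structure such that in addition (writing $\mathsf d_W(x,y)$ for $\mathsf d_W(\pi_W(x),\pi_W(y))$): 1. (Hyperbolicity) Every $C(W)$ is $E$-hyperbolic. 2. (Finite complexity) Any set of pairwise $\sqsubseteq$-comparable elements has at most $E$ elements. 3. (Containers) For $W\in\mathfrak S$ and $U\in\mathfrak S_W$ with $\mathfrak S_W\cap\mathfrak S_U^\perp\ne\emptyset$ there is $Q\in\mathfrak S_W$ with $V\sqsubseteq Q$ for all $V\in\mathfrak S_W\cap\mathfrak S_U^\perp$. 4. (Uniqueness) There is $\theta:[0,\infty)\to[0,\infty)$ such that for all $r\ge0$, if $\mathsf d_{\mathcal X}(x,y)\ge\theta(r)$ then $\mathsf d_W(x,y)\ge r$ for some $W$. 5. (Bounded geodesic image) If $V\sqsubsetneq W$ and $\mathsf d_V(x,y)\ge E$, then every $C(W)$-geodesic from $\pi_W(x)$ to $\pi_W(y)$ meets the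 $E$-neighbourhood of $\rho^V_W$. 6. (Large links) For all $W$ and $x,y\in\mathcal X$ there is $\{V_1,\dots,V_m\}\subseteq\mathfrak S_W\smallsetminus\{W\}$ with $m\le E\,\mathsf d_W(x,y)+E$ such that for all $U\in\mathfrak S_W\smallsetminus\{W\}$, either $U\sqsubseteq V_i$ for some $i$ or $\mathsf d_U(x,y)\le E$. 7. (Consistency) If $V\pitchfork W$ then $\min\{\mathsf d_W(\pi_W(x),\rho^V_W),\mathsf d_V(\pi_V(x),\rho^W_V)\}\le E$ for all $x$. If $U\sqsubseteq V$ and either $V\sqsubsetneq W$, or $V\pitchfork W$ and $W\not\perp U$, then $\mathsf d_W(\rho^U_W,\rho^V_W)\le E$. 8. (Partial realisation) If $\{V_i\}$ is a finite collection of pairwise orthogonal elements and $p_i\in C(V_i)$, there is $x\in\mathcal X$ with $\mathsf d_{V_i}(\pi_{V_i}(x),p_i)\le E$ for all $i$, and $\mathsf d_W(\pi_W(x),\rho^{V_i}_W)\le E$ whenever $V_i\sqsubsetneq W$ or $W\pitchfork V_i$. *)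

theory Defs
  imports "HOL-Analysis.Analysis" "HOL-Algebra.Coset"
begin

section \<open>Graph products of groups and the syllable metric\<close>

definition simplicial_graph :: "'v set \<Rightarrow> 'v set set \<Rightarrow> bool" where
  "simplicial_graph V Ed \<longleftrightarrow> (\<forall>e\<in>Ed. e \<subseteq> V \<and> card e = 2)"

definition group_words :: "'v set \<Rightarrow> ('v \<Rightarrow> ('g, 'm) monoid_scheme) \<Rightarrow> ('v \<times> 'g) list set" where
  "group_words V G = lists (SIGMA v:V. carrier (G v))"

text \<open>The least congruence on the monoid of words that identifies a product of two letters of the
  same vertex group with the product taken in that group, and every neutral letter with the empty
  word. The quotient is the free product (the coproduct of groups).\<close>

inductive_set free_product_rel ::
    "'v set \<Rightarrow> ('v \<Rightarrow> ('g, 'm) monoid_scheme) \<Rightarrow> (('v \<times> 'g) list \<times> ('v \<times> 'g) list) set"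
  for V :: "'v set" and G :: "'v \<Rightarrow> ('g, 'm) monoid_scheme" where
  refl: "w \<in> group_words V G \<Longrightarrow> (w, w) \<in> free_product_rel V G"
| sym: "(u, w) \<in> free_product_rel V G \<Longrightarrow> (w, u) \<in> free_product_rel V G"
| trans: "(u, w) \<in> free_product_rel V G \<Longrightarrow> (w, z) \<in> free_product_rel V G
    \<Longrightarrow> (u, z) \<in> free_product_rel V G"
| append: "(u, u') \<in> free_product_rel V G \<Longrightarrow> (w, w') \<in> free_product_rel V G
    \<Longrightarrow> (u @ w, u' @ w') \<in> free_product_rel V G"
| one: "v \<in> V \<Longrightarrow> ([(v, \<one>\<^bsub>G v\<^esub>)], []) \<in> free_product_rel V G"
| mult: "v \<in> V \<Longrightarrow> g \<in> carrier (G v) \<Longrightarrow> h \<in> carrier (G v)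
    \<Longrightarrow> ([(v, g), (v, h)], [(v, g \<otimes>\<^bsub>G v\<^esub> h)]) \<in> free_product_rel V G"

definition free_product ::
    "'v set \<Rightarrow> ('v \<Rightarrow> ('g, 'm) monoid_scheme) \<Rightarrow> ('v \<times> 'g) list set monoid" where
  "free_product V G =
    \<lparr>carrier = group_words V G // free_product_rel V G,
     mult = (\<lambda>A B. \<Union>a\<in>A. \<Union>b\<in>B. free_product_rel V G `` {a @ b}),
     one = free_product_rel V G `` {[]}\<rparr>"

definition free_product_incl ::
    "'v set \<Rightarrow> ('v \<Rightarrow> ('g, 'm) monoid_scheme) \<Rightarrow> 'v \<Rightarrow> 'g \<Rightarrow> ('v \<times> 'g) list set" where
  "free_product_incl V G v g = free_product_rel V G `` {[(v, g)]}"

definition commutator :: "('a, 'm) monoid_scheme \<Rightarrow> 'a \<Rightarrow> 'a \<Rightarrow> 'a" where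
  "commutator H a b = a \<otimes>\<^bsub>H\<^esub> b \<otimes>\<^bsub>H\<^esub> inv\<^bsub>H\<^esub> a \<otimes>\<^bsub>H\<^esub> inv\<^bsub>H\<^esub> b"

definition normal_closure :: "('a, 'm) monoid_scheme \<Rightarrow> 'a set \<Rightarrow> 'a set" where
  "normal_closure H S = \<Inter>{N. N \<lhd> H \<and> S \<subseteq> N}"

definition edge_commutators ::
    "'v set \<Rightarrow> 'v set set \<Rightarrow> ('v \<Rightarrow> ('g, 'm) monoid_scheme) \<Rightarrow> ('v \<times> 'g) list set set" where
  "edge_commutators V Ed G =
    {commutator (free_product V G) (free_product_incl V G v g) (free_product_incl V G w h) |
      v w g h. {v, w} \<in> Ed \<and> g \<in> carrier (G v) \<and> h \<in> carrier (G w)}"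

type_synonym ('v, 'g) graph_product_elt = "('v \<times> 'g) list set set"

definition graph_product ::
    "'v set \<Rightarrow> 'v set set \<Rightarrow> ('v \<Rightarrow> ('g, 'm) monoid_scheme) \<Rightarrow> ('v, 'g) graph_product_elt monoid" where
  "graph_product V Ed G =
    free_product V G Mod normal_closure (free_product V G) (edge_commutators V Ed G)"

definition vertex_subgroup ::
    "'v set \<Rightarrow> 'v set set \<Rightarrow> ('v \<Rightarrow> ('g, 'm) monoid_scheme) \<Rightarrow> 'v \<Rightarrow> ('v, 'g) graph_product_elt set" where
  "vertex_subgroup V Ed G v =
    (\<lambda>g. normal_closure (free_product V G) (edge_commutators V Ed G)
           #>\<^bsub>free_product V G\<^esub> free_product_incl V G v g) ` carrier (G v)"

definition syllable_adj ::
    "'v set \<Rightarrow> 'v set set \<Rightarrow> ('v \<Rightarrow> ('g, 'm) monoid_scheme)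
      \<Rightarrow> ('v, 'g) graph_product_elt rel" where
  "syllable_adj V Ed G =
    {(x, y). x \<in> carrier (graph_product V Ed G) \<and> y \<in> carrier (graph_product V Ed G) \<and> x \<noteq> y \<and>
      (\<exists>v\<in>V. inv\<^bsub>graph_product V Ed G\<^esub> x \<otimes>\<^bsub>graph_product V Ed G\<^esub> y \<in> vertex_subgroup V Ed G v)}"

text \<open>Path metric on the vertices of the syllable graph: the least length of an edge path. Any two
  elements are joined by an edge path because the vertex groups generate.\<close>

definition syllable_dist ::
    "'v set \<Rightarrow> 'v set set \<Rightarrow> ('v \<Rightarrow> ('g, 'm) monoid_scheme)
      \<Rightarrow> ('v, 'g) graph_product_elt \<Rightarrow> ('v, 'g) graph_product_elt \<Rightarrow> real" where
  "syllable_dist V Ed G x y = real (LEAST n. (x, y) \<in> syllable_adj V Ed G ^^ n)"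


section \<open>Coarse metric geometry\<close>

definition geodesic_segment :: "'a set \<Rightarrow> ('a \<Rightarrow> 'a \<Rightarrow> real) \<Rightarrow> 'a \<Rightarrow> 'a \<Rightarrow> 'a set \<Rightarrow> bool" where
  "geodesic_segment M d x y S \<longleftrightarrow>
    (\<exists>\<gamma> :: real \<Rightarrow> 'a. \<gamma> 0 = x \<and> \<gamma> (d x y) = y \<and> \<gamma> ` {0..d x y} = S \<and> S \<subseteq> M \<and>
      (\<forall>s\<in>{0..d x y}. \<forall>t\<in>{0..d x y}. d (\<gamma> s) (\<gamma> t) = \<bar>s - t\<bar>))"

definition geodesic_space :: "'a set \<Rightarrow> ('a \<Rightarrow> 'a \<Rightarrow> real) \<Rightarrow> bool" where
  "geodesic_space M d \<longleftrightarrow>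
    Metric_space M d \<and> (\<forall>x\<in>M. \<forall>y\<in>M. \<exists>S. geodesic_segment M d x y S)"

definition quasi_geodesic_space :: "'a set \<Rightarrow> ('a \<Rightarrow> 'a \<Rightarrow> real) \<Rightarrow> bool" where
  "quasi_geodesic_space M d \<longleftrightarrow>
    Metric_space M d \<and>
    (\<exists>K c. K \<ge> 1 \<and> c \<ge> 0 \<and>
      (\<forall>x\<in>M. \<forall>y\<in>M. \<exists>L \<ge> 0. \<exists>\<gamma> :: real \<Rightarrow> 'a.
        \<gamma> 0 = x \<and> \<gamma> L = y \<and> \<gamma> ` {0..L} \<subseteq> M \<and>
        (\<forall>s\<in>{0..L}. \<forall>t\<in>{0..L}.
          \<bar>s - t\<bar> / K - c \<le> d (\<gamma> s) (\<gamma> t) \<and> d (\<gamma> s) (\<gamma> t) \<le> K * \<bar>s - t\<bar> + c)))"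

text \<open>Hyperbolicity in the sense of slim geodesic triangles.\<close>

definition hyperbolic :: "real \<Rightarrow> 'a set \<Rightarrow> ('a \<Rightarrow> 'a \<Rightarrow> real) \<Rightarrow> bool" where
  "hyperbolic \<delta> M d \<longleftrightarrow>
    (\<forall>x\<in>M. \<forall>y\<in>M. \<forall>z\<in>M. \<forall>S T U.
      geodesic_segment M d x y S \<and> geodesic_segment M d y z T \<and> geodesic_segment M d x z U \<longrightarrow>
      (\<forall>p\<in>S. \<exists>q\<in>T \<union> U. d p q \<le> \<delta>))"

definition set_dist :: "('a \<Rightarrow> 'a \<Rightarrow> real) \<Rightarrow> 'a set \<Rightarrow> 'a set \<Rightarrow> real" where
  "set_dist d A B = (INF (a, b)\<in>A \<times> B. d a b)"

definition nbhd :: "real \<Rightarrow> 'a set \<Rightarrow> ('a \<Rightarrow> 'a \<Rightarrow> real) \<Rightarrow> 'a set \<Rightarrow> 'a set" where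
  "nbhd r M d A = {p \<in> M. \<exists>a\<in>A. d p a \<le> r}"

definition diam_le :: "('a \<Rightarrow> 'a \<Rightarrow> real) \<Rightarrow> 'a set \<Rightarrow> real \<Rightarrow> bool" where
  "diam_le d A r \<longleftrightarrow> (\<forall>a\<in>A. \<forall>b\<in>A. d a b \<le> r)"


section \<open>Hierarchically hyperbolic spaces\<close>

text \<open>\<open>\<rho> V W\<close> is the subset \<open>\<rho>\<^sup>V\<^sub>W\<close> of \<open>C W\<close>; it is only constrained when \<open>V\<close> is properly nested in
  \<open>W\<close> or transverse to \<open>W\<close>. All relations are only constrained on the index set \<open>\<SS>\<close>.\<close>

locale proto_hierarchy_structure =
  fixes X :: "'x set" and dX :: "'x \<Rightarrow> 'x \<Rightarrow> real" and E :: real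
    and \<SS> :: "'i set" and C :: "'i \<Rightarrow> 'p set" and d :: "'i \<Rightarrow> 'p \<Rightarrow> 'p \<Rightarrow> real"
    and \<pi> :: "'i \<Rightarrow> 'x \<Rightarrow> 'p set"
    and nest :: "'i \<Rightarrow> 'i \<Rightarrow> bool" and orth :: "'i \<Rightarrow> 'i \<Rightarrow> bool"
    and \<rho> :: "'i \<Rightarrow> 'i \<Rightarrow> 'p set"
  assumes quasi_geodesic: "quasi_geodesic_space X dX"
    and E_pos: "E > 0"
    and geodesic: "W \<in> \<SS> \<Longrightarrow> geodesic_space (C W) (d W)"
    and proj_subset: "W \<in> \<SS> \<Longrightarrow> x \<in> X \<Longrightarrow> \<pi> W x \<subseteq> C W"
    and proj_nonempty: "W \<in> \<SS> \<Longrightarrow> x \<in> X \<Longrightarrow> \<pi> W x \<noteq> {}"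
    and proj_diam: "W \<in> \<SS> \<Longrightarrow> x \<in> X \<Longrightarrow> diam_le (d W) (\<pi> W x) E"
    and proj_lipschitz: "W \<in> \<SS> \<Longrightarrow> x \<in> X \<Longrightarrow> y \<in> X \<Longrightarrow>
      set_dist (d W) (\<pi> W x) (\<pi> W y) \<le> E * dX x y + E"
    and proj_coarsely_onto: "W \<in> \<SS> \<Longrightarrow> C W \<subseteq> nbhd E (C W) (d W) (\<Union>x\<in>X. \<pi> W x)"
    and nest_refl: "reflp_on \<SS> nest"
    and nest_antisym: "antisymp_on \<SS> nest"
    and nest_trans: "transp_on \<SS> nest"
    and unique_maximal: "\<SS> \<noteq> {} \<Longrightarrow> \<exists>!M. M \<in> \<SS> \<and> (\<forall>W\<in>\<SS>. nest M W \<longrightarrow> W = M)"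
    and rho_nest: "V \<in> \<SS> \<Longrightarrow> W \<in> \<SS> \<Longrightarrow> nest V W \<Longrightarrow> V \<noteq> W \<Longrightarrow>
      \<rho> V W \<subseteq> C W \<and> \<rho> V W \<noteq> {} \<and> diam_le (d W) (\<rho> V W) E"
    and orth_sym: "symp_on \<SS> orth"
    and orth_not_comparable: "V \<in> \<SS> \<Longrightarrow> W \<in> \<SS> \<Longrightarrow> orth V W \<Longrightarrow> \<not> nest V W \<and> \<not> nest W V"
    and nest_orth: "V \<in> \<SS> \<Longrightarrow> W \<in> \<SS> \<Longrightarrow> U \<in> \<SS> \<Longrightarrow> nest V W \<Longrightarrow> orth W U \<Longrightarrow> orth V U"
    and rho_transverse: "V \<in> \<SS> \<Longrightarrow> W \<in> \<SS> \<Longrightarrow> \<not> orth V W \<Longrightarrow> \<not> nest V W \<Longrightarrow> \<not> nest W V \<Longrightarrow>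
      \<rho> V W \<subseteq> C W \<and> \<rho> V W \<noteq> {} \<and> diam_le (d W) (\<rho> V W) E \<and>
      \<rho> W V \<subseteq> C V \<and> \<rho> W V \<noteq> {} \<and> diam_le (d V) (\<rho> W V) E"
begin

definition transverse :: "'i \<Rightarrow> 'i \<Rightarrow> bool" where
  "transverse V W \<longleftrightarrow> \<not> orth V W \<and> \<not> nest V W \<and> \<not> nest W V"

definition nested_in :: "'i \<Rightarrow> 'i set" where
  "nested_in W = {V \<in> \<SS>. nest V W}"

definition orthogonal_to :: "'i \<Rightarrow> 'i set" where
  "orthogonal_to W = {V \<in> \<SS>. orth V W}"

definition proj_dist :: "'i \<Rightarrow> 'x \<Rightarrow> 'x \<Rightarrow> real" where
  "proj_dist W x y = set_dist (d W) (\<pi> W x) (\<pi> W y)"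

end

locale HHS_structure = proto_hierarchy_structure X dX E \<SS> C d \<pi> nest orth \<rho>
  for X :: "'x set" and dX :: "'x \<Rightarrow> 'x \<Rightarrow> real" and E :: real
    and \<SS> :: "'i set" and C :: "'i \<Rightarrow> 'p set" and d :: "'i \<Rightarrow> 'p \<Rightarrow> 'p \<Rightarrow> real"
    and \<pi> :: "'i \<Rightarrow> 'x \<Rightarrow> 'p set"
    and nest :: "'i \<Rightarrow> 'i \<Rightarrow> bool" and orth :: "'i \<Rightarrow> 'i \<Rightarrow> bool"
    and \<rho> :: "'i \<Rightarrow> 'i \<Rightarrow> 'p set" +
  assumes hyperbolicity: "W \<in> \<SS> \<Longrightarrow> hyperbolic E (C W) (d W)"
    and finite_complexity: "T \<subseteq> \<SS> \<Longrightarrow> (\<And>V W. V \<in> T \<Longrightarrow> W \<in> T \<Longrightarrow> nest V W \<or> nest W V) \<Longrightarrow>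
      finite T \<and> real (card T) \<le> E"
    and containers: "W \<in> \<SS> \<Longrightarrow> U \<in> nested_in W \<Longrightarrow> nested_in W \<inter> orthogonal_to U \<noteq> {} \<Longrightarrow>
      \<exists>Q\<in>nested_in W. \<forall>V\<in>nested_in W \<inter> orthogonal_to U. nest V Q"
    and uniqueness: "\<exists>\<theta> :: real \<Rightarrow> real. (\<forall>r\<ge>0. \<theta> r \<ge> 0) \<and>
      (\<forall>r\<ge>0. \<forall>x\<in>X. \<forall>y\<in>X. dX x y \<ge> \<theta> r \<longrightarrow> (\<exists>W\<in>\<SS>. proj_dist W x y \<ge> r))"
    and bounded_geodesic_image: "V \<in> \<SS> \<Longrightarrow> W \<in> \<SS> \<Longrightarrow> nest V W \<Longrightarrow> V \<noteq> W \<Longrightarrow>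
      x \<in> X \<Longrightarrow> y \<in> X \<Longrightarrow> proj_dist V x y \<ge> E \<Longrightarrow>
      a \<in> \<pi> W x \<Longrightarrow> b \<in> \<pi> W y \<Longrightarrow> geodesic_segment (C W) (d W) a b S \<Longrightarrow>
      S \<inter> nbhd E (C W) (d W) (\<rho> V W) \<noteq> {}"
    and large_links: "W \<in> \<SS> \<Longrightarrow> x \<in> X \<Longrightarrow> y \<in> X \<Longrightarrow>
      \<exists>F \<subseteq> nested_in W - {W}. finite F \<and> real (card F) \<le> E * proj_dist W x y + E \<and>
        (\<forall>U\<in>nested_in W - {W}. (\<exists>V\<in>F. nest U V) \<or> proj_dist U x y \<le> E)"
    and consistency_transverse: "V \<in> \<SS> \<Longrightarrow> W \<in> \<SS> \<Longrightarrow> transverse V W \<Longrightarrow> x \<in> X \<Longrightarrow>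
      min (set_dist (d W) (\<pi> W x) (\<rho> V W)) (set_dist (d V) (\<pi> V x) (\<rho> W V)) \<le> E"
    and consistency_nested: "U \<in> \<SS> \<Longrightarrow> V \<in> \<SS> \<Longrightarrow> W \<in> \<SS> \<Longrightarrow> nest U V \<Longrightarrow>
      (nest V W \<and> V \<noteq> W) \<or> (transverse V W \<and> \<not> orth W U) \<Longrightarrow>
      set_dist (d W) (\<rho> U W) (\<rho> V W) \<le> E"
    and partial_realisation: "F \<subseteq> \<SS> \<Longrightarrow> finite F \<Longrightarrow>
      (\<And>V W. V \<in> F \<Longrightarrow> W \<in> F \<Longrightarrow> V \<noteq> W \<Longrightarrow> orth V W) \<Longrightarrow> (\<And>V. V \<in> F \<Longrightarrow> p V \<in> C V) \<Longrightarrow>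
      \<exists>x\<in>X. \<forall>V\<in>F. set_dist (d V) (\<pi> V x) {p V} \<le> E \<and>
        (\<forall>W\<in>\<SS>. (nest V W \<and> V \<noteq> W) \<or> transverse W V \<longrightarrow>
          set_dist (d W) (\<pi> W x) (\<rho> V W) \<le> E)"

text \<open>HOL cannot quantify existentially over types, so the types \<open>'i\<close> of indices and \<open>'p\<close> of points
  of the hyperbolic spaces, in which the structure is sought, are explicit parameters.\<close>

definition hierarchically_hyperbolic_space ::
    "'i itself \<Rightarrow> 'p itself \<Rightarrow> 'x set \<Rightarrow> ('x \<Rightarrow> 'x \<Rightarrow> real) \<Rightarrow> bool" where
  "hierarchically_hyperbolic_space (ti :: 'i itself) (tp :: 'p itself) X dX \<longleftrightarrow>
    (\<exists>E (\<SS> :: 'i set) (C :: 'i \<Rightarrow> 'p set) d \<pi> nest orth \<rho>.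
      HHS_structure X dX E \<SS> C d \<pi> nest orth \<rho>)"

end

theory Submission
  imports Defs
begin

text \<open>For a set \<open>\<Lambda>\<close> of vertices, every element \<open>x\<close> of the graph product has a gate, its maximal prefix in the
  parabolic subgroup \<open>par \<Lambda>\<close>. Gates come from an action of the graph product on pairs, which only needs the
  universal property, and they make the usual normal form theorem unnecessary. The index set consists of
  the parallelism classes of cosets of the \<open>par \<Lambda>\<close>, the space of a class is \<open>par \<Lambda>\<close> with all its proper
  parabolic cosets coned off, and the projections are the gates.

  The recurring argument: a letter of type \<open>v\<close> moves the gate on a coset only at points that differ from
  their gate by an element linked to \<open>v\<close>. Hence a path in a coned-off space along which the gate on a
  smaller coset changes passes within distance two of that coset. This gives bounded geodesic images, and,
  applied to the hyperplanes crossed by a syllable geodesic, a bottleneck property and so hyperbolicity.\<close>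

text \<open>A syllable has length one whatever its vertex group, so coning off turns a single vertex
  group into a space of diameter at most one and no geometry of the vertex groups is ever needed.
  Cosets \<open>g par \<Lambda>\<close> and \<open>h par \<Lambda>\<close> are parallel when
  \<open>inv g \<otimes> h\<close> lies in \<open>par (st \<Lambda>)\<close>. Since
  \<open>par (lk \<Lambda>)\<close> commutes with \<open>par \<Lambda>\<close>, both give the same
  gates up to a translation. Taken as separate indices they would be nested in each other, against
  antisymmetry; hence classes. Uniqueness is an induction on \<open>\<Lambda>\<close>: a coned-off
  geodesic with at most \<open>r\<close> steps runs through \<open>r\<close> cosets of smaller
  parabolic subgroups, and every syllable between its ends moves the gate on one of them. This
  produces the power of \<open>r + 1\<close>. The axioms ask for geodesic spaces, whereas the
  arguments only concern group elements. The coned-off graphs are therefore realised explicitly, and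
  the small constants pay for moving between a point of the realisation and a vertex within distance
  one of it.\<close>

section \<open>Geodesic realisation of integer-valued path metrics\<close>

lemma geodesic_segment_refl:
  assumes "Metric_space M d" "x \<in> M"
  shows "geodesic_segment M d x x {x}"
proof -
  have "d x x = 0" using assms by (simp add: Metric_space.zero)
  then show ?thesis
    unfolding geodesic_segment_def using assms(2) by (intro exI[of _ "\<lambda>_. x"]) auto
qed

text \<open>A point of the first half and one of the second are at most as far apart as the route
  through \<open>y\<close> and, since \<open>add\<close> leaves no shortcut from \<open>x\<close> to
  \<open>z\<close>, no closer.\<close>

lemma geodesic_segment_concat:
  assumes M: "Metric_space M d"
    and S: "geodesic_segment M d x y S" and T: "geodesic_segment M d y z T"
    and add: "d x z = d x y + d y z"
  shows "geodesic_segment M d x z (S \<union> T)"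
proof -
  interpret Metric_space M d by fact
  obtain \<gamma> where g: "\<gamma> 0 = x" "\<gamma> (d x y) = y" "\<gamma> ` {0..d x y} = S" "S \<subseteq> M"
    and gi: "\<And>s t. s \<in> {0..d x y} \<Longrightarrow> t \<in> {0..d x y} \<Longrightarrow> d (\<gamma> s) (\<gamma> t) = \<bar>s - t\<bar>"
    using S unfolding geodesic_segment_def by blast
  obtain \<eta> where h: "\<eta> 0 = y" "\<eta> (d y z) = z" "\<eta> ` {0..d y z} = T" "T \<subseteq> M"
    and hi: "\<And>s t. s \<in> {0..d y z} \<Longrightarrow> t \<in> {0..d y z} \<Longrightarrow> d (\<eta> s) (\<eta> t) = \<bar>s - t\<bar>"
    using T unfolding geodesic_segment_def by blast
  define \<zeta> where "\<zeta> u = (if u \<le> d x y then \<gamma> u else \<eta> (u - d x y))" for u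
  have gM: "\<gamma> s \<in> M" if "s \<in> {0..d x y}" for s using g that by blast
  have hM: "\<eta> s \<in> M" if "s \<in> {0..d y z}" for s using h that by blast
  have xyz: "x \<in> M" "y \<in> M" "z \<in> M"
    using gM[of 0] hM[of 0] hM[of "d y z"] g h by auto
  have cross: "d (\<gamma> s) (\<eta> t) = d x y - s + t" if s: "s \<in> {0..d x y}" and t: "t \<in> {0..d y z}" for s t
  proof (rule antisym)
    have "d (\<gamma> s) (\<eta> t) \<le> d (\<gamma> s) y + d y (\<eta> t)"
      using gM[OF s] hM[OF t] xyz by (intro triangle)
    also have "d (\<gamma> s) y = d x y - s" using gi[OF s, of "d x y"] s g by auto
    also have "d y (\<eta> t) = t" using hi[of 0 t] t h by auto
    finally show "d (\<gamma> s) (\<eta> t) \<le> d x y - s + t" .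
    have "d x z \<le> d x (\<gamma> s) + d (\<gamma> s) z" using gM[OF s] xyz by (intro triangle)
    also have "d (\<gamma> s) z \<le> d (\<gamma> s) (\<eta> t) + d (\<eta> t) z" using gM[OF s] hM[OF t] xyz by (intro triangle)
    also have "d x (\<gamma> s) = s" using gi[of 0 s] s g by auto
    also have "d (\<eta> t) z = d y z - t" using hi[of t "d y z"] t h by auto
    finally show "d x y - s + t \<le> d (\<gamma> s) (\<eta> t)" using add by simp
  qed
  have iso: "d (\<zeta> s) (\<zeta> t) = \<bar>s - t\<bar>" if "s \<in> {0..d x z}" "t \<in> {0..d x z}" for s t
  proof (cases "s \<le> d x y"; cases "t \<le> d x y")
    assume "s \<le> d x y" "t \<le> d x y"
    then show ?thesis using gi that by (simp add: \<zeta>_def)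
  next
    assume *: "s \<le> d x y" "\<not> t \<le> d x y"
    then show ?thesis using cross[of s "t - d x y"] that add by (simp add: \<zeta>_def)
  next
    assume *: "\<not> s \<le> d x y" "t \<le> d x y"
    then show ?thesis using cross[of t "s - d x y"] that add by (simp add: \<zeta>_def commute)
  next
    assume *: "\<not> s \<le> d x y" "\<not> t \<le> d x y"
    then show ?thesis using hi[of "s - d x y" "t - d x y"] that add by (simp add: \<zeta>_def)
  qed
  have img: "\<zeta> ` {0..d x z} = S \<union> T"
  proof -
    have "{0..d x z} = {0..d x y} \<union> {d x y<..d x z}"
    proof (rule Set.set_eqI)
      fix u
      show "u \<in> {0..d x z} \<longleftrightarrow> u \<in> {0..d x y} \<union> {d x y<..d x z}"
        unfolding atLeastAtMost_iff Un_iff greaterThanAtMost_iff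
        using add nonneg[of x y] nonneg[of y z] by linarith
    qed
    moreover have "\<zeta> ` {0..d x y} = S" using g(3) by (simp add: \<zeta>_def cong: image_cong_simp)
    moreover have "T \<subseteq> S \<union> \<zeta> ` {d x y<..d x z}"
    proof
      fix p assume "p \<in> T"
      then obtain t where t: "t \<in> {0..d y z}" "p = \<eta> t" using h by auto
      \<comment> \<open>The half-open interval misses the time \<open>d x y\<close>, whose point
        \<open>y\<close> already belongs to \<open>S\<close>.\<close>
      show "p \<in> S \<union> \<zeta> ` {d x y<..d x z}"
      proof (cases "t = 0")
        case True
        then have "p = \<gamma> (d x y)" using t g h by simp
        moreover have "\<gamma> (d x y) \<in> \<gamma> ` {0..d x y}" by (rule imageI) simp
        ultimately show ?thesis using g(3) by blast
      next
        case False
        then have "p = \<zeta> (t + d x y)" "t + d x y \<in> {d x y<..d x z}" using t add by (auto simp: \<zeta>_def)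
        then show ?thesis by blast
      qed
    qed
    moreover have "\<zeta> ` {d x y<..d x z} \<subseteq> T" using h add by (auto simp: \<zeta>_def)
    ultimately have "\<zeta> ` {0..d x z} = S \<union> \<zeta> ` {d x y<..d x z}" "\<zeta> ` {d x y<..d x z} \<subseteq> T"
        "T \<subseteq> S \<union> \<zeta> ` {d x y<..d x z}"
      by (simp_all only: image_Un)
    then show ?thesis by blast
  qed
  have "\<zeta> 0 = x" using g by (simp add: \<zeta>_def)
  moreover have "\<zeta> (d x z) = z"
  proof (cases "y = z")
    case True
    then show ?thesis using g(2) by (simp add: \<zeta>_def)
  next
    case False
    then have "\<not> d x z \<le> d x y" using add nonneg[of y z] zero[OF xyz(2,3)] by linarith
    then show ?thesis using h(2) add by (simp add: \<zeta>_def)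
  qed
  ultimately show ?thesis
    unfolding geodesic_segment_def using iso img g(4) h(4) by (intro exI[of _ \<zeta>]) auto
qed

text \<open>\<open>D_step\<close> makes an integer-valued metric the path metric of a graph, the one
  whose edges join the pairs at distance one.\<close>

locale integer_path_metric =
  fixes A :: "'a set" and D :: "'a \<Rightarrow> 'a \<Rightarrow> nat"
  assumes D_zero: "x \<in> A \<Longrightarrow> y \<in> A \<Longrightarrow> D x y = 0 \<longleftrightarrow> x = y"
    and D_commute: "x \<in> A \<Longrightarrow> y \<in> A \<Longrightarrow> D x y = D y x"
    and D_triangle: "x \<in> A \<Longrightarrow> y \<in> A \<Longrightarrow> z \<in> A \<Longrightarrow> D x z \<le> D x y + D y z"
    and D_step: "x \<in> A \<Longrightarrow> y \<in> A \<Longrightarrow> D x y = Suc n \<Longrightarrow> \<exists>z\<in>A. D x z = n \<and> D z y = 1"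
begin

lemma integer_geodesic:
  assumes "x \<in> A" "y \<in> A"
  shows "\<exists>z. z 0 = x \<and> z (D x y) = y \<and> (\<forall>i\<le>D x y. z i \<in> A) \<and>
    (\<forall>i j. i \<le> j \<and> j \<le> D x y \<longrightarrow> D (z i) (z j) = j - i)"
proof -
  have "\<exists>z. z 0 = x \<and> z n = y \<and> (\<forall>i\<le>n. z i \<in> A) \<and> (\<forall>i j. i \<le> j \<and> j \<le> n \<longrightarrow> D (z i) (z j) = j - i)"
    if "D x y = n" "y \<in> A" for n y
    using that
  proof (induction n arbitrary: y)
    case 0
    then have "x = y" using D_zero assms by simp
    then show ?case using assms D_zero[of x x] by (intro exI[of _ "\<lambda>_. x"]) auto
  next
    case (Suc n)
    obtain w where w: "w \<in> A" "D x w = n" "D w y = 1" using D_step[of x y n] Suc.prems assms by blast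
    obtain z where z: "z 0 = x" "z n = w" "\<forall>i\<le>n. z i \<in> A" "\<And>i j. i \<le> j \<and> j \<le> n \<Longrightarrow> D (z i) (z j) = j - i"
      using Suc.IH[OF w(2,1)] by blast
    define z' where "z' i = (if i \<le> n then z i else y)" for i
    have last: "D (z i) y = Suc n - i" if "i \<le> n" for i
    proof -
      have "D (z i) y \<le> D (z i) (z n) + D w y" using D_triangle[of "z i" w y] z that w Suc.prems by auto
      moreover have "D x y \<le> D (z 0) (z i) + D (z i) y" using D_triangle[of x "z i" y] z that assms Suc.prems by auto
      ultimately show ?thesis using z(4)[of i n] z(4)[of 0 i] that w Suc.prems by simp
    qed
    have "D (z' i) (z' j) = j - i" if "i \<le> j" "j \<le> Suc n" for i j
      using that z(4)[of i j] last[of i] D_zero[of y y] Suc.prems by (auto simp: z'_def le_Suc_eq)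
    then show ?case using z Suc.prems by (intro exI[of _ z']) (auto simp: z'_def)
  qed
  then show ?thesis using assms by blast
qed

text \<open>A point of the realisation is encoded by its distances to the vertices.\<close>

definition seg :: "'a \<Rightarrow> 'a \<Rightarrow> real \<Rightarrow> 'a \<Rightarrow> real" where
  "seg a b t = (\<lambda>z. if z \<in> A then min (t + D a z) (1 - t + D b z) else 0)"

definition vertex :: "'a \<Rightarrow> 'a \<Rightarrow> real" where
  "vertex a = (\<lambda>z. if z \<in> A then real (D a z) else 0)"

definition edge :: "'a \<Rightarrow> 'a \<Rightarrow> ('a \<Rightarrow> real) set" where
  "edge a b = seg a b ` {0..1}"

definition realisation :: "('a \<Rightarrow> real) set" where
  "realisation = vertex ` A \<union> (\<Union>(a, b)\<in>{(a, b). a \<in> A \<and> b \<in> A \<and> D a b = 1}. edge a b)"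

text \<open>Equality is an alternative of its own because in a graph with one vertex no edge
  contains that vertex.\<close>

definition coedge :: "('a \<Rightarrow> real) \<Rightarrow> ('a \<Rightarrow> real) \<Rightarrow> bool" where
  "coedge f g \<longleftrightarrow> f = g \<or> (\<exists>a\<in>A. \<exists>b\<in>A. D a b = 1 \<and> f \<in> edge a b \<and> g \<in> edge a b)"

text \<open>On a common edge the distance is that of the parameters, and an end of the edge attains
  the supremum. Otherwise a shortest path runs through some vertex \<open>z\<close>, which gives the
  infimum; the supremum would only be a lower bound there. The value 0 elsewhere keeps
  \<open>rdist\<close> symmetric and non-negative for all arguments, as \<open>Metric_space\<close>
  demands.\<close>

definition rdist :: "('a \<Rightarrow> real) \<Rightarrow> ('a \<Rightarrow> real) \<Rightarrow> real" where
  "rdist f g = (if f \<in> realisation \<and> g \<in> realisation then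
     if coedge f g then SUP z\<in>A. \<bar>f z - g z\<bar> else INF z\<in>A. f z + g z else 0)"

section \<open>Distances between points and vertices of the realisation\<close>

lemma seg_swap: "seg a b t = seg b a (1 - t)"
  by (auto simp: seg_def fun_eq_iff min.commute)

lemma edge_swap: "edge a b = edge b a"
proof -
  have "edge a b \<subseteq> edge b a" for a b
    unfolding edge_def
  proof
    fix f assume "f \<in> seg a b ` {0..1}"
    then obtain t where "t \<in> {0..1}" "f = seg b a (1 - t)" using seg_swap[of a b] by auto
    then show "f \<in> seg b a ` {0..1}" by auto
  qed
  then show ?thesis by blast
qed

lemma seg_0: "a \<in> A \<Longrightarrow> b \<in> A \<Longrightarrow> D a b = 1 \<Longrightarrow> seg a b 0 = vertex a"
  using D_triangle[of a b] by (force simp: seg_def vertex_def fun_eq_iff min_def)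

lemma seg_1: "a \<in> A \<Longrightarrow> b \<in> A \<Longrightarrow> D a b = 1 \<Longrightarrow> seg a b 1 = vertex b"
  using seg_swap[of a b 1] seg_0[of b a] D_commute by simp

lemma realisation_cases:
  assumes "f \<in> realisation"
  obtains a where "a \<in> A" "f = vertex a"
  | a b t where "a \<in> A" "b \<in> A" "D a b = 1" "t \<in> {0..1}" "f = seg a b t"
  using assms unfolding realisation_def edge_def by auto

lemma edge_realisation: "a \<in> A \<Longrightarrow> b \<in> A \<Longrightarrow> D a b = 1 \<Longrightarrow> t \<in> {0..1} \<Longrightarrow> seg a b t \<in> realisation"
  unfolding realisation_def edge_def by blast

lemma vertex_realisation: "a \<in> A \<Longrightarrow> vertex a \<in> realisation"
  unfolding realisation_def by auto

lemma realisation_lipschitz: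
  assumes "f \<in> realisation" "x \<in> A" "y \<in> A"
  shows "f x \<le> f y + real (D x y)"
  using assms(1)
proof (cases rule: realisation_cases)
  case (1 a)
  then show ?thesis using D_triangle[of a y x] D_commute[of x y] assms by (auto simp: vertex_def)
next
  case (2 a b t)
  then show ?thesis using D_triangle[of a y x] D_triangle[of b y x] D_commute[of x y] assms
    by (auto simp: seg_def min_def)
qed

text \<open>A triangle inequality through a point that need not be a vertex. If \<open>x\<close> and
  \<open>y\<close> are reached through different ends of the edge, then \<open>t\<close> and
  \<open>1 - t\<close> add up to the length of the edge.\<close>

lemma realisation_opposite:
  assumes "f \<in> realisation" "x \<in> A" "y \<in> A"
  shows "real (D x y) \<le> f x + f y"
  using assms(1)
proof (cases rule: realisation_cases)
  case (1 a)
  then show ?thesis using D_triangle[of x a y] D_commute[of x a] assms by (auto simp: vertex_def)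
next
  case (2 a b t)
  have "D x y \<le> D a x + D a y" "D x y \<le> D b x + D b y"
    "D x y \<le> D a x + 1 + D b y" "D x y \<le> D b x + 1 + D a y"
    using D_triangle[of x a y] D_commute[of x a] D_triangle[of x b y] D_commute[of x b]
      D_triangle[of a b y] D_triangle[of b a y] D_commute[of a b] 2 assms(2,3) by linarith+
  moreover have "f x = t + D a x \<or> f x = 1 - t + D b x" "f y = t + D a y \<or> f y = 1 - t + D b y"
    using 2 assms(2,3) by (auto simp: seg_def min_def)
  ultimately show ?thesis using 2(4) by auto
qed

lemma realisation_outside: "f \<in> realisation \<Longrightarrow> x \<notin> A \<Longrightarrow> f x = 0"
  by (erule realisation_cases) (auto simp: vertex_def seg_def)

text \<open>Every way from a point to a vertex starts through one of two ends. A vertex counts as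
  both of its own ends, so that vertices and inner points of edges can be treated alike.\<close>

lemma realisation_ends:
  assumes "f \<in> realisation"
  obtains a b where "a \<in> A" "b \<in> A" "\<And>z. z \<in> A \<Longrightarrow> f z = f a + D a z \<or> f z = f b + D b z"
    "coedge f (vertex a)" "coedge f (vertex b)"
  using assms
proof (cases rule: realisation_cases)
  case (1 a)
  show ?thesis by (rule that[of a a]) (use 1 D_zero[of a a] in \<open>auto simp: vertex_def coedge_def\<close>)
next
  case (2 a b t)
  have "f \<in> edge a b" "vertex a \<in> edge a b" "vertex b \<in> edge a b"
    unfolding edge_def using 2 seg_0[of a b] seg_1[of a b]
    by (auto intro: image_eqI[of _ _ 0] image_eqI[of _ _ 1])
  then have "coedge f (vertex a)" "coedge f (vertex b)"
    unfolding coedge_def using 2 by blast+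
  then show ?thesis
    using 2 D_zero[of a a] D_zero[of b b] D_commute[of a b]
    by (intro that[of a b]) (auto simp: seg_def min_def)
qed

text \<open>\<open>A\<close> may be infinite, but as \<open>g\<close> is 1-Lipschitz on
  \<open>A\<close>, no vertex does better than the better one of the two ends of
  \<open>f\<close>.\<close>

lemma INF_attained:
  assumes "f \<in> realisation" "g \<in> realisation"
  obtains c where "c \<in> A" "coedge f (vertex c)" "(INF z\<in>A. f z + g z) = f c + g c"
    "\<And>z. z \<in> A \<Longrightarrow> f c + g c \<le> f z + g z"
proof -
  obtain a b where ab: "a \<in> A" "b \<in> A" "\<And>z. z \<in> A \<Longrightarrow> f z = f a + D a z \<or> f z = f b + D b z"
    "coedge f (vertex a)" "coedge f (vertex b)"
    using realisation_ends[OF assms(1)] by blast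
  define c where "c = (if f a + g a \<le> f b + g b then a else b)"
  have c: "c \<in> A" "coedge f (vertex c)" using ab by (auto simp: c_def)
  have le: "f c + g c \<le> f z + g z" if "z \<in> A" for z
    using ab(3)[OF that] realisation_lipschitz[OF assms(2) ab(1) that]
      realisation_lipschitz[OF assms(2) ab(2) that] by (auto simp: c_def)
  have "(INF z\<in>A. f z + g z) = f c + g c"
    using c le by (intro cInf_eq_minimum) auto
  then show ?thesis using that c le by blast
qed

lemma seg_diff:
  assumes "a \<in> A" "b \<in> A" "D a b = 1" "t \<in> {0..1}" "s \<in> {0..1}"
  shows "(SUP z\<in>A. \<bar>seg a b t z - seg a b s z\<bar>) = \<bar>t - s\<bar>"
  using assms D_zero[of a a] D_commute[of a b]
  by (intro cSup_eq_maximum) (auto simp: seg_def min_def intro!: image_eqI[of _ _ a])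

lemma rdist_seg:
  assumes "a \<in> A" "b \<in> A" "D a b = 1" "t \<in> {0..1}" "s \<in> {0..1}"
  shows "rdist (seg a b t) (seg a b s) = \<bar>t - s\<bar>"
proof -
  have "coedge (seg a b t) (seg a b s)" using assms unfolding coedge_def edge_def by blast
  then show ?thesis using assms seg_diff[OF assms] by (simp add: rdist_def edge_realisation)
qed

lemma rdist_same: assumes "f \<in> realisation" shows "rdist f f = 0"
proof -
  have "A \<noteq> {}" using assms unfolding realisation_def by auto
  then show ?thesis using assms by (simp add: rdist_def coedge_def)
qed

lemma coedge_cases:
  assumes "f \<in> realisation" "g \<in> realisation" "coedge f g"
  obtains "f = g" "rdist f g = 0"
  | a b t s where "a \<in> A" "b \<in> A" "D a b = 1" "t \<in> {0..1}" "s \<in> {0..1}" "f = seg a b t" "g = seg a b s"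
     "rdist f g = \<bar>t - s\<bar>"
  using assms rdist_same rdist_seg unfolding coedge_def edge_def by blast

lemma rdist_commute: "rdist f g = rdist g f"
proof -
  have "coedge f g = coedge g f" by (auto simp: coedge_def)
  then show ?thesis by (simp add: rdist_def abs_minus_commute add.commute)
qed

lemma rdist_ge:
  assumes "f \<in> realisation" "g \<in> realisation" "z \<in> A"
  shows "f z \<le> rdist f g + g z"
proof (cases "coedge f g")
  case True
  show ?thesis
    using coedge_cases[OF assms(1,2) True]
  proof cases
    case (2 a b t s)
    then show ?thesis by (auto simp: seg_def min_def)
  qed simp
next
  case False
  obtain c where c: "c \<in> A" "(INF z\<in>A. f z + g z) = f c + g c"
    using INF_attained[OF assms(1,2)] by blast
  have "f z \<le> f c + D z c" using realisation_lipschitz assms c by blast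
  moreover have "D z c \<le> g z + g c" using realisation_opposite assms c by blast
  ultimately show ?thesis using False c assms by (simp add: rdist_def)
qed

lemma rdist_le:
  assumes "f \<in> realisation" "g \<in> realisation" "w \<in> A"
  shows "rdist f g \<le> f w + g w"
proof (cases "coedge f g")
  case True
  have "(SUP z\<in>A. \<bar>f z - g z\<bar>) \<le> f w + g w"
  proof (rule cSUP_least)
    fix z assume z: "z \<in> A"
    show "\<bar>f z - g z\<bar> \<le> f w + g w"
      using realisation_lipschitz[OF assms(1) z assms(3)] realisation_lipschitz[OF assms(2) z assms(3)]
        realisation_opposite[OF assms(1) z assms(3)] realisation_opposite[OF assms(2) z assms(3)] by linarith
  qed (use assms in auto)
  then show ?thesis using True assms by (simp add: rdist_def)
next
  case False
  obtain c where "(INF z\<in>A. f z + g z) = f c + g c" "\<And>z. z \<in> A \<Longrightarrow> f c + g c \<le> f z + g z"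
    using INF_attained[OF assms(1,2)] by blast
  then show ?thesis using False assms by (simp add: rdist_def)
qed

lemma rdist_nonneg: "rdist f g \<ge> 0"
proof (cases "f \<in> realisation \<and> g \<in> realisation")
  case True
  then obtain z where "z \<in> A" unfolding realisation_def by auto
  then show ?thesis using rdist_ge[of f g z] rdist_ge[of g f z] True rdist_commute[of f g] by auto
qed (auto simp: rdist_def)

lemma rdist_vertex:
  assumes "f \<in> realisation" "c \<in> A"
  shows "rdist f (vertex c) = f c"
proof (rule antisym)
  show "rdist f (vertex c) \<le> f c"
    using rdist_le[OF assms(1) vertex_realisation[OF assms(2)] assms(2)] assms D_zero[of c c]
    by (simp add: vertex_def)
  show "f c \<le> rdist f (vertex c)"
    using rdist_ge[OF assms(1) vertex_realisation[OF assms(2)] assms(2)] assms D_zero[of c c]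
    by (simp add: vertex_def)
qed

lemma rdist_vertices: "a \<in> A \<Longrightarrow> b \<in> A \<Longrightarrow> rdist (vertex a) (vertex b) = D a b"
  using rdist_vertex[of "vertex a" b] by (simp add: vertex_realisation) (simp add: vertex_def)

text \<open>An interior point of an edge determines the edge: its endpoints are the vertices at distance
  less than one.\<close>

lemma interior_edge:
  assumes "a \<in> A" "b \<in> A" "D a b = 1" "t \<in> {0<..<1}"
    and "c \<in> A" "e \<in> A" "D c e = 1" "s \<in> {0..1}" and eq: "seg a b t = seg c e s"
  shows "edge a b = edge c e"
proof -
  have near: "{z \<in> A. seg a b t z < 1} \<subseteq> {a, b}" if "a \<in> A" "b \<in> A" "t \<in> {0..1}" for a b t
  proof
    fix z assume "z \<in> {z \<in> A. seg a b t z < 1}"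
    then have z: "z \<in> A" "min (t + D a z) (1 - t + D b z) < 1" by (auto simp: seg_def)
    then have "real (D a z) < 1 \<or> real (D b z) < 1" using that by (auto simp: min_def split: if_splits)
    then have "D a z = 0 \<or> D b z = 0" by linarith
    then show "z \<in> {a, b}" using D_zero that z by auto
  qed
  have "seg a b t a < 1" "seg a b t b < 1"
    using assms(1-4) D_zero[of a a] D_zero[of b b] by (auto simp: seg_def)
  then have "{a, b} \<subseteq> {z \<in> A. seg c e s z < 1}" using assms(1,2) unfolding eq by blast
  then have "{a, b} \<subseteq> {c, e}" using near[of c e s] assms by blast
  moreover have "a \<noteq> b" using assms D_zero by force
  ultimately have "a = c \<and> b = e \<or> a = e \<and> b = c" by auto
  then show ?thesis using edge_swap by auto
qed

text \<open>If \<open>g\<close> shares no edge with \<open>f\<close>, or none with \<open>h\<close>,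
  a shortest path between the two passes through a vertex, and the triangle inequality through
  vertices suffices. Otherwise \<open>g\<close> is a vertex, or it is inner to an edge, which is
  then unique by \<open>interior_edge\<close> and contains all three points.\<close>

lemma rdist_triangle:
  assumes f: "f \<in> realisation" and g: "g \<in> realisation" and h: "h \<in> realisation"
  shows "rdist f h \<le> rdist f g + rdist g h"
proof -
  have noncoedge: "rdist f h \<le> rdist f g + rdist g h"
    if "\<not> coedge f g" and f: "f \<in> realisation" and g: "g \<in> realisation" and h: "h \<in> realisation" for f g h
  proof -
    obtain c where c: "c \<in> A" "(INF z\<in>A. f z + g z) = f c + g c" using INF_attained[OF f g] by blast
    have "rdist f g = f c + g c" using that c by (simp add: rdist_def)
    moreover have "rdist f h \<le> f c + h c" using rdist_le f h c by blast
    moreover have "h c \<le> rdist g h + g c" using rdist_ge[OF h g c(1)] rdist_commute[of g h] by simp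
    ultimately show ?thesis by simp
  qed
  consider "\<not> coedge f g" | "\<not> coedge g h" | "coedge f g" "coedge g h" by blast
  then show ?thesis
  proof cases
    case 1
    then show ?thesis using noncoedge f g h by blast
  next
    case 2
    then have "\<not> coedge h g" by (auto simp: coedge_def)
    then show ?thesis using noncoedge[of h g f] f g h rdist_commute[of h f] rdist_commute[of g f] rdist_commute[of h g] by simp
  next
    case 3
    have via: "rdist f h \<le> rdist f g + rdist g h" if "g = vertex c" "c \<in> A" for c
      using rdist_vertex[OF f that(2)] rdist_vertex[OF h that(2)] rdist_le[OF f h that(2)] that rdist_commute[of g h] by simp
    show ?thesis
      using coedge_cases[OF f g 3(1)]
    proof cases
      case fg: (2 a b t s)
      show ?thesis
        using coedge_cases[OF g h 3(2)]
      proof cases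
        case gh: (2 c e t' s')
        show ?thesis
        proof (cases "s \<in> {0<..<1}")
          case True
          have "edge a b = edge c e"
            using interior_edge[of a b s c e t'] fg gh True by auto
          then have "h \<in> edge a b" using gh by (auto simp: edge_def)
          then obtain u where u: "u \<in> {0..1}" "h = seg a b u" by (auto simp: edge_def)
          show ?thesis using rdist_seg[of a b] fg u by auto
        next
          case False
          then have "s = 0 \<or> s = 1" using fg by auto
          then show ?thesis using via seg_0[of a b] seg_1[of a b] fg by metis
        qed
      qed (use rdist_nonneg in auto)
    qed (use rdist_nonneg in auto)
  qed
qed

section \<open>The realisation is a geodesic metric space\<close>

lemma realisation_metric: "Metric_space realisation rdist"
proof
  fix f g assume fg: "f \<in> realisation" "g \<in> realisation"
  show "rdist f g = 0 \<longleftrightarrow> f = g"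
  proof
    assume "rdist f g = 0"
    then have "f z = g z" if "z \<in> A" for z
      using rdist_ge[OF fg that] rdist_ge[OF fg(2,1) that] rdist_commute[of f g] by auto
    then show "f = g" using realisation_outside fg by (metis ext)
  qed (use rdist_same fg in auto)
qed (use rdist_nonneg rdist_commute rdist_triangle in auto)

lemma coedge_geodesic:
  assumes fg: "f \<in> realisation" "g \<in> realisation" "coedge f g"
  shows "\<exists>S. geodesic_segment realisation rdist f g S"
  using coedge_cases[OF fg]
proof cases
  case 1
  then show ?thesis using geodesic_segment_refl[OF realisation_metric] fg by auto
next
  case (2 a b t s)
  have "\<exists>S. geodesic_segment realisation rdist (seg a b t) (seg a b s) S"
    if "a \<in> A" "b \<in> A" "D a b = 1" "t \<in> {0..1}" "s \<in> {0..1}" "t \<le> s" for a b t s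
  proof -
    have d: "rdist (seg a b t) (seg a b s) = s - t" using rdist_seg that by auto
    have "(\<lambda>u. seg a b (t + u)) ` {0..s - t} \<subseteq> realisation" using edge_realisation that by auto
    moreover have "rdist (seg a b (t + u)) (seg a b (t + v)) = \<bar>u - v\<bar>" if "u \<in> {0..s-t}" "v \<in> {0..s-t}" for u v
      using rdist_seg[of a b "t + u" "t + v"] that \<open>a \<in> A\<close> \<open>b \<in> A\<close> \<open>D a b = 1\<close> \<open>t \<in> {0..1}\<close> \<open>s \<in> {0..1}\<close> by auto
    ultimately show ?thesis
      unfolding geodesic_segment_def d by (intro exI[of _ "\<lambda>u. seg a b (t + u)"] exI conjI refl) auto
  qed note * = this
  show ?thesis
  proof (cases "t \<le> s")
    case True
    then show ?thesis using *[of a b t s] 2 by auto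
  next
    case False
    have "D b a = 1" using 2 D_commute by simp
    then show ?thesis using *[of b a "1 - t" "1 - s"] 2 False seg_swap[of a b t] seg_swap[of a b s] by auto
  qed
qed

lemma vertex_geodesic:
  assumes "a \<in> A" "b \<in> A"
  shows "\<exists>S. geodesic_segment realisation rdist (vertex a) (vertex b) S"
proof -
  have "\<exists>S. geodesic_segment realisation rdist (vertex a) (vertex b) S" if "D a b = n" "b \<in> A" for n b
    using that
  proof (induction n arbitrary: b)
    case 0
    then have "b = a" using D_zero assms by auto
    then show ?case using geodesic_segment_refl[OF realisation_metric] vertex_realisation assms by blast
  next
    case (Suc n)
    obtain c where c: "c \<in> A" "D a c = n" "D c b = 1" using D_step[of a b n] Suc assms by blast
    obtain S where S: "geodesic_segment realisation rdist (vertex a) (vertex c) S" using Suc.IH c by blast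
    have "coedge (vertex c) (vertex b)"
      unfolding coedge_def edge_def using c Suc.prems seg_0[of c b] seg_1[of c b]
      by (metis atLeastAtMost_iff image_eqI order.refl zero_le_one)
    then obtain T where T: "geodesic_segment realisation rdist (vertex c) (vertex b) T"
      using coedge_geodesic vertex_realisation c Suc.prems by blast
    have "rdist (vertex a) (vertex b) = rdist (vertex a) (vertex c) + rdist (vertex c) (vertex b)"
      using rdist_vertices assms c Suc.prems by simp
    then have "geodesic_segment realisation rdist (vertex a) (vertex b) (S \<union> T)"
      by (rule geodesic_segment_concat[OF realisation_metric S T])
    then show ?case by blast
  qed
  then show ?thesis using assms by blast
qed

text \<open>Off a common edge, a geodesic goes from \<open>f\<close> to the end \<open>c\<close>
  that attains the infimum, along the graph to the end \<open>e\<close> of \<open>g\<close> through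
  which \<open>c\<close> is reached, and from there to \<open>g\<close>.\<close>

lemma realisation_geodesic: "geodesic_space realisation rdist"
  unfolding geodesic_space_def
proof (intro conjI ballI)
  show "Metric_space realisation rdist" by (rule realisation_metric)
  fix f g assume fg: "f \<in> realisation" "g \<in> realisation"
  show "\<exists>S. geodesic_segment realisation rdist f g S"
  proof (cases "coedge f g")
    case True
    then show ?thesis using coedge_geodesic fg by blast
  next
    case False
    obtain c where c: "c \<in> A" "coedge f (vertex c)" "(INF z\<in>A. f z + g z) = f c + g c"
      using INF_attained[OF fg] by blast
    obtain a b where ab: "a \<in> A" "b \<in> A" "\<And>z. z \<in> A \<Longrightarrow> g z = g a + D a z \<or> g z = g b + D b z"
      "coedge g (vertex a)" "coedge g (vertex b)" using realisation_ends[OF fg(2)] by blast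
    then obtain e where e: "e \<in> A" "g c = g e + D e c" "coedge g (vertex e)" using c by metis
    obtain S where S: "geodesic_segment realisation rdist f (vertex c) S"
      using coedge_geodesic c fg vertex_realisation by blast
    obtain T where T: "geodesic_segment realisation rdist (vertex c) (vertex e) T"
      using vertex_geodesic c e by blast
    have "coedge (vertex e) g" using e by (auto simp: coedge_def)
    then obtain U where U: "geodesic_segment realisation rdist (vertex e) g U"
      using coedge_geodesic e fg vertex_realisation by blast
    have ce: "rdist (vertex c) g = rdist (vertex c) (vertex e) + rdist (vertex e) g"
      using rdist_vertices[OF e(1) c(1)] rdist_vertex fg e c rdist_commute[of "vertex c"] rdist_commute[of "vertex e" g] by simp
    have "rdist f g = f c + g c" using False c fg by (simp add: rdist_def)
    then have "rdist f g = rdist f (vertex c) + rdist (vertex c) g"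
      using rdist_vertex fg c rdist_commute[of "vertex c" g] by simp
    moreover have "geodesic_segment realisation rdist (vertex c) g (T \<union> U)"
      by (rule geodesic_segment_concat[OF realisation_metric T U]) (rule ce)
    ultimately have "geodesic_segment realisation rdist f g (S \<union> (T \<union> U))"
      using geodesic_segment_concat[OF realisation_metric S] by simp
    then show ?thesis by blast
  qed
qed

lemma vertex_dense:
  assumes "f \<in> realisation"
  shows "\<exists>a\<in>A. rdist f (vertex a) \<le> 1"
  using assms
proof (cases rule: realisation_cases)
  case (1 a)
  then show ?thesis using rdist_same assms by (intro bexI[of _ a]) auto
next
  case (2 a b t)
  then show ?thesis using rdist_vertex[OF assms, of a] D_zero[of a a] by (intro bexI[of _ a]) (auto simp: seg_def)
qed

end

section \<open>Hyperbolicity from coarse bottlenecks\<close>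

definition chain_rel :: "'a set \<Rightarrow> ('a \<Rightarrow> 'a \<Rightarrow> real) \<Rightarrow> real \<Rightarrow> ('a \<times> 'a) set" where
  "chain_rel B d c = {(u, v). u \<in> B \<and> v \<in> B \<and> d u v \<le> c}"

lemma rtrancl_crossing:
  assumes "(x, y) \<in> R\<^sup>*" "P x" "\<not> P y"
  obtains a b where "(a, b) \<in> R" "P a" "\<not> P b"
  using assms by (induction rule: rtrancl_induct) auto

lemma chain_rel_sym:
  assumes "\<And>u v. d u v = d v u" "(x, y) \<in> (chain_rel B d c)\<^sup>*"
  shows "(y, x) \<in> (chain_rel B d c)\<^sup>*"
proof -
  have "sym (chain_rel B d c)" using assms(1) by (auto simp: sym_def chain_rel_def)
  then show ?thesis using assms(2) by (meson sym_rtrancl symD)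
qed

lemma chain_rel_mono: "B \<subseteq> B' \<Longrightarrow> (x, y) \<in> (chain_rel B d c)\<^sup>* \<Longrightarrow> (x, y) \<in> (chain_rel B' d c)\<^sup>*"
  by (rule subsetD[OF rtrancl_mono]) (auto simp: chain_rel_def)

lemma geodesic_segment_subset: "geodesic_segment M d p q S \<Longrightarrow> S \<subseteq> M"
  unfolding geodesic_segment_def by blast

lemma geodesic_segment_endpoints:
  assumes "geodesic_segment M d p q S" "Metric_space M d"
  shows "p \<in> S" "q \<in> S"
proof -
  obtain \<gamma> where "\<gamma> 0 = p" "\<gamma> (d p q) = q" "\<gamma> ` {0..d p q} = S"
    using assms(1) unfolding geodesic_segment_def by blast
  moreover have "0 \<le> d p q" using assms(2) by (simp add: Metric_space.nonneg)
  ultimately show "p \<in> S" "q \<in> S" by (metis atLeastAtMost_iff image_eqI order.refl)+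
qed

text \<open>The geodesic is sampled at whole times. Consecutive samples are at most 1 apart and each
  is moved by at most 1 to a point of \<open>A\<close>, so the chain has steps of length at most 1 +
  1 + 1 = 3.\<close>

lemma geodesic_segment_chain:
  fixes A :: "'a set"
  assumes M: "Metric_space M d" and S: "geodesic_segment M d p q S"
    and A: "A \<subseteq> M" and dense: "\<And>z. z \<in> M \<Longrightarrow> \<exists>a\<in>A. d z a \<le> 1"
    and x: "x \<in> A" "d p x \<le> 1" and y: "y \<in> A" "d q y \<le> 1"
  shows "(x, y) \<in> (chain_rel {a \<in> A. \<exists>s\<in>S. d s a \<le> 1} d 3)\<^sup>*"
proof -
  interpret Metric_space M d by fact
  let ?B = "{a \<in> A. \<exists>s\<in>S. d s a \<le> 1}"
  obtain \<gamma> where g: "\<gamma> 0 = p" "\<gamma> (d p q) = q" "\<gamma> ` {0..d p q} = S" "S \<subseteq> M"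
    and gi: "\<And>s t. s \<in> {0..d p q} \<Longrightarrow> t \<in> {0..d p q} \<Longrightarrow> d (\<gamma> s) (\<gamma> t) = \<bar>s - t\<bar>"
    using S unfolding geodesic_segment_def by blast
  have gS: "\<gamma> t \<in> S" if "t \<in> {0..d p q}" for t using g(3) that by blast
  have step: "(u, v) \<in> chain_rel ?B d 3"
    if "s \<in> {0..d p q}" "t \<in> {0..d p q}" "\<bar>s - t\<bar> \<le> 1" "u \<in> A" "d (\<gamma> s) u \<le> 1" "v \<in> A" "d (\<gamma> t) v \<le> 1"
    for s t u v
  proof -
    have "\<gamma> s \<in> M" "\<gamma> t \<in> M" "u \<in> M" "v \<in> M" using gS that g(4) A by blast+
    then have "d u v \<le> d u (\<gamma> s) + d (\<gamma> s) v" "d (\<gamma> s) v \<le> d (\<gamma> s) (\<gamma> t) + d (\<gamma> t) v"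
      using triangle by blast+
    then have "d u v \<le> 3" using that gi[of s t] commute[of u "\<gamma> s"] by linarith
    then show ?thesis using that gS unfolding chain_rel_def by blast
  qed
  have *: "(x, a) \<in> (chain_rel ?B d 3)\<^sup>*"
    if "real n \<le> d p q" "a \<in> A" "d (\<gamma> (real n)) a \<le> 1" for n a
    using that
  proof (induction n arbitrary: a)
    case 0
    have "(x, a) \<in> chain_rel ?B d 3" by (rule step[of 0 0]) (use x g(1) 0 in auto)
    then show ?case by blast
  next
    case (Suc n)
    have "\<gamma> (real n) \<in> M" using gS[of "real n"] g(4) Suc.prems by auto
    then obtain b where b: "b \<in> A" "d (\<gamma> (real n)) b \<le> 1" using dense by blast
    have "(x, b) \<in> (chain_rel ?B d 3)\<^sup>*" using Suc.IH[OF _ b] Suc.prems by simp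
    moreover have "(b, a) \<in> chain_rel ?B d 3" 
      by (rule step[of "real n" "real (Suc n)"]) (use b Suc.prems in auto)
    ultimately show ?case by (rule rtrancl_into_rtrancl)
  qed
  \<comment> \<open>After the last whole time a piece of length at most one remains up to
    \<open>q\<close>.\<close>
  define n where "n = nat \<lfloor>d p q\<rfloor>"
  have n: "real n \<le> d p q" "d p q - real n \<le> 1" using nonneg[of p q] unfolding n_def by linarith+
  have "\<gamma> (real n) \<in> M" using gS[of "real n"] g(4) n by auto
  then obtain b where b: "b \<in> A" "d (\<gamma> (real n)) b \<le> 1" using dense by blast
  have "(b, y) \<in> chain_rel ?B d 3" by (rule step[of "real n" "d p q"]) (use b n y g(2) in auto)
  then show ?thesis using *[OF n(1) b] by (meson rtrancl_into_rtrancl)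
qed

text \<open>A geodesic stays close to the path \<open>Z\<close> of bottlenecks, and \<open>Z\<close> stays close to the two other sides.\<close>

lemma hyperbolic_of_bottleneck:
  fixes A :: "'a set"
  assumes M: "Metric_space M d" and A: "A \<subseteq> M" and dense: "\<And>z. z \<in> M \<Longrightarrow> \<exists>a\<in>A. d z a \<le> 1"
    and bottleneck: "\<And>x y. x \<in> A \<Longrightarrow> y \<in> A \<Longrightarrow> \<exists>Z\<subseteq>A. x \<in> Z \<and> (x, y) \<in> (chain_rel Z d 1)\<^sup>* \<and>
      (\<forall>z\<in>Z. \<forall>B\<subseteq>A. x \<in> B \<longrightarrow> (x, y) \<in> (chain_rel B d 3)\<^sup>* \<longrightarrow> (\<exists>u\<in>B. d z u \<le> 6))"
  shows "hyperbolic 30 M d"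
  unfolding hyperbolic_def
proof (intro ballI allI impI)
  interpret Metric_space M d by fact
  fix x y z S T U p
  assume xyz: "x \<in> M" "y \<in> M" "z \<in> M" and p: "p \<in> S"
    and STU: "geodesic_segment M d x y S \<and> geodesic_segment M d y z T \<and> geodesic_segment M d x z U"
  obtain a b c where abc: "a \<in> A" "d x a \<le> 1" "b \<in> A" "d y b \<le> 1" "c \<in> A" "d z c \<le> 1"
    using dense xyz by meson
  define near where "near = (\<lambda>S. {a \<in> A. \<exists>s\<in>S. d s a \<le> 1})"
  have S': "(a, b) \<in> (chain_rel (near S) d 3)\<^sup>*" "(b, c) \<in> (chain_rel (near T) d 3)\<^sup>*"
    "(a, c) \<in> (chain_rel (near U) d 3)\<^sup>*"
    unfolding near_def using geodesic_segment_chain[OF M _ A dense] STU abc by blast+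
  have sub: "near S \<subseteq> near (S \<union> S')" "near S' \<subseteq> near (S \<union> S')" "near S \<subseteq> A" for S S' by (auto simp: near_def)
  \<comment> \<open>The other two sides together form a chain from \<open>a\<close> to
    \<open>b\<close> by way of \<open>c\<close>, and the bottlenecks apply to it as well.\<close>
  have ab: "(a, b) \<in> (chain_rel (near (T \<union> U)) d 3)\<^sup>*"
    using chain_rel_mono[OF sub(2) S'(3)] chain_rel_mono[OF sub(1) chain_rel_sym[OF commute S'(2)]]
    by (metis rtrancl_trans)
  obtain Z where Z: "Z \<subseteq> A" "a \<in> Z" "(a, b) \<in> (chain_rel Z d 1)\<^sup>*"
    and bn: "\<forall>z\<in>Z. \<forall>B\<subseteq>A. a \<in> B \<longrightarrow> (a, b) \<in> (chain_rel B d 3)\<^sup>* \<longrightarrow> (\<exists>u\<in>B. d z u \<le> 6)"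
    using bottleneck[OF abc(1,3)] by (elim exE conjE) (rule that)
  have neck: "\<exists>u\<in>B. d z u \<le> 6"
    if "z \<in> Z" "B \<subseteq> A" "a \<in> B" "(a, b) \<in> (chain_rel B d 3)\<^sup>*" for z B
    using bn that by simp
  have aS: "a \<in> near S" "a \<in> near (T \<union> U)"
    using geodesic_segment_endpoints[OF _ M] STU abc unfolding near_def by blast+
  obtain \<gamma> where g: "\<gamma> 0 = x" "\<gamma> (d x y) = y" "\<gamma> ` {0..d x y} = S" "S \<subseteq> M"
    and gi: "\<And>s t. s \<in> {0..d x y} \<Longrightarrow> t \<in> {0..d x y} \<Longrightarrow> d (\<gamma> s) (\<gamma> t) = \<bar>s - t\<bar>"
    using conjunct1[OF STU] unfolding geodesic_segment_def by blast
  have gM: "\<gamma> t \<in> M" if "t \<in> {0..d x y}" for t using g(3,4) that by blast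
  obtain t where t: "t \<in> {0..d x y}" "p = \<gamma> t" using p g(3) by blast
  have Zs: "\<exists>s\<in>{0..d x y}. d (\<gamma> s) v \<le> 7" if v: "v \<in> Z" for v
  proof -
    obtain u where u: "u \<in> near S" "d v u \<le> 6" using neck[OF v sub(3) aS(1) S'(1)] by blast
    then obtain s where s: "s \<in> {0..d x y}" "d (\<gamma> s) u \<le> 1" "u \<in> A" unfolding near_def using g(3) by blast
    have "\<gamma> s \<in> M" "u \<in> M" "v \<in> M" using gM s A v Z by blast+
    then have "d (\<gamma> s) v \<le> d (\<gamma> s) u + d v u" using triangle[of "\<gamma> s" u v] commute[of u v] by simp
    then show ?thesis using s u by (intro bexI[of _ s]) auto
  qed
  \<comment> \<open>Every point of \<open>Z\<close> is within 7 of the geodesic. Unless the end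
    \<open>b\<close> is already near a time before \<open>t\<close>, some step of \<open>Z\<close>
    leads from a point near a time up to \<open>t\<close> to one near a later time. These times are
    at most 7 + 1 + 7 = 15 apart with \<open>t\<close> between them, so \<open>p\<close> is within
    15 + 7 of \<open>Z\<close>.\<close>
  have "\<exists>v\<in>Z. d p v \<le> 22"
  proof (cases "\<exists>s\<in>{0..t}. d (\<gamma> s) b \<le> 7")
    case True
    then obtain s where s: "s \<in> {0..t}" "d (\<gamma> s) b \<le> 7" by blast
    have bZ: "b \<in> Z" using Z(3,2) by (cases rule: rtranclE) (auto simp: chain_rel_def)
    have M': "\<gamma> s \<in> M" "y \<in> M" "b \<in> M" "p \<in> M" using gM[of s] gM[of t] s t xyz abc A by auto
    have "d (\<gamma> s) y \<le> d (\<gamma> s) b + d y b" using triangle[of "\<gamma> s" b y] commute[of y b] M' by simp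
    moreover have "d (\<gamma> s) y = d x y - s" using gi[of s "d x y"] g(2) s t by simp
    moreover have "d p (\<gamma> s) = t - s" using gi[of t s] s t by simp
    moreover have "d p b \<le> d p (\<gamma> s) + d (\<gamma> s) b" using triangle M' by blast
    ultimately have "d p b \<le> 22" using s t abc by auto
    then show ?thesis using bZ by blast
  next
    case False
    moreover have "\<exists>s\<in>{0..t}. d (\<gamma> s) a \<le> 7" using abc g(1) t by (intro bexI[of _ 0]) auto
    ultimately obtain v w where vw: "(v, w) \<in> chain_rel Z d 1" "\<exists>s\<in>{0..t}. d (\<gamma> s) v \<le> 7"
      "\<not> (\<exists>s\<in>{0..t}. d (\<gamma> s) w \<le> 7)" using rtrancl_crossing[OF Z(3), of "\<lambda>v. \<exists>s\<in>{0..t}. d (\<gamma> s) v \<le> 7"] by blast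
    then obtain s where s: "s \<in> {0..t}" "d (\<gamma> s) v \<le> 7" by blast
    have vwZ: "v \<in> Z" "w \<in> Z" "d v w \<le> 1" using vw(1) by (auto simp: chain_rel_def)
    obtain s' where s': "s' \<in> {0..d x y}" "d (\<gamma> s') w \<le> 7" using Zs[OF vwZ(2)] by blast
    then have "s' > t" using vw(3) by force
    have M': "\<gamma> s \<in> M" "\<gamma> s' \<in> M" "v \<in> M" "w \<in> M" "p \<in> M" using gM[of s] gM[of s'] gM[of t] s s' t vwZ Z A by auto
    have "d (\<gamma> s) (\<gamma> s') = s' - s" using gi[of s s'] s s' t \<open>s' > t\<close> by auto
    moreover have "d (\<gamma> s) (\<gamma> s') \<le> d (\<gamma> s) v + d v (\<gamma> s')" using triangle M' by blast
    moreover have "d v (\<gamma> s') \<le> d v w + d (\<gamma> s') w" using triangle[of v w "\<gamma> s'"] commute[of w "\<gamma> s'"] M' by simp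
    moreover have "d p (\<gamma> s) = t - s" using gi[of t s] s t by simp
    moreover have "d p v \<le> d p (\<gamma> s) + d (\<gamma> s) v" using triangle M' by blast
    ultimately have "d p v \<le> 22" using s s' vwZ \<open>s' > t\<close> by auto
    then show ?thesis using vwZ by blast
  qed
  then obtain v where v: "v \<in> Z" "d p v \<le> 22" by blast
  obtain u where u: "u \<in> near (T \<union> U)" "d v u \<le> 6" using neck[OF v(1) sub(3) aS(2) ab] by blast
  then obtain q where q: "q \<in> T \<union> U" "d q u \<le> 1" "u \<in> A" unfolding near_def by blast
  have "T \<subseteq> M" "U \<subseteq> M" using STU by (auto dest: geodesic_segment_subset)
  then have M': "p \<in> M" "v \<in> M" "u \<in> M" "q \<in> M"
    using gM[OF t(1)] t(2) v(1) Z(1) A q(1,3) by auto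
  \<comment> \<open>From \<open>p\<close> to \<open>Z\<close>, to the chain along the other sides
    and to these sides themselves: 22 + 6 + 1.\<close>
  have "d p q \<le> d p v + d v q" "d v q \<le> d v u + d u q" using triangle M' by blast+
  then have "d p q \<le> 30" using v u q commute[of u q] by simp
  then show "\<exists>q\<in>T \<union> U. d p q \<le> 30" using q by blast
qed

section \<open>Word metrics\<close>

text \<open>As \<open>T\<close> contains the neutral element, \<open>ball n\<close> consists of the
  words of length at most \<open>n\<close>, not exactly \<open>n\<close>.\<close>

locale word_metric = group G for G (structure) +
  fixes T :: "'a set"
  assumes T_carrier: "T \<subseteq> carrier G" and one_T: "\<one> \<in> T" and inv_T: "t \<in> T \<Longrightarrow> inv t \<in> T"
begin

primrec ball :: "nat \<Rightarrow> 'a set" where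
  "ball 0 = {\<one>}"
| "ball (Suc n) = {x \<otimes> t | x t. x \<in> ball n \<and> t \<in> T}"

text \<open>Meaningful only for elements of some ball, since \<open>T\<close> may generate a proper
  subgroup, as the cone elements of \<open>par \<Lambda>\<close> do; this is the reason for the
  premises about balls below.\<close>

definition wlen :: "'a \<Rightarrow> nat" where
  "wlen x = (LEAST n. x \<in> ball n)"

lemma cancel [simp]:
  "x \<in> carrier G \<Longrightarrow> y \<in> carrier G \<Longrightarrow> x \<otimes> (inv x \<otimes> y) = y"
  "x \<in> carrier G \<Longrightarrow> y \<in> carrier G \<Longrightarrow> inv x \<otimes> (x \<otimes> y) = y"
  by (simp_all flip: m_assoc)

lemma ball_carrier: "x \<in> ball n \<Longrightarrow> x \<in> carrier G"
  by (induction n arbitrary: x) (use T_carrier in auto)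

lemma ball_step: "x \<in> ball n \<Longrightarrow> t \<in> T \<Longrightarrow> x \<otimes> t \<in> ball (Suc n)"
  by auto

lemma ball_mono: "m \<le> n \<Longrightarrow> x \<in> ball m \<Longrightarrow> x \<in> ball n"
proof (induction n rule: dec_induct)
  case (step n)
  then show ?case using ball_step[of x n \<one>] one_T ball_carrier[of x n] by simp
qed simp

lemma ball_1: "t \<in> T \<Longrightarrow> t \<in> ball (Suc 0)"
  using ball_step[of \<one> 0 t] T_carrier ball.simps(1) by (simp add: subset_iff del: ball.simps)

lemma ball_add: "x \<in> ball m \<Longrightarrow> y \<in> ball n \<Longrightarrow> x \<otimes> y \<in> ball (m + n)"
proof (induction n arbitrary: y)
  case (Suc n)
  then obtain y' t where y: "y = y' \<otimes> t" "y' \<in> ball n" "t \<in> T" by auto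
  then have "x \<otimes> y = x \<otimes> y' \<otimes> t" using Suc.prems ball_carrier T_carrier by (simp add: m_assoc subset_iff)
  then show ?case using Suc.IH[OF Suc.prems(1) y(2)] y(3) ball_step[of "x \<otimes> y'" "m + n" t] by simp
qed (use ball_carrier in auto)

lemma ball_inv: "x \<in> ball n \<Longrightarrow> inv x \<in> ball n"
proof (induction n arbitrary: x)
  case (Suc n)
  then obtain y t where y: "x = y \<otimes> t" "y \<in> ball n" "t \<in> T" by auto
  then have "inv x = inv t \<otimes> inv y" using ball_carrier T_carrier by (simp add: inv_mult_group subset_iff)
  then show ?case using ball_add[OF ball_1[OF inv_T[OF y(3)]] Suc.IH[OF y(2)]] by simp
qed simp

lemma wlen_le: "x \<in> ball n \<Longrightarrow> wlen x \<le> n"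
  unfolding wlen_def by (rule Least_le)

lemma ball_wlen: "x \<in> ball n \<Longrightarrow> x \<in> ball (wlen x)"
  unfolding wlen_def by (rule LeastI)

lemma wlen_one: "wlen \<one> = 0"
  using wlen_le[of \<one> 0] by simp

lemma wlen_eq_0: "x \<in> ball n \<Longrightarrow> wlen x = 0 \<longleftrightarrow> x = \<one>"
  using ball_wlen[of x n] wlen_one by auto

lemma wlen_inv: "x \<in> carrier G \<Longrightarrow> wlen (inv x) = wlen x"
proof -
  assume x: "x \<in> carrier G"
  then have "inv x \<in> ball n \<longleftrightarrow> x \<in> ball n" for n using ball_inv[of x n] ball_inv[of "inv x" n] by auto
  then show ?thesis by (simp add: wlen_def)
qed

lemma wlen_mult: "x \<in> ball m \<Longrightarrow> y \<in> ball n \<Longrightarrow> wlen (x \<otimes> y) \<le> wlen x + wlen y"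
  using wlen_le[OF ball_add[OF ball_wlen ball_wlen]] .

lemma ball_Suc_E:
  assumes "x \<in> ball n" "wlen x = Suc k"
  obtains y t where "x = y \<otimes> t" "y \<in> ball k" "t \<in> T" "wlen y = k" "wlen t = 1"
proof -
  have "x \<in> ball (Suc k)" using ball_wlen[OF assms(1)] assms(2) by simp
  then obtain y t where y: "x = y \<otimes> t" "y \<in> ball k" "t \<in> T" by auto
  have "wlen x \<le> wlen y + wlen t" using wlen_mult[OF y(2) ball_1[OF y(3)]] y(1) by simp
  then have "wlen y = k" "wlen t = 1" using wlen_le[OF y(2)] wlen_le[OF ball_1[OF y(3)]] assms(2) by auto
  then show ?thesis using that y by blast
qed

lemma path_metric:
  assumes P: "subgroup P G" and TP: "T \<subseteq> P" and gen: "\<And>x. x \<in> P \<Longrightarrow> \<exists>n. x \<in> ball n"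
  shows "integer_path_metric P (\<lambda>x y. wlen (inv x \<otimes> y))"
proof -
  have Pc: "x \<in> carrier G" if "x \<in> P" for x using subgroup.mem_carrier[OF P that] .
  have cl: "inv x \<otimes> y \<in> P" "x \<otimes> y \<in> P" if "x \<in> P" "y \<in> P" for x y
    using that by (simp_all add: subgroup.m_closed[OF P] subgroup.m_inv_closed[OF P])
  show ?thesis
  proof
    fix x y assume xy: "x \<in> P" "y \<in> P"
    obtain n where n: "inv x \<otimes> y \<in> ball n" using gen[OF cl(1)[OF xy]] by blast
    have "inv x \<otimes> y = \<one> \<longleftrightarrow> x = y"
    proof
      assume "inv x \<otimes> y = \<one>"
      then have "x \<otimes> (inv x \<otimes> y) = x" using xy Pc by simp
      then show "x = y" using xy Pc by simp
    qed (use xy Pc in simp)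
    then show "wlen (inv x \<otimes> y) = 0 \<longleftrightarrow> x = y" using wlen_eq_0[OF n] by simp
    show "wlen (inv x \<otimes> y) = wlen (inv y \<otimes> x)"
      using wlen_inv[of "inv x \<otimes> y"] xy Pc by (simp add: inv_mult_group)
    show "\<exists>z\<in>P. wlen (inv x \<otimes> z) = k \<and> wlen (inv z \<otimes> y) = 1" if k: "wlen (inv x \<otimes> y) = Suc k" for k
    proof -
      obtain w t where w: "inv x \<otimes> y = w \<otimes> t" "w \<in> ball k" "t \<in> T" "wlen w = k" "wlen t = 1"
        using ball_Suc_E[OF n k] by blast
      have c: "x \<in> carrier G" "y \<in> carrier G" "w \<in> carrier G" "t \<in> carrier G" "t \<in> P"
        using xy Pc w ball_carrier T_carrier TP by auto
      have "w = inv x \<otimes> y \<otimes> inv t" using w(1) c by (simp add: m_assoc)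
      then have "w \<in> P" using xy cl c P by (simp add: subgroup.m_inv_closed)
      moreover have "wlen (inv x \<otimes> (x \<otimes> w)) = k" using c w by simp
      moreover have "wlen (inv (x \<otimes> w) \<otimes> y) = 1"
        using c w(1,5) by (simp add: inv_mult_group m_assoc)
      ultimately show ?thesis using cl(2)[of x w] xy(1) by blast
    qed
    fix z assume z: "z \<in> P"
    obtain n where n: "inv x \<otimes> y \<in> ball n" using gen[OF cl(1)[OF xy]] by blast
    obtain m where m: "inv y \<otimes> z \<in> ball m" using gen[OF cl(1)[OF xy(2) z]] by blast
    have "inv x \<otimes> z = (inv x \<otimes> y) \<otimes> (inv y \<otimes> z)" using xy z Pc by (simp add: m_assoc)
    then show "wlen (inv x \<otimes> z) \<le> wlen (inv x \<otimes> y) + wlen (inv y \<otimes> z)"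
      using wlen_mult[OF n m] by simp
  qed
qed

end

section \<open>Parabolic subgroups and gates\<close>

locale vertex_subgroups = group G for G (structure) +
  fixes V :: "'v set" and adj :: "'v \<Rightarrow> 'v \<Rightarrow> bool" and S :: "'v \<Rightarrow> 'a set"
  assumes finite_V: "finite V"
    and adj_sym: "adj u v \<Longrightarrow> adj v u"
    and adj_irrefl: "\<not> adj v v"
    and S_subgroup: "v \<in> V \<Longrightarrow> subgroup (S v) G"
    and S_comm: "u \<in> V \<Longrightarrow> v \<in> V \<Longrightarrow> adj u v \<Longrightarrow> s \<in> S u \<Longrightarrow> t \<in> S v \<Longrightarrow> s \<otimes> t = t \<otimes> s"
begin

text \<open>Letters are appended on the right, which is how gates are computed later: the inductions
  over words read them from left to right.\<close>

inductive_set par :: "'v set \<Rightarrow> 'a set" for \<Lambda> where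
  par_one: "\<one> \<in> par \<Lambda>"
| par_step: "x \<in> par \<Lambda> \<Longrightarrow> v \<in> \<Lambda> \<Longrightarrow> v \<in> V \<Longrightarrow> s \<in> S v \<Longrightarrow> x \<otimes> s \<in> par \<Lambda>"

definition lk :: "'v set \<Rightarrow> 'v set" where
  "lk \<Lambda> = {w \<in> V. \<forall>v\<in>\<Lambda>. adj v w}"

definition st :: "'v set \<Rightarrow> 'v set" where
  "st \<Lambda> = \<Lambda> \<union> lk \<Lambda>"

lemma cancel [simp]:
  "x \<in> carrier G \<Longrightarrow> y \<in> carrier G \<Longrightarrow> x \<otimes> (inv x \<otimes> y) = y"
  "x \<in> carrier G \<Longrightarrow> y \<in> carrier G \<Longrightarrow> inv x \<otimes> (x \<otimes> y) = y"
  by (simp_all flip: m_assoc)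

lemma S_carrier [intro]: "v \<in> V \<Longrightarrow> s \<in> S v \<Longrightarrow> s \<in> carrier G"
  using subgroup.mem_carrier[OF S_subgroup] .

lemma par_carrier [intro]: "x \<in> par \<Lambda> \<Longrightarrow> x \<in> carrier G"
  by (induction rule: par.induct) auto

lemma par_letter: "v \<in> \<Lambda> \<Longrightarrow> v \<in> V \<Longrightarrow> s \<in> S v \<Longrightarrow> s \<in> par \<Lambda>"
  using par_step[OF par_one, of v \<Lambda> s] S_carrier by simp

lemma par_mult: "y \<in> par \<Lambda> \<Longrightarrow> x \<in> par \<Lambda> \<Longrightarrow> x \<otimes> y \<in> par \<Lambda>"
proof (induction rule: par.induct)
  case (par_step y v s)
  then have "x \<otimes> (y \<otimes> s) = x \<otimes> y \<otimes> s" using par_carrier S_carrier by (simp add: m_assoc)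
  then show ?case using par_step par.par_step[of "x \<otimes> y"] by simp
qed (use par_carrier in auto)

lemma par_inv: "x \<in> par \<Lambda> \<Longrightarrow> inv x \<in> par \<Lambda>"
proof (induction rule: par.induct)
  case (par_step x v s)
  then have "inv s \<in> par \<Lambda>" using par_letter subgroup.m_inv_closed[OF S_subgroup] by auto
  moreover have "inv (x \<otimes> s) = inv s \<otimes> inv x" using par_step par_carrier S_carrier by (simp add: inv_mult_group)
  ultimately show ?case using par_step par_mult by simp
qed (simp add: par_one)

lemma par_subgroup: "subgroup (par \<Lambda>) G"
  by (rule subgroupI) (use par_carrier par_one par_inv par_mult in blast)+

lemma par_mono: "\<Lambda> \<subseteq> \<Omega> \<Longrightarrow> x \<in> par \<Lambda> \<Longrightarrow> x \<in> par \<Omega>"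
  by (rotate_tac, induction rule: par.induct) (auto intro: par.intros)

lemma par_empty: "x \<in> par {} \<Longrightarrow> x = \<one>"
  by (induction rule: par.induct) auto

lemma par_comm:
  assumes "y \<in> par B" "x \<in> par A" and adj: "\<And>v w. v \<in> A \<Longrightarrow> w \<in> B \<Longrightarrow> v \<in> V \<Longrightarrow> w \<in> V \<Longrightarrow> adj v w"
  shows "x \<otimes> y = y \<otimes> x"
proof -
  have letter: "s \<otimes> y = y \<otimes> s" if "v \<in> A" "v \<in> V" "s \<in> S v" "y \<in> par B" for v s y
    using that(4)
  proof (induction rule: par.induct)
    case (par_step y w t)
    have c: "s \<in> carrier G" "y \<in> carrier G" "t \<in> carrier G" using that par_step par_carrier S_carrier by auto
    have "s \<otimes> (y \<otimes> t) = y \<otimes> (s \<otimes> t)" using par_step.IH c by (simp flip: m_assoc)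
    also have "s \<otimes> t = t \<otimes> s" using S_comm adj that par_step by blast
    finally show ?case using c by (simp add: m_assoc)
  qed (use that S_carrier in auto)
  show ?thesis using assms(2)
  proof (induction rule: par.induct)
    case (par_step x v s)
    have c: "s \<in> carrier G" "y \<in> carrier G" "x \<in> carrier G" using assms(1) par_step par_carrier S_carrier by auto
    have "x \<otimes> s \<otimes> y = (x \<otimes> y) \<otimes> s" using letter[OF par_step(2-4) assms(1)] c by (simp add: m_assoc)
    then show ?case using par_step.IH c by (simp add: m_assoc)
  qed (use assms(1) par_carrier in auto)
qed

lemma par_lk_comm: "x \<in> par \<Lambda> \<Longrightarrow> y \<in> par (lk \<Lambda>) \<Longrightarrow> x \<otimes> y = y \<otimes> x"
  by (rule par_comm) (auto simp: lk_def)

lemma par_join: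
  assumes "x \<in> par \<Omega>" "\<Omega> \<subseteq> A \<union> B" and adj: "\<And>v w. v \<in> A \<Longrightarrow> w \<in> B \<Longrightarrow> v \<in> V \<Longrightarrow> w \<in> V \<Longrightarrow> adj v w"
  obtains a b where "a \<in> par A" "b \<in> par B" "x = a \<otimes> b"
proof -
  have "\<exists>a\<in>par A. \<exists>b\<in>par B. x = a \<otimes> b"
    using assms(1)
  proof (induction rule: par.induct)
    case par_one
    then show ?case using par.par_one by (metis one_closed r_one)
  next
    case (par_step x v s)
    then obtain a b where ab: "a \<in> par A" "b \<in> par B" "x = a \<otimes> b" by blast
    have c: "a \<in> carrier G" "b \<in> carrier G" "s \<in> carrier G" using ab par_step par_carrier S_carrier by auto
    show ?case
    proof (cases "v \<in> A")
      case True
      then have s: "s \<in> par A" using par_letter par_step by blast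
      have "x \<otimes> s = (a \<otimes> s) \<otimes> b" using par_comm[OF ab(2) s adj] ab(3) c by (simp add: m_assoc)
      then show ?thesis using ab par_mult[OF s] by blast
    next
      case False
      then have "s \<in> par B" using par_letter par_step assms(2) by blast
      moreover have "x \<otimes> s = a \<otimes> (b \<otimes> s)" using ab(3) c by (simp add: m_assoc)
      ultimately show ?thesis using ab par_mult[of s] by blast
    qed
  qed
  then show ?thesis using that by blast
qed

lemma par_st:
  assumes "x \<in> par (st \<Lambda>)"
  obtains a b where "a \<in> par \<Lambda>" "b \<in> par (lk \<Lambda>)" "x = a \<otimes> b"
  using par_join[OF assms, of \<Lambda> "lk \<Lambda>"] by (auto simp: st_def lk_def)

lemma lk_disjoint: "\<Lambda> \<inter> lk \<Lambda> = {}"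
  using adj_irrefl by (auto simp: lk_def)

lemma lk_antimono: "\<Lambda> \<subseteq> \<Omega> \<Longrightarrow> lk \<Omega> \<subseteq> lk \<Lambda>"
  by (auto simp: lk_def)

lemma st_lk_subset: "v \<in> \<Lambda> \<Longrightarrow> lk \<Lambda> \<subseteq> st {v}"
  by (auto simp: lk_def st_def)

end

text \<open>\<open>gate_exists\<close> stands in for normal forms: the rule that updates a gate when
  a letter is appended gives the same value for all words of an element. It fails, for instance, if
  one infinite cyclic group is used as the subgroup of two non-adjacent vertices.\<close>

locale gated_group = vertex_subgroups G V adj S
  for G :: "('a, 'm) monoid_scheme" (structure) and V :: "'v set" and adj and S :: "'v \<Rightarrow> 'a set" +
  assumes generated: "carrier G = par V"
    and gate_exists: "\<exists>\<gamma>. \<gamma> \<one> = \<one> \<and> (\<forall>x\<in>carrier G. \<forall>v\<in>V. \<forall>s\<in>S v. \<gamma> (x \<otimes> s) =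
      (if v \<in> \<Lambda> \<and> inv (\<gamma> x) \<otimes> x \<in> par (st {v}) then \<gamma> x \<otimes> s else \<gamma> x))"
begin

text \<open>\<open>gate \<Lambda> x\<close> is the point of \<open>par \<Lambda>\<close> closest to \<open>x\<close>, that is, the maximal prefix of \<open>x\<close> in \<open>par \<Lambda>\<close>.\<close>

definition gate :: "'v set \<Rightarrow> 'a \<Rightarrow> 'a" where
  "gate \<Lambda> = (SOME \<gamma>. \<gamma> \<one> = \<one> \<and> (\<forall>x\<in>carrier G. \<forall>v\<in>V. \<forall>s\<in>S v. \<gamma> (x \<otimes> s) =
      (if v \<in> \<Lambda> \<and> inv (\<gamma> x) \<otimes> x \<in> par (st {v}) then \<gamma> x \<otimes> s else \<gamma> x)))"

definition res :: "'v set \<Rightarrow> 'a \<Rightarrow> 'a" where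
  "res \<Lambda> x = inv (gate \<Lambda> x) \<otimes> x"

lemma gate_spec: "gate \<Lambda> \<one> = \<one> \<and> (\<forall>x\<in>carrier G. \<forall>v\<in>V. \<forall>s\<in>S v. gate \<Lambda> (x \<otimes> s) =
      (if v \<in> \<Lambda> \<and> inv (gate \<Lambda> x) \<otimes> x \<in> par (st {v}) then gate \<Lambda> x \<otimes> s else gate \<Lambda> x))"
  unfolding gate_def by (rule someI_ex[OF gate_exists])

lemma gate_one [simp]: "gate \<Lambda> \<one> = \<one>"
  using gate_spec by blast

lemma gate_step: "x \<in> carrier G \<Longrightarrow> v \<in> V \<Longrightarrow> s \<in> S v \<Longrightarrow> gate \<Lambda> (x \<otimes> s) =
      (if v \<in> \<Lambda> \<and> res \<Lambda> x \<in> par (st {v}) then gate \<Lambda> x \<otimes> s else gate \<Lambda> x)"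
  unfolding res_def using gate_spec by blast

section \<open>The algebra of gates and residues\<close>

lemma carrier_induct [consumes 1, case_names one step]:
  assumes "x \<in> carrier G" "P \<one>"
    and "\<And>x v s. x \<in> carrier G \<Longrightarrow> P x \<Longrightarrow> v \<in> V \<Longrightarrow> s \<in> S v \<Longrightarrow> s \<in> carrier G \<Longrightarrow> P (x \<otimes> s)"
  shows "P x"
proof -
  have "x \<in> par V" using assms(1) generated by simp
  then show ?thesis using assms(2,3) by (induction rule: par.induct) auto
qed

lemma gate_par: "x \<in> carrier G \<Longrightarrow> gate \<Lambda> x \<in> par \<Lambda>"
  by (induction rule: carrier_induct) (auto simp: gate_step intro: par.intros)

lemma gate_carrier [simp]: "x \<in> carrier G \<Longrightarrow> gate \<Lambda> x \<in> carrier G"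
  using gate_par par_carrier by blast

lemma res_carrier [simp]: "x \<in> carrier G \<Longrightarrow> res \<Lambda> x \<in> carrier G"
  by (simp add: res_def)

lemma gate_res: "x \<in> carrier G \<Longrightarrow> gate \<Lambda> x \<otimes> res \<Lambda> x = x"
  by (simp add: res_def)

text \<open>A letter changes the gate either not at all or, if its vertex lies in
  \<open>\<Lambda>\<close>, by that same letter.\<close>

lemma gate_diff:
  assumes "y \<in> par \<Omega>" "x \<in> carrier G"
  shows "inv (gate \<Lambda> x) \<otimes> gate \<Lambda> (x \<otimes> y) \<in> par (\<Lambda> \<inter> \<Omega>)"
  using assms(1)
proof (induction rule: par.induct)
  case par_one
  then show ?case using assms by (simp add: par.par_one)
next
  case (par_step y v s)
  have c: "y \<in> carrier G" "s \<in> carrier G" using par_step par_carrier S_carrier by auto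
  have g: "gate \<Lambda> (x \<otimes> (y \<otimes> s)) = gate \<Lambda> (x \<otimes> y \<otimes> s)" using assms c by (simp add: m_assoc)
  have "gate \<Lambda> (x \<otimes> y \<otimes> s) = gate \<Lambda> (x \<otimes> y) \<or> (v \<in> \<Lambda> \<and> gate \<Lambda> (x \<otimes> y \<otimes> s) = gate \<Lambda> (x \<otimes> y) \<otimes> s)"
    using gate_step[of "x \<otimes> y" v s \<Lambda>] assms c par_step by auto
  then show ?case
  proof
    assume *: "v \<in> \<Lambda> \<and> gate \<Lambda> (x \<otimes> y \<otimes> s) = gate \<Lambda> (x \<otimes> y) \<otimes> s"
    then have "inv (gate \<Lambda> x) \<otimes> gate \<Lambda> (x \<otimes> (y \<otimes> s)) = inv (gate \<Lambda> x) \<otimes> gate \<Lambda> (x \<otimes> y) \<otimes> s"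
      unfolding g using assms c by (simp add: m_assoc)
    then show ?thesis using par.par_step[OF par_step.IH, of v s] * par_step by simp
  qed (use par_step.IH g in simp)
qed

lemma gate_id: "x \<in> par \<Lambda> \<Longrightarrow> gate \<Lambda> x = x"
proof (induction rule: par.induct)
  case (par_step x v s)
  then have "res \<Lambda> x = \<one>" using par_carrier by (simp add: res_def)
  then show ?case using gate_step[of x v s \<Lambda>] par_step par_carrier par_one by auto
qed simp

text \<open>The test in \<open>gate_step\<close> depends only on the residue, and the residue does
  not change under left multiplication by \<open>par \<Lambda>\<close>; both sides therefore obey
  the same recursion.\<close>

lemma gate_left: "x \<in> carrier G \<Longrightarrow> h \<in> par \<Lambda> \<Longrightarrow> gate \<Lambda> (h \<otimes> x) = h \<otimes> gate \<Lambda> x"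
proof (induction rule: carrier_induct)
  case one
  then show ?case using gate_id par_carrier by simp
next
  case (step x v s)
  have h: "h \<in> carrier G" using step par_carrier by blast
  have r: "res \<Lambda> (h \<otimes> x) = res \<Lambda> x"
    using step h by (simp add: res_def inv_mult_group m_assoc)
  have "gate \<Lambda> (h \<otimes> (x \<otimes> s)) = gate \<Lambda> (h \<otimes> x \<otimes> s)" using step h by (simp add: m_assoc)
  also have "\<dots> = h \<otimes> gate \<Lambda> (x \<otimes> s)"
    using gate_step[of "h \<otimes> x" v s \<Lambda>] gate_step[of x v s \<Lambda>] step h r by (simp add: m_assoc)
  finally show ?case .
qed

lemma res_left: "x \<in> carrier G \<Longrightarrow> h \<in> par \<Lambda> \<Longrightarrow> res \<Lambda> (h \<otimes> x) = res \<Lambda> x"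
  using par_carrier by (simp add: res_def gate_left inv_mult_group m_assoc)

lemma gate_of_res: "x \<in> carrier G \<Longrightarrow> gate \<Lambda> (res \<Lambda> x) = \<one>"
  unfolding res_def by (simp add: gate_left par_inv gate_par)

lemma res_id: "b \<in> carrier G \<Longrightarrow> gate \<Lambda> b = \<one> \<Longrightarrow> res \<Lambda> b = b"
  by (simp add: res_def)

text \<open>Spell \<open>x\<close> with letters of \<open>\<Omega>\<close>: by
  \<open>gate_diff\<close> its gate on \<open>par \<Lambda>\<close>, which is \<open>x\<close>
  itself, is spelled with letters of both sets.\<close>

lemma par_inter: "x \<in> par \<Lambda> \<Longrightarrow> x \<in> par \<Omega> \<Longrightarrow> x \<in> par (\<Lambda> \<inter> \<Omega>)"
  using gate_diff[of x \<Omega> \<one> \<Lambda>] gate_id[of x \<Lambda>] par_carrier by simp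

lemma gate_in: "x \<in> par \<Omega> \<Longrightarrow> gate \<Lambda> x \<in> par (\<Lambda> \<inter> \<Omega>)"
  using gate_diff[of x \<Omega> \<one> \<Lambda>] par_carrier[of x \<Omega>] by simp

text \<open>\<open>k\<close> commutes with the gate, so it only multiplies the residue. As it
  belongs to the star subgroup of every vertex of \<open>\<Lambda>\<close>, no test in
  \<open>gate_step\<close> changes its outcome.\<close>

lemma gate_lk: "x \<in> carrier G \<Longrightarrow> k \<in> par (lk \<Lambda>) \<Longrightarrow> gate \<Lambda> (k \<otimes> x) = gate \<Lambda> x"
proof (induction rule: carrier_induct)
  case one
  then have "gate \<Lambda> k \<in> par {}" using gate_in[of k "lk \<Lambda>" \<Lambda>] lk_disjoint by simp
  then have "gate \<Lambda> k = \<one>" by (rule par_empty)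
  then show ?case using par_carrier[OF one] by simp
next
  case (step x v s)
  have k: "k \<in> carrier G" using step par_carrier by blast
  have comm: "inv (gate \<Lambda> x) \<otimes> k = k \<otimes> inv (gate \<Lambda> x)"
    by (rule par_lk_comm[of _ \<Lambda>]) (use step gate_par par_inv in auto)
  have r: "res \<Lambda> (k \<otimes> x) = k \<otimes> res \<Lambda> x"
  proof -
    have "res \<Lambda> (k \<otimes> x) = (inv (gate \<Lambda> x) \<otimes> k) \<otimes> x" using step k by (simp add: res_def m_assoc)
    then show ?thesis using comm step k by (simp add: res_def m_assoc)
  qed
  have "k \<otimes> res \<Lambda> x \<in> par (st {v}) \<longleftrightarrow> res \<Lambda> x \<in> par (st {v})" if "v \<in> \<Lambda>"
  proof -
    have "k \<in> par (st {v})" using par_mono[OF st_lk_subset[OF that]] step by blast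
    then show ?thesis using par_mult[of "res \<Lambda> x" "st {v}" k] par_mult[of "k \<otimes> res \<Lambda> x" "st {v}" "inv k"]
        par_inv[of k] step k by auto
  qed
  then have "gate \<Lambda> (k \<otimes> x \<otimes> s) = gate \<Lambda> (x \<otimes> s)"
    using gate_step[of "k \<otimes> x" v s \<Lambda>] gate_step[of x v s \<Lambda>] step k r by auto
  then show ?case using step k by (simp add: m_assoc)
qed

text \<open>This is why displacements of gates depend only on a parallelism class: a change of base
  point within \<open>par (st \<Lambda>)\<close> merely translates the gates.\<close>

lemma gate_st:
  assumes "a \<in> par \<Lambda>" "k \<in> par (lk \<Lambda>)" "x \<in> carrier G"
  shows "gate \<Lambda> (a \<otimes> k \<otimes> x) = a \<otimes> gate \<Lambda> x"
  using assms gate_left[of "k \<otimes> x" a \<Lambda>] gate_lk[of x k \<Lambda>] par_carrier[OF assms(1)] par_carrier[OF assms(2)]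
  by (simp add: m_assoc)

text \<open>Split \<open>b\<close> into a part \<open>t\<close> of type \<open>v\<close> and a part
  in the link. As \<open>b\<close> has no prefix in \<open>par \<Lambda>\<close>, \<open>t\<close>
  is the inverse of the gate of the link part; thus it lies in the link subgroup too and is
  trivial.\<close>

lemma res_lk:
  assumes "v \<in> \<Lambda>" "v \<in> V" "b \<in> par (st {v})" "gate \<Lambda> b = \<one>"
  shows "b \<in> par (lk {v})"
proof -
  obtain t c where tc: "t \<in> par {v}" "c \<in> par (lk {v})" "b = t \<otimes> c" using par_st[OF assms(3)] by blast
  have carr: "t \<in> carrier G" "c \<in> carrier G" using tc par_carrier by auto
  have "t \<in> par \<Lambda>" using par_mono[of "{v}" \<Lambda> t] tc(1) assms(1) by simp
  then have "t \<otimes> gate \<Lambda> c = \<one>" using gate_left[OF carr(2)] assms(4) tc(3) by simp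
  then have "t = inv (gate \<Lambda> c)" using carr by (simp add: inv_equality[symmetric])
  moreover have "gate \<Lambda> c \<in> par (lk {v})" using par_mono[OF _ gate_in[OF tc(2), of \<Lambda>]] by blast
  ultimately have "t \<in> par (lk {v})" using par_inv by simp
  then have "t \<in> par ({v} \<inter> lk {v})" using tc(1) by (intro par_inter)
  then have "t = \<one>" using lk_disjoint par_empty by auto
  then show ?thesis using tc carr by simp
qed

lemma res_lk_iff:
  assumes "v \<in> \<Lambda>" "v \<in> V" "x \<in> carrier G"
  shows "res \<Lambda> x \<in> par (st {v}) \<longleftrightarrow> res \<Lambda> x \<in> par (lk {v})"
  using res_lk[OF assms(1,2), of "res \<Lambda> x"] gate_of_res[OF assms(3)] par_mono[of "lk {v}" "st {v}"]
  by (auto simp: st_def)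

text \<open>An appended letter is absorbed either by the gate, after commuting past the residue, or
  by the residue. From here on the gate rule is used in the form of this pair of lemmas.\<close>

lemma gate_moved:
  assumes "x \<in> carrier G" "v \<in> V" "s \<in> S v" "v \<in> \<Lambda>" "res \<Lambda> x \<in> par (lk {v})"
  shows "gate \<Lambda> (x \<otimes> s) = gate \<Lambda> x \<otimes> s" "res \<Lambda> (x \<otimes> s) = res \<Lambda> x"
proof -
  have s: "s \<in> carrier G" "s \<in> par {v}" using assms par_letter by auto
  show *: "gate \<Lambda> (x \<otimes> s) = gate \<Lambda> x \<otimes> s"
    using gate_step[OF assms(1-3), of \<Lambda>] res_lk_iff[OF assms(4,2,1)] assms by simp
  have "res \<Lambda> (x \<otimes> s) = inv s \<otimes> (res \<Lambda> x \<otimes> s)"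
    unfolding res_def * using assms s by (simp add: inv_mult_group m_assoc)
  also have "res \<Lambda> x \<otimes> s = s \<otimes> res \<Lambda> x" using par_lk_comm[OF s(2) assms(5)] by simp
  finally show "res \<Lambda> (x \<otimes> s) = res \<Lambda> x" using assms s by simp
qed

lemma gate_unmoved:
  assumes "x \<in> carrier G" "v \<in> V" "s \<in> S v" "\<not> (v \<in> \<Lambda> \<and> res \<Lambda> x \<in> par (lk {v}))"
  shows "gate \<Lambda> (x \<otimes> s) = gate \<Lambda> x" "res \<Lambda> (x \<otimes> s) = res \<Lambda> x \<otimes> s"
proof -
  show *: "gate \<Lambda> (x \<otimes> s) = gate \<Lambda> x"
    using gate_step[OF assms(1-3), of \<Lambda>] res_lk_iff[of v \<Lambda> x] assms by auto
  show "res \<Lambda> (x \<otimes> s) = res \<Lambda> x \<otimes> s"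
    unfolding res_def * using assms S_carrier by (simp add: m_assoc)
qed

text \<open>The residue for the smaller set is the product of two residues, and a letter can be
  shuffled past this product exactly if it can be shuffled past both factors. Hence the gates on
  both sides react alike.\<close>

lemma gate_subset:
  assumes "x \<in> carrier G" "\<Lambda>' \<subseteq> \<Lambda>"
  shows "gate \<Lambda>' (gate \<Lambda> x) = gate \<Lambda>' x"
  using assms(1)
proof (induction rule: carrier_induct)
  case (step x v s)
  let ?g = "gate \<Lambda> x"
  have k: "res \<Lambda>' ?g \<in> carrier G" using step by simp
  have r: "res \<Lambda>' x = res \<Lambda>' ?g \<otimes> res \<Lambda> x"
    unfolding res_def step.IH using step by (simp add: m_assoc)
  have kp: "res \<Lambda>' ?g \<in> par \<Lambda>"
    unfolding res_def using gate_par[of x \<Lambda>] gate_par[of ?g \<Lambda>'] par_mono[OF assms(2)] par_mult par_inv step by auto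
  show ?case
  proof (cases "v \<in> \<Lambda>")
    case False
    then show ?thesis using gate_step[of x v s \<Lambda>] gate_step[of x v s \<Lambda>'] step assms by auto
  next
    case True
    have iff: "res \<Lambda>' x \<in> par (st {v}) \<longleftrightarrow> res \<Lambda>' ?g \<in> par (st {v}) \<and> res \<Lambda> x \<in> par (st {v})"
    proof
      assume *: "res \<Lambda>' x \<in> par (st {v})"
      \<comment> \<open>The gate on \<open>par \<Lambda>\<close> recovers the first factor of the
        product, and taking gates does not leave the star subgroup.\<close>
      have "gate \<Lambda> (res \<Lambda>' x) = res \<Lambda>' ?g"
        unfolding r using gate_left[OF _ kp, of "res \<Lambda> x"] gate_of_res step k by simp
      then have k': "res \<Lambda>' ?g \<in> par (st {v})"
        using gate_in[OF *, of \<Lambda>] par_mono[of "\<Lambda> \<inter> st {v}" "st {v}"] by auto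
      moreover have "res \<Lambda> x = inv (res \<Lambda>' ?g) \<otimes> res \<Lambda>' x" unfolding r using step k by simp
      ultimately show "res \<Lambda>' ?g \<in> par (st {v}) \<and> res \<Lambda> x \<in> par (st {v})"
        using par_mult[OF *] par_inv by simp
    qed (use r par_mult in auto)
    show ?thesis
    proof (cases "res \<Lambda> x \<in> par (st {v})")
      case True
      then show ?thesis
        using \<open>v \<in> \<Lambda>\<close> iff gate_step[of x v s \<Lambda>] gate_step[of x v s \<Lambda>'] gate_step[of ?g v s \<Lambda>'] step by auto
    next
      case False
      then show ?thesis
        using iff gate_step[of x v s \<Lambda>] gate_step[of x v s \<Lambda>'] step by auto
    qed
  qed
qed simp

end

context gated_group
begin

lemma group_cancel [simp]:
  "x \<in> carrier G \<Longrightarrow> y \<in> carrier G \<Longrightarrow> z \<in> carrier G \<Longrightarrow> inv (x \<otimes> y) \<otimes> (x \<otimes> z) = inv y \<otimes> z"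
  by (simp add: inv_mult_group m_assoc)

lemma telescope:
  "x \<in> carrier G \<Longrightarrow> y \<in> carrier G \<Longrightarrow> z \<in> carrier G \<Longrightarrow> (inv x \<otimes> y) \<otimes> (inv y \<otimes> z) = inv x \<otimes> z"
  by (simp add: m_assoc)

lemma inv_eq_one_iff: "x \<in> carrier G \<Longrightarrow> y \<in> carrier G \<Longrightarrow> inv x \<otimes> y = \<one> \<longleftrightarrow> y = x"
  using cancel(1)[of x y] by (metis l_inv r_one)

subsection \<open>Syllable length\<close>

text \<open>The neutral element is already in every \<open>S v\<close>; inserting it covers the case
  \<open>V = {}\<close>.\<close>

definition letters :: "'a set" where
  "letters = insert \<one> (\<Union>v\<in>V. S v)"

sublocale syl: word_metric G letters
proof
  show "letters \<subseteq> carrier G" unfolding letters_def using S_carrier by blast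
  show "inv t \<in> letters" if "t \<in> letters" for t
    using that subgroup.m_inv_closed[OF S_subgroup] unfolding letters_def by force
qed (simp add: letters_def)

abbreviation len :: "'a \<Rightarrow> nat" where
  "len \<equiv> syl.wlen"

lemma letter_E:
  assumes "t \<in> letters"
  obtains "t = \<one>" | v where "v \<in> V" "t \<in> S v"
  using assms unfolding letters_def by blast

lemma carrier_ball: "x \<in> carrier G \<Longrightarrow> \<exists>n. x \<in> syl.ball n"
proof (induction rule: carrier_induct)
  case one
  then show ?case by (intro exI[of _ 0]) simp
next
  case (step x v s)
  then obtain n where "x \<in> syl.ball n" by blast
  then have "x \<otimes> s \<in> syl.ball (Suc n)" using step by (intro syl.ball_step) (auto simp: letters_def)
  then show ?case by blast
qed

lemma len_ball: "x \<in> carrier G \<Longrightarrow> x \<in> syl.ball (len x)"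
  using carrier_ball syl.ball_wlen by blast

lemma len_mult: "x \<in> carrier G \<Longrightarrow> y \<in> carrier G \<Longrightarrow> len (x \<otimes> y) \<le> len x + len y"
  by (rule syl.wlen_mult[OF len_ball len_ball])

lemma len_eq_0: "x \<in> carrier G \<Longrightarrow> len x = 0 \<longleftrightarrow> x = \<one>"
  by (rule syl.wlen_eq_0[OF len_ball])

lemma len_letter: "v \<in> V \<Longrightarrow> s \<in> S v \<Longrightarrow> len s \<le> 1"
  using syl.wlen_le[OF syl.ball_1[of s]] by (auto simp: letters_def)

text \<open>Each letter of a word for \<open>x\<close> is dealt either to the gate or to the
  residue.\<close>

lemma len_gate_ball:
  "x \<in> syl.ball n \<Longrightarrow> \<exists>i j. i + j \<le> n \<and> gate \<Lambda> x \<in> syl.ball i \<and> res \<Lambda> x \<in> syl.ball j"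
proof (induction n arbitrary: x)
  case 0
  then show ?case by (auto simp: res_def)
next
  case (Suc n)
  then obtain y t where y: "x = y \<otimes> t" "y \<in> syl.ball n" "t \<in> letters" by auto
  have yc: "y \<in> carrier G" using syl.ball_carrier y by blast
  obtain i j where ij: "i + j \<le> n" "gate \<Lambda> y \<in> syl.ball i" "res \<Lambda> y \<in> syl.ball j" using Suc.IH y by blast
  show ?case using y(3)
  proof (cases rule: letter_E)
    case 1
    then have "x = y" using y yc by simp
    then show ?thesis using ij by (intro exI[of _ i] exI[of _ j]) auto
  next
    case (2 v)
    show ?thesis
    proof (cases "v \<in> \<Lambda> \<and> res \<Lambda> y \<in> par (lk {v})")
      case True
      then have "gate \<Lambda> x = gate \<Lambda> y \<otimes> t" "res \<Lambda> x = res \<Lambda> y" using gate_moved[OF yc 2] y by auto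
      then show ?thesis using ij syl.ball_step[OF ij(2) y(3)] by (intro exI[of _ "Suc i"] exI[of _ j]) auto
    next
      case False
      then have "gate \<Lambda> x = gate \<Lambda> y" "res \<Lambda> x = res \<Lambda> y \<otimes> t" using gate_unmoved[OF yc 2] y by auto
      then show ?thesis using ij syl.ball_step[OF ij(3) y(3)] by (intro exI[of _ i] exI[of _ "Suc j"]) auto
    qed
  qed
qed

lemma len_gate: "x \<in> carrier G \<Longrightarrow> len (gate \<Lambda> x) + len (res \<Lambda> x) \<le> len x"
proof -
  assume "x \<in> carrier G"
  then obtain i j where ij: "i + j \<le> len x" "gate \<Lambda> x \<in> syl.ball i" "res \<Lambda> x \<in> syl.ball j"
    using len_gate_ball[OF len_ball, of x \<Lambda>] by blast
  then show ?thesis using syl.wlen_le[OF ij(2)] syl.wlen_le[OF ij(3)] by simp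
qed

lemma par_single: "x \<in> par {v} \<Longrightarrow> v \<in> V \<Longrightarrow> x \<in> S v"
  by (induction rule: par.induct) (auto simp: subgroup.one_closed[OF S_subgroup] subgroup.m_closed[OF S_subgroup])

text \<open>Stripping the gate of \<open>m\<close> from \<open>m \<otimes> n\<close> does not change
  the residue, which is all of \<open>m \<otimes> n\<close>. So \<open>res \<Lambda> m\<close>
  followed by \<open>n\<close> is not shorter than \<open>m \<otimes> n\<close>, and additivity of
  lengths leaves length zero for the gate of \<open>m\<close>.\<close>

lemma gate_prefix:
  assumes "m \<in> carrier G" "n \<in> carrier G" "len (m \<otimes> n) = len m + len n" "gate \<Lambda> (m \<otimes> n) = \<one>"
  shows "gate \<Lambda> m = \<one>"
proof -
  let ?e = "gate \<Lambda> m" and ?b = "res \<Lambda> m \<otimes> n"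
  have c: "?e \<in> carrier G" "?b \<in> carrier G" "res \<Lambda> m \<in> carrier G" using assms by auto
  have e: "?e \<in> par \<Lambda>" using gate_par assms by blast
  have b: "m \<otimes> n = ?e \<otimes> ?b" using gate_res[OF assms(1), of \<Lambda>] assms c by (metis m_assoc)
  have "res \<Lambda> ?b = m \<otimes> n"
    using res_left[OF c(2) e] res_id[of "m \<otimes> n" \<Lambda>] assms b by simp
  then have "len (m \<otimes> n) \<le> len ?b" using len_gate[OF c(2), of \<Lambda>] by simp
  also have "\<dots> \<le> len (res \<Lambda> m) + len n" using len_mult c assms by blast
  finally have "len m \<le> len (res \<Lambda> m)" using assms by simp
  then have "len ?e = 0" using len_gate[OF assms(1), of \<Lambda>] by simp
  then show ?thesis using len_eq_0 c by simp
qed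

text \<open>\<open>gate {v} (inv u)\<close> is the inverse of the last syllable of type
  \<open>v\<close> that can be shuffled to the end of \<open>u\<close>. Together with
  \<open>gate_of_long\<close>: a non-neutral letter of type \<open>v\<close> lengthens
  \<open>u\<close> exactly if there is no such syllable.\<close>

lemma len_mult_letter:
  assumes "u \<in> carrier G" "v \<in> V" "s \<in> S v" "s \<noteq> \<one>" "gate {v} (inv u) = \<one>"
  shows "len (u \<otimes> s) = len u + 1"
proof -
  have c: "s \<in> carrier G" "inv u \<in> carrier G" using assms by auto
  have s: "inv s \<in> par {v}" using assms par_letter par_inv by blast
  have i: "inv (u \<otimes> s) = inv s \<otimes> inv u" using assms c by (simp add: inv_mult_group)
  have "gate {v} (inv (u \<otimes> s)) = inv s" "res {v} (inv (u \<otimes> s)) = inv u"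
    unfolding i using gate_left[OF c(2) s] res_left[OF c(2) s] res_id[OF c(2) assms(5)] assms(5) c by simp_all
  then have "len (inv s) + len (inv u) \<le> len (inv (u \<otimes> s))" using len_gate[of "inv (u \<otimes> s)" "{v}"] assms c by simp
  then have "len s + len u \<le> len (u \<otimes> s)" using syl.wlen_inv assms c by simp
  moreover have "len s \<noteq> 0" using len_eq_0 c assms by simp
  ultimately show ?thesis using len_mult[OF assms(1) c(1)] len_letter[OF assms(2,3)] by simp
qed

lemma gate_of_long:
  assumes "u \<in> carrier G" "v \<in> V" "s \<in> S v" "len (u \<otimes> s) = len u + 1"
  shows "gate {v} (inv u) = \<one>"
proof -
  let ?e = "gate {v} (inv u)" and ?r = "res {v} (inv u)"
  have c: "?e \<in> carrier G" "?r \<in> carrier G" "s \<in> carrier G" using assms by auto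
  have e: "?e \<in> S v" using gate_par[of "inv u" "{v}"] par_single assms by simp
  have "inv u = ?e \<otimes> ?r" using gate_res assms by simp
  then have "u = inv ?r \<otimes> inv ?e" using inv_mult_group c assms by (metis inv_inv)
  then have "u \<otimes> s = inv ?r \<otimes> (inv ?e \<otimes> s)" using c by (metis inv_closed m_assoc)
  then have "len (u \<otimes> s) \<le> len (inv ?r) + len (inv ?e \<otimes> s)" using len_mult c by simp
  moreover have "len (inv ?e \<otimes> s) \<le> 1"
    using e assms S_subgroup by (intro len_letter[of v]) (auto simp: subgroup.m_closed subgroup.m_inv_closed)
  ultimately have "len u \<le> len ?r" using assms syl.wlen_inv c by simp
  then have "len ?e = 0" using len_gate[of "inv u" "{v}"] assms syl.wlen_inv by simp
  then show ?thesis using len_eq_0 c by simp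
qed

subsection \<open>Gates of cosets onto cosets\<close>

text \<open>\<open>b\<close> is a shortest element of the double coset of \<open>k\<close>: a
  nontrivial gate on either side could be moved into \<open>a\<close> or \<open>c\<close>, leaving
  something shorter.\<close>

lemma double_reduced:
  assumes "k \<in> carrier G"
  obtains a b c where "a \<in> par \<Lambda>" "b \<in> carrier G" "c \<in> par \<Omega>" "k = a \<otimes> b \<otimes> c"
    "gate \<Lambda> b = \<one>" "gate \<Omega> (inv b) = \<one>"
proof -
  define P where "P b \<longleftrightarrow> b \<in> carrier G \<and> (\<exists>a\<in>par \<Lambda>. \<exists>c\<in>par \<Omega>. k = a \<otimes> b \<otimes> c)" for b
  have "P k" unfolding P_def using assms by (intro conjI bexI[of _ \<one>]) (auto simp: par_one)
  then obtain b where "P b" and min: "\<And>b'. P b' \<Longrightarrow> len b \<le> len b'" using ex_has_least_nat[of P k len] by blast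
  then obtain a c where abc: "a \<in> par \<Lambda>" "b \<in> carrier G" "c \<in> par \<Omega>" "k = a \<otimes> b \<otimes> c" unfolding P_def by blast
  have ac: "a \<in> carrier G" "c \<in> carrier G" using abc par_carrier by auto
  have "P (res \<Lambda> b)"
  proof -
    have "k = (a \<otimes> gate \<Lambda> b) \<otimes> res \<Lambda> b \<otimes> c" using gate_res[OF abc(2), of \<Lambda>] abc ac by (simp add: m_assoc)
    then show ?thesis unfolding P_def using par_mult[OF gate_par[OF abc(2)] abc(1)] abc by auto
  qed
  then have "len (gate \<Lambda> b) = 0" using min len_gate[OF abc(2), of \<Lambda>] by fastforce
  then have 1: "gate \<Lambda> b = \<one>" using len_eq_0 abc by simp
  let ?e = "gate \<Omega> (inv b)" and ?r = "res \<Omega> (inv b)"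
  have c': "?e \<in> carrier G" "?r \<in> carrier G" using abc by auto
  have "P (inv ?r)"
  proof -
    have "inv b = ?e \<otimes> ?r" using gate_res abc by simp
    then have bb: "inv ?r \<otimes> inv ?e = b" using inv_mult_group c' abc by (metis inv_inv)
    have "a \<otimes> inv ?r \<otimes> (inv ?e \<otimes> c) = a \<otimes> (inv ?r \<otimes> inv ?e) \<otimes> c" using ac c' by (simp add: m_assoc)
    then have "k = a \<otimes> inv ?r \<otimes> (inv ?e \<otimes> c)" unfolding bb using abc(4) by simp
    moreover have "inv ?e \<otimes> c \<in> par \<Omega>" using par_mult[OF abc(3) par_inv[OF gate_par]] abc(2) by simp
    ultimately show ?thesis unfolding P_def using abc(1) c' inv_closed by blast
  qed
  then have "len ?e = 0" using min len_gate[of "inv b" \<Omega>] syl.wlen_inv[of ?r] syl.wlen_inv[of b] abc c' by fastforce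
  then have 2: "?e = \<one>" using len_eq_0 c' by simp
  show ?thesis using that abc 1 2 by blast
qed

text \<open>After inversion the gate on \<open>par \<Omega>\<close> singles out
  \<open>inv y\<close>, and taking gates does not leave \<open>par \<Theta>\<close>.\<close>

lemma right_reduced:
  assumes "b \<in> carrier G" "gate \<Omega> (inv b) = \<one>" "y \<in> par \<Omega>" "b \<otimes> y \<in> par \<Theta>"
  shows "b \<in> par \<Theta>"
proof -
  have y: "y \<in> carrier G" using assms par_carrier by blast
  have "inv y \<otimes> inv b \<in> par \<Theta>" using par_inv[OF assms(4)] assms y by (simp add: inv_mult_group)
  then have "gate \<Omega> (inv y \<otimes> inv b) \<in> par (\<Omega> \<inter> \<Theta>)" by (rule gate_in)
  then have "inv y \<in> par \<Theta>" using gate_left[of "inv b" "inv y" \<Omega>] assms par_inv y par_mono[of "\<Omega> \<inter> \<Theta>" \<Theta>] by simp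
  then have "b \<otimes> y \<otimes> inv y \<in> par \<Theta>" using assms(4) by (rule par_mult)
  then show ?thesis using assms y by (simp add: m_assoc)
qed

text \<open>Reading the letters of \<open>y\<close> after \<open>b\<close>, a letter can only be shuffled past \<open>b\<close> if its vertex
  is linked to the whole support of \<open>b\<close>.\<close>

lemma gate_double_reduced:
  assumes b: "b \<in> carrier G" "gate \<Lambda> b = \<one>" "gate \<Omega> (inv b) = \<one>" and "y \<in> par \<Omega>"
  shows "gate \<Lambda> (b \<otimes> y) \<in> par {v \<in> \<Lambda> \<inter> \<Omega>. b \<in> par (lk {v})} \<and> (\<exists>y'\<in>par \<Omega>. res \<Lambda> (b \<otimes> y) = b \<otimes> y')"
  using assms(4)
proof (induction rule: par.induct)
  case par_one
  then show ?case using b res_id[OF b(1,2)] by (auto simp: par.par_one intro!: bexI[of _ \<one>])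
next
  case (par_step y v s)
  have c: "y \<in> carrier G" "s \<in> carrier G" using par_step par_carrier S_carrier by auto
  have by': "b \<otimes> y \<in> carrier G" using b c by simp
  have e: "b \<otimes> (y \<otimes> s) = b \<otimes> y \<otimes> s" using b c by (simp add: m_assoc)
  obtain y' where y': "y' \<in> par \<Omega>" "res \<Lambda> (b \<otimes> y) = b \<otimes> y'" using par_step.IH by blast
  show ?case
  proof (cases "v \<in> \<Lambda> \<and> res \<Lambda> (b \<otimes> y) \<in> par (lk {v})")
    case True
    then have "b \<in> par (lk {v})" using right_reduced[OF b(1,3) y'(1)] y'(2) by simp
    then have "gate \<Lambda> (b \<otimes> y) \<otimes> s \<in> par {v \<in> \<Lambda> \<inter> \<Omega>. b \<in> par (lk {v})}"
      using par.par_step[OF conjunct1[OF par_step.IH], of v s] True par_step by blast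
    then show ?thesis unfolding e using gate_moved[OF by' par_step(3,4), of \<Lambda>] True par_step.IH by auto
  next
    case False
    have "res \<Lambda> (b \<otimes> y) \<otimes> s = b \<otimes> (y' \<otimes> s)" using y' par_carrier[OF y'(1)] b c by (simp add: m_assoc)
    then show ?thesis unfolding e using gate_unmoved[OF by' par_step(3,4) False] par_step.IH
      par.par_step[OF y'(1) par_step(2-4)] by auto
  qed
qed

text \<open>The intersection with \<open>V\<close> gives the empty family its correct value, the
  whole group.\<close>

lemma par_Inter:
  assumes "finite F" "b \<in> carrier G" "\<And>v. v \<in> F \<Longrightarrow> b \<in> par (\<Theta> v)"
  shows "b \<in> par (V \<inter> (\<Inter>v\<in>F. \<Theta> v))"
  using assms(1,3)
proof (induction F rule: finite_induct)
  case empty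
  then show ?case using assms generated by simp
next
  case (insert w F)
  then have "b \<in> par (\<Theta> w \<inter> (V \<inter> (\<Inter>v\<in>F. \<Theta> v)))" by (intro par_inter[of b "\<Theta> w"]) auto
  then show ?case by (simp add: Int_left_commute)
qed

lemma par_lk_all:
  assumes "\<Lambda> \<subseteq> V" "b \<in> carrier G" "\<And>v. v \<in> \<Lambda> \<Longrightarrow> b \<in> par (lk {v})"
  shows "b \<in> par (lk \<Lambda>)"
proof -
  have "lk \<Lambda> = V \<inter> (\<Inter>v\<in>\<Lambda>. lk {v})" by (auto simp: lk_def)
  then show ?thesis using par_Inter[OF finite_subset[OF assms(1) finite_V] assms(2,3)] by simp
qed

text \<open>The displacement, read in \<open>par \<Lambda>\<close>, between the gates of
  \<open>x\<close> and \<open>y\<close> on the coset \<open>g \<cdot> par \<Lambda>\<close>. Its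
  coned-off length is the distance of the two projections.\<close>

definition disp :: "'v set \<Rightarrow> 'a \<Rightarrow> 'a \<Rightarrow> 'a \<Rightarrow> 'a" where
  "disp \<Lambda> g x y = inv (gate \<Lambda> (inv g \<otimes> x)) \<otimes> gate \<Lambda> (inv g \<otimes> y)"

lemma disp_par: "g \<in> carrier G \<Longrightarrow> x \<in> carrier G \<Longrightarrow> y \<in> carrier G \<Longrightarrow> disp \<Lambda> g x y \<in> par \<Lambda>"
  unfolding disp_def using par_mult par_inv gate_par by simp

lemma disp_carrier [simp]: "g \<in> carrier G \<Longrightarrow> x \<in> carrier G \<Longrightarrow> y \<in> carrier G \<Longrightarrow> disp \<Lambda> g x y \<in> carrier G"
  unfolding disp_def by simp

lemma disp_self: "g \<in> carrier G \<Longrightarrow> x \<in> carrier G \<Longrightarrow> disp \<Lambda> g x x = \<one>"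
  unfolding disp_def by simp

lemma disp_mult: "g \<in> carrier G \<Longrightarrow> x \<in> carrier G \<Longrightarrow> y \<in> carrier G \<Longrightarrow> z \<in> carrier G \<Longrightarrow>
    disp \<Lambda> g x y \<otimes> disp \<Lambda> g y z = disp \<Lambda> g x z"
  unfolding disp_def by (simp add: telescope)

lemma disp_inv: "g \<in> carrier G \<Longrightarrow> x \<in> carrier G \<Longrightarrow> y \<in> carrier G \<Longrightarrow> inv (disp \<Lambda> g x y) = disp \<Lambda> g y x"
  unfolding disp_def by (simp add: inv_mult_group)

lemma disp_near:
  assumes "g \<in> carrier G" "x \<in> carrier G" "y \<in> par \<Omega>"
  shows "disp \<Lambda> g x (x \<otimes> y) \<in> par (\<Lambda> \<inter> \<Omega>)"
  using gate_diff[OF assms(3), of "inv g \<otimes> x" \<Lambda>] assms par_carrier[OF assms(3)] by (simp add: disp_def m_assoc)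

lemma gate_rep:
  assumes "g \<in> carrier G" "g' \<in> carrier G" "x \<in> carrier G" "a \<in> par \<Lambda>" "k \<in> par (lk \<Lambda>)" "inv g \<otimes> g' = a \<otimes> k"
  shows "gate \<Lambda> (inv g \<otimes> x) = a \<otimes> gate \<Lambda> (inv g' \<otimes> x)"
proof -
  have "inv g \<otimes> x = a \<otimes> k \<otimes> (inv g' \<otimes> x)" using telescope[OF assms(1-3)] unfolding assms(6) by (simp only:)
  then show ?thesis using gate_st[OF assms(4,5), of "inv g' \<otimes> x"] assms by simp
qed

lemma disp_rep:
  assumes "g \<in> carrier G" "g' \<in> carrier G" "x \<in> carrier G" "y \<in> carrier G" "inv g \<otimes> g' \<in> par (st \<Lambda>)"
  shows "disp \<Lambda> g x y = disp \<Lambda> g' x y"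
proof -
  obtain a k where ak: "a \<in> par \<Lambda>" "k \<in> par (lk \<Lambda>)" "inv g \<otimes> g' = a \<otimes> k" using par_st[OF assms(5)] by blast
  show ?thesis
    unfolding disp_def gate_rep[OF assms(1-3) ak] gate_rep[OF assms(1,2,4) ak]
    using par_carrier[OF ak(1)] assms by simp
qed

text \<open>Let \<open>b\<close> be the shortest bridge between the two cosets. Within
  \<open>r \<cdot> par \<Omega>\<close> the gate moves only in directions of
  \<open>\<Lambda> \<inter> \<Omega>\<close> that are linked to \<open>b\<close>. If these are not
  all of \<open>\<Lambda>\<close>, the displacement is coned off; if they are, \<open>b\<close>
  commutes with \<open>par \<Lambda>\<close>, and a coset parallel to
  \<open>g \<cdot> par \<Lambda>\<close> lies in \<open>r \<cdot> par \<Omega>\<close>.\<close>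

lemma gate_coset_dichotomy:
  assumes "\<Lambda> \<subseteq> V" "g \<in> carrier G" "r \<in> carrier G" "y1 \<in> par \<Omega>" "y2 \<in> par \<Omega>"
  shows "(\<exists>v\<in>\<Lambda>. disp \<Lambda> g (r \<otimes> y1) (r \<otimes> y2) \<in> par (\<Lambda> - {v})) \<or>
    (\<Lambda> \<subseteq> \<Omega> \<and> (\<exists>c\<in>par \<Omega>. inv g \<otimes> (r \<otimes> c) \<in> par (st \<Lambda>)))"
proof -
  obtain a b c where abc: "a \<in> par \<Lambda>" "b \<in> carrier G" "c \<in> par \<Omega>" "inv g \<otimes> r = a \<otimes> b \<otimes> c"
    "gate \<Lambda> b = \<one>" "gate \<Omega> (inv b) = \<one>"
    by (rule double_reduced[of "inv g \<otimes> r" \<Lambda> \<Omega>]) (use assms in auto)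
  have carr: "a \<in> carrier G" "c \<in> carrier G" "y1 \<in> carrier G" "y2 \<in> carrier G" using abc assms par_carrier by auto
  let ?\<Sigma> = "{v \<in> \<Lambda> \<inter> \<Omega>. b \<in> par (lk {v})}"
  have g: "gate \<Lambda> (inv g \<otimes> (r \<otimes> y)) = a \<otimes> gate \<Lambda> (b \<otimes> (c \<otimes> y))" if "y \<in> carrier G" for y
  proof -
    have "inv g \<otimes> (r \<otimes> y) = (inv g \<otimes> r) \<otimes> y" using assms that by (simp add: m_assoc)
    also have "\<dots> = a \<otimes> (b \<otimes> (c \<otimes> y))" unfolding abc(4) using carr abc(2) that by (simp add: m_assoc)
    finally show ?thesis using gate_left[of "b \<otimes> (c \<otimes> y)" a \<Lambda>] abc carr that by simp
  qed
  have "disp \<Lambda> g (r \<otimes> y1) (r \<otimes> y2) = inv (gate \<Lambda> (b \<otimes> (c \<otimes> y1))) \<otimes> gate \<Lambda> (b \<otimes> (c \<otimes> y2))"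
    unfolding disp_def using g carr abc(2) by simp
  moreover have "gate \<Lambda> (b \<otimes> (c \<otimes> y)) \<in> par ?\<Sigma>" if "y \<in> par \<Omega>" for y
    using gate_double_reduced[OF abc(2,5,6) par_mult[OF that abc(3)]] by blast
  ultimately have \<Sigma>: "disp \<Lambda> g (r \<otimes> y1) (r \<otimes> y2) \<in> par ?\<Sigma>"
    using par_mult[OF _ par_inv] assms(4,5) by simp
  show ?thesis
  proof (cases "?\<Sigma> = \<Lambda>")
    case True
    then have "b \<in> par (lk \<Lambda>)" by (intro par_lk_all[OF assms(1) abc(2)]) blast
    then have "a \<otimes> b \<in> par (st \<Lambda>)"
      using abc(1) par_mono[of "lk \<Lambda>" "st \<Lambda>" b] par_mono[of \<Lambda> "st \<Lambda>" a] par_mult by (simp add: st_def)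
    moreover have "inv g \<otimes> (r \<otimes> inv c) = (inv g \<otimes> r) \<otimes> inv c" using assms carr by (simp add: m_assoc)
    then have "inv g \<otimes> (r \<otimes> inv c) = a \<otimes> b" unfolding abc(4) using carr abc(2) by (simp add: m_assoc)
    ultimately have "inv g \<otimes> (r \<otimes> inv c) \<in> par (st \<Lambda>)" by simp
    moreover have "\<Lambda> \<subseteq> \<Omega>" using True by blast
    ultimately show ?thesis using par_inv[OF abc(3)] by blast
  next
    case False
    then obtain v where "v \<in> \<Lambda>" "v \<notin> ?\<Sigma>" by blast
    then show ?thesis using par_mono[OF _ \<Sigma>, of "\<Lambda> - {v}"] by blast
  qed
qed

text \<open>Both cosets may be replaced by their parallel copies through \<open>c\<close>, where one
  contains the other and \<open>gate_subset\<close> applies. The error made is an element of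
  \<open>par (lk \<Lambda>)\<close>, which gates on \<open>par \<Lambda>'\<close> do not
  see.\<close>

lemma disp_gate:
  assumes "\<Lambda>' \<subseteq> \<Lambda>" and carr: "g \<in> carrier G" "h \<in> carrier G" "c \<in> carrier G" "x \<in> carrier G"
    and c: "inv h \<otimes> c \<in> par (st \<Lambda>')" "inv g \<otimes> c \<in> par (st \<Lambda>)"
  shows "disp \<Lambda>' h x (g \<otimes> gate \<Lambda> (inv g \<otimes> x)) = \<one>"
proof -
  obtain a k where ak: "a \<in> par \<Lambda>" "k \<in> par (lk \<Lambda>)" "inv g \<otimes> c = a \<otimes> k" using par_st[OF c(2)] by blast
  have akc: "a \<in> carrier G" "k \<in> carrier G" using ak par_carrier by auto
  define p where "p = gate \<Lambda> (inv c \<otimes> x)"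
  have p: "p \<in> carrier G" unfolding p_def using carr by simp
  have "g \<otimes> (inv g \<otimes> c) = c" using carr by simp
  then have c': "g \<otimes> (a \<otimes> k) = c" unfolding ak(3) .
  have "inv (g \<otimes> (a \<otimes> k)) \<otimes> (g \<otimes> (a \<otimes> p)) = inv k \<otimes> p" using carr akc p by simp
  then have "inv c \<otimes> (g \<otimes> gate \<Lambda> (inv g \<otimes> x)) = inv k \<otimes> p"
    unfolding c' gate_rep[OF carr(1,3,4) ak] p_def .
  moreover have "inv k \<in> par (lk \<Lambda>')" using par_mono[OF lk_antimono[OF assms(1)]] par_inv ak by blast
  ultimately have "gate \<Lambda>' (inv c \<otimes> (g \<otimes> gate \<Lambda> (inv g \<otimes> x))) = gate \<Lambda>' p" using gate_lk p by simp
  also have "\<dots> = gate \<Lambda>' (inv c \<otimes> x)" unfolding p_def using gate_subset assms(1) carr by simp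
  finally have "disp \<Lambda>' c x (g \<otimes> gate \<Lambda> (inv g \<otimes> x)) = \<one>" unfolding disp_def using carr by simp
  then show ?thesis using disp_rep[OF carr(2,3,4) _ c(1)] carr by simp
qed

text \<open>If the gate moves at all while \<open>t\<close> is read, it does so at some letter, of
  type \<open>v\<close> say; just before, at \<open>x \<otimes> t'\<close>, the residue must be
  linked to \<open>v\<close>.\<close>

lemma disp_change:
  assumes "g \<in> carrier G" "x \<in> carrier G" "t \<in> par \<Theta>"
  shows "disp \<Lambda> g x (x \<otimes> t) = \<one> \<or>
    (\<exists>t'\<in>par \<Theta>. \<exists>v\<in>\<Lambda>. v \<in> V \<and> (\<exists>a\<in>par \<Lambda>. inv (x \<otimes> t') \<otimes> (g \<otimes> a) \<in> par (lk {v})))"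
  using assms(3)
proof (induction rule: par.induct)
  case par_one
  then show ?case using assms disp_self by simp
next
  case (par_step t v s)
  have c: "t \<in> carrier G" "s \<in> carrier G" using par_step par_carrier S_carrier by auto
  let ?y = "inv g \<otimes> (x \<otimes> t)"
  have y: "?y \<in> carrier G" "inv g \<otimes> (x \<otimes> (t \<otimes> s)) = ?y \<otimes> s" using assms c by (simp_all add: m_assoc)
  show ?case
  proof (cases "v \<in> \<Lambda> \<and> res \<Lambda> ?y \<in> par (lk {v})")
    case True
    have "inv (x \<otimes> t) \<otimes> (g \<otimes> gate \<Lambda> ?y) = inv (res \<Lambda> ?y)"
      unfolding res_def using assms c by (simp add: inv_mult_group m_assoc)
    then have "inv (x \<otimes> t) \<otimes> (g \<otimes> gate \<Lambda> ?y) \<in> par (lk {v})" using True par_inv by simp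
    then show ?thesis using True par_step gate_par[OF y(1)] by blast
  next
    case False
    then have "gate \<Lambda> (inv g \<otimes> (x \<otimes> (t \<otimes> s))) = gate \<Lambda> ?y"
      unfolding y(2) using gate_unmoved[OF y(1) par_step(3,4)] by blast
    then have "disp \<Lambda> g x (x \<otimes> (t \<otimes> s)) = disp \<Lambda> g x (x \<otimes> t)" by (simp add: disp_def)
    then show ?thesis using par_step.IH by simp
  qed
qed

text \<open>The premise for \<open>v\<close> puts the bridge \<open>b\<close> between the two cosets
  into the link subgroup of \<open>v\<close>. Hence \<open>b\<close> commutes with
  \<open>par \<Lambda>\<close>, and a parallel copy of \<open>g \<cdot> par \<Lambda>\<close> meets
  \<open>h \<cdot> par \<Theta>\<close>.\<close>

lemma cosets_meet:
  assumes "\<Lambda> \<subseteq> V" "g \<in> carrier G" "h \<in> carrier G"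
    and meet: "\<And>v. v \<in> \<Lambda> \<Longrightarrow> \<exists>a\<in>par \<Lambda>. \<exists>c\<in>par (lk {v}). inv h \<otimes> (g \<otimes> a \<otimes> c) \<in> par \<Theta>"
  shows "\<exists>y\<in>carrier G. inv g \<otimes> y \<in> par (st \<Lambda>) \<and> inv h \<otimes> y \<in> par \<Theta>"
proof -
  obtain s b l where sbl: "s \<in> par \<Theta>" "b \<in> carrier G" "l \<in> par \<Lambda>" "inv h \<otimes> g = s \<otimes> b \<otimes> l"
    "gate \<Theta> b = \<one>" "gate \<Lambda> (inv b) = \<one>"
    by (rule double_reduced[of "inv h \<otimes> g" \<Theta> \<Lambda>]) (use assms in auto)
  have carr: "s \<in> carrier G" "l \<in> carrier G" using sbl par_carrier by auto
  have "b \<in> par (lk {v})" if v: "v \<in> \<Lambda>" for v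
  proof -
    obtain a c where ac: "a \<in> par \<Lambda>" "c \<in> par (lk {v})" "inv h \<otimes> (g \<otimes> a \<otimes> c) \<in> par \<Theta>" using meet[OF v] by blast
    have acc: "a \<in> carrier G" "c \<in> carrier G" using ac par_carrier by auto
    define \<sigma> where "\<sigma> = b \<otimes> (l \<otimes> a) \<otimes> c"
    have \<sigma>c: "\<sigma> \<in> carrier G" unfolding \<sigma>_def using carr acc sbl by simp
    have "inv h \<otimes> (g \<otimes> a \<otimes> c) = (inv h \<otimes> g) \<otimes> (a \<otimes> c)" using assms acc by (simp add: m_assoc)
    then have "inv h \<otimes> (g \<otimes> a \<otimes> c) = s \<otimes> \<sigma>" unfolding sbl(4) \<sigma>_def using carr acc sbl(2) by (simp add: m_assoc)
    then have "inv s \<otimes> (s \<otimes> \<sigma>) \<in> par \<Theta>" using par_mult[OF ac(3) par_inv[OF sbl(1)]] by simp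
    then have \<sigma>: "\<sigma> \<in> par \<Theta>" using \<sigma>c carr by simp
    have "b \<otimes> (l \<otimes> a) = \<sigma> \<otimes> inv c" unfolding \<sigma>_def using carr acc sbl(2) by (simp add: m_assoc)
    \<comment> \<open>The residue ignores the factor \<open>\<sigma>\<close> on the left, so it can
      be computed from \<open>inv c\<close> alone, inside the link subgroup.\<close>
    then have "res \<Theta> (b \<otimes> (l \<otimes> a)) = res \<Theta> (inv c)" using res_left \<sigma> acc by simp
    moreover have "res \<Theta> (inv c) \<in> par (lk {v})"
      unfolding res_def using gate_in[OF par_inv[OF ac(2)], of \<Theta>]
      by (intro par_mult[OF par_inv[OF ac(2)] par_inv]) (rule par_mono[OF Int_lower2])
    moreover obtain y' where "y' \<in> par \<Lambda>" "res \<Theta> (b \<otimes> (l \<otimes> a)) = b \<otimes> y'"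
      using gate_double_reduced[OF sbl(2,5,6) par_mult[OF ac(1) sbl(3)]] by blast
    ultimately show ?thesis using right_reduced[OF sbl(2,6)] by simp
  qed
  then have b: "b \<in> par (lk \<Lambda>)" by (rule par_lk_all[OF assms(1) sbl(2)])
  let ?y = "h \<otimes> s"
  have "h \<otimes> (inv h \<otimes> g) = g" using assms by simp
  then have "g = h \<otimes> (s \<otimes> b \<otimes> l)" unfolding sbl(4) by (simp only:)
  then have "inv g \<otimes> ?y = inv l \<otimes> inv b" using carr sbl(2) assms by (simp add: inv_mult_group m_assoc)
  moreover have "inv l \<otimes> inv b \<in> par (st \<Lambda>)"
    using par_inv[OF sbl(3)] par_inv[OF b] par_mono[of "lk \<Lambda>" "st \<Lambda>"] par_mono[of \<Lambda> "st \<Lambda>"]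
    by (intro par_mult) (auto simp: st_def)
  ultimately show ?thesis using sbl(1) carr assms by (intro bexI[of _ ?y]) auto
qed

text \<open>\<open>z\<close> is its own gate on \<open>h \<cdot> par \<Omega>\<close>; moving from
  \<open>z\<close> to \<open>x\<close> inside \<open>par \<Theta>\<close> moves the gate inside
  \<open>par (\<Omega> \<inter> \<Theta>)\<close>. This is what makes finitely many pairwise meeting
  regions meet in one point.\<close>

lemma gate_keeps_coset:
  assumes "h \<in> carrier G" "x \<in> carrier G" "z \<in> carrier G" "inv h \<otimes> z \<in> par \<Omega>" "inv z \<otimes> x \<in> par \<Theta>"
  shows "inv z \<otimes> (h \<otimes> gate \<Omega> (inv h \<otimes> x)) \<in> par \<Theta>"
proof -
  have "inv (inv h \<otimes> z) \<otimes> gate \<Omega> (inv h \<otimes> z \<otimes> (inv z \<otimes> x)) \<in> par (\<Omega> \<inter> \<Theta>)"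
    using gate_diff[OF assms(5), of "inv h \<otimes> z" \<Omega>] gate_id[OF assms(4)] assms by simp
  then have "inv z \<otimes> (h \<otimes> gate \<Omega> (inv h \<otimes> x)) \<in> par (\<Omega> \<inter> \<Theta>)"
    using assms by (simp add: telescope inv_mult_group m_assoc)
  then show ?thesis using par_mono by blast
qed

subsection \<open>Counting syllables through a family of cosets\<close>

text \<open>Follow a geodesic from \<open>x\<close> to \<open>y\<close>. By assumption each syllable
  moves the gate on one of the cosets, and along a geodesic a moving gate never loses syllables
  again. So the sum grows at least as fast as the length.\<close>

lemma len_le_sum_gates:
  assumes "finite I" "\<And>i. i \<in> I \<Longrightarrow> r i \<in> carrier G" "x \<in> carrier G" "y \<in> carrier G"
    and "\<And>z v s. z \<in> carrier G \<Longrightarrow> v \<in> V \<Longrightarrow> s \<in> S v \<Longrightarrow> s \<noteq> \<one> \<Longrightarrow>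
      len (inv x \<otimes> z) + 1 + len (inv (z \<otimes> s) \<otimes> y) = len (inv x \<otimes> y) \<Longrightarrow>
      \<exists>i\<in>I. disp (\<Lambda> i) (r i) z (z \<otimes> s) \<noteq> \<one>"
  shows "len (inv x \<otimes> y) \<le> (\<Sum>i\<in>I. len (disp (\<Lambda> i) (r i) x y))"
  using assms(4,5)
proof (induction "len (inv x \<otimes> y)" arbitrary: y)
  case (Suc m)
  have y: "y \<in> carrier G" and x: "x \<in> carrier G" using Suc.prems assms by auto
  have "inv x \<otimes> y \<in> syl.ball (len (inv x \<otimes> y))" "len (inv x \<otimes> y) = Suc m"
    using len_ball x y Suc.hyps(2) by simp_all
  then obtain u s where us: "inv x \<otimes> y = u \<otimes> s" "u \<in> syl.ball m" "s \<in> letters" "len u = m" "len s = 1"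
    by (rule syl.ball_Suc_E)
  have u: "u \<in> carrier G" using syl.ball_carrier us by blast
  have s1: "s \<noteq> \<one>" using us syl.wlen_one by auto
  obtain v where v: "v \<in> V" "s \<in> S v" using us(3) s1 by (auto elim: letter_E)
  have s: "s \<in> carrier G" using v by blast
  define z where "z = x \<otimes> u"
  have z: "z \<in> carrier G" "inv x \<otimes> z = u" unfolding z_def using x u by auto
  have "x \<otimes> (inv x \<otimes> y) = x \<otimes> (u \<otimes> s)" using us(1) by simp
  then have yz: "y = z \<otimes> s" unfolding z_def using x y u s by (simp add: m_assoc)
  have len: "len (inv x \<otimes> y) = Suc m" "len (inv x \<otimes> z) = m" using Suc.hyps z us by auto
  \<comment> \<open>A syllable on a geodesic from \<open>x\<close> to \<open>z\<close> also lies on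
    a geodesic from \<open>x\<close> to \<open>y\<close>, so the assumption is inherited by
    \<open>z\<close>.\<close>
  have IH: "len (inv x \<otimes> z) \<le> (\<Sum>i\<in>I. len (disp (\<Lambda> i) (r i) x z))"
  proof (rule Suc.hyps(1))
    fix z' v' s'
    assume z': "z' \<in> carrier G" "v' \<in> V" "s' \<in> S v'" "s' \<noteq> \<one>"
      "len (inv x \<otimes> z') + 1 + len (inv (z' \<otimes> s') \<otimes> z) = len (inv x \<otimes> z)"
    have s': "s' \<in> carrier G" using z' by blast
    let ?w = "z' \<otimes> s'"
    have w: "?w \<in> carrier G" using z' s' by simp
    have "inv ?w \<otimes> y = (inv ?w \<otimes> z) \<otimes> s" unfolding yz using w z s by (simp add: m_assoc)
    then have 1: "len (inv ?w \<otimes> y) \<le> len (inv ?w \<otimes> z) + 1" using len_mult[of "inv ?w \<otimes> z" s] us(5) w z s by simp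
    have "inv x \<otimes> y = (inv x \<otimes> z') \<otimes> (s' \<otimes> (inv ?w \<otimes> y))" using x z' s' y by (simp add: inv_mult_group m_assoc)
    then have "len (inv x \<otimes> y) \<le> len (inv x \<otimes> z') + len (s' \<otimes> (inv ?w \<otimes> y))"
      using len_mult[of "inv x \<otimes> z'" "s' \<otimes> (inv ?w \<otimes> y)"] x z' s' w y by simp
    also have "len (s' \<otimes> (inv ?w \<otimes> y)) \<le> 1 + len (inv ?w \<otimes> y)"
      using len_mult[of s' "inv ?w \<otimes> y"] len_letter[OF z'(2,3)] s' w y by simp
    finally have "len (inv x \<otimes> z') + 1 + len (inv ?w \<otimes> y) = len (inv x \<otimes> y)" using 1 z'(5) len by simp
    then show "\<exists>i\<in>I. disp (\<Lambda> i) (r i) z' (z' \<otimes> s') \<noteq> \<one>" using Suc.prems(2) z' by blast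
  qed (use z len in auto)
  have gv: "gate {v} (inv z \<otimes> x) = \<one>"
  proof -
    have "gate {v} (inv u) = \<one>"
      using gate_of_long[OF u v] us(1) len us(4) by simp
    moreover have "inv (inv x \<otimes> z) = inv z \<otimes> x" using x z(1) by (simp add: inv_mult_group)
    then have "inv u = inv z \<otimes> x" unfolding z(2) .
    ultimately show ?thesis by simp
  qed
  \<comment> \<open>A moving gate gains exactly the syllable \<open>s\<close>. If it were absorbed
    instead, the displacement would end in a syllable of type \<open>v\<close>; by
    \<open>gate_subset\<close> and \<open>gate_lk\<close> so would \<open>inv x \<otimes> z\<close>,
    against \<open>gv\<close>.\<close>
  have step: "len (disp (\<Lambda> i) (r i) x y) = len (disp (\<Lambda> i) (r i) x z) + (if disp (\<Lambda> i) (r i) z y = \<one> then 0 else 1)"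
    if i: "i \<in> I" for i
  proof (cases "disp (\<Lambda> i) (r i) z y = \<one>")
    case True
    then show ?thesis using disp_mult[of "r i" x z y "\<Lambda> i"] assms(2)[OF i] x y z by simp
  next
    case False
    have r: "r i \<in> carrier G" using assms(2)[OF i] .
    let ?q = "inv (r i) \<otimes> z"
    have q: "?q \<in> carrier G" "inv (r i) \<otimes> y = ?q \<otimes> s" unfolding yz using r z s by (simp_all add: m_assoc)
    have mv: "v \<in> \<Lambda> i \<and> res (\<Lambda> i) ?q \<in> par (lk {v})"
    proof (rule ccontr)
      assume "\<not> ?thesis"
      then have "gate (\<Lambda> i) (inv (r i) \<otimes> y) = gate (\<Lambda> i) ?q" unfolding q(2) using gate_unmoved[OF q(1) v] by blast
      then show False using False q(1) by (simp add: disp_def)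
    qed
    have zy: "disp (\<Lambda> i) (r i) z y = s"
      unfolding disp_def q(2) using gate_moved[OF q(1) v, of "\<Lambda> i"] mv q s by simp
    let ?d = "disp (\<Lambda> i) (r i) x z"
    have d: "?d \<in> carrier G" using r x z by simp
    have "inv ?d = inv (gate (\<Lambda> i) ?q) \<otimes> gate (\<Lambda> i) (inv (r i) \<otimes> x)"
      using disp_inv[OF r x z(1)] by (simp add: disp_def)
    also have "\<dots> = gate (\<Lambda> i) (inv (gate (\<Lambda> i) ?q) \<otimes> (inv (r i) \<otimes> x))"
      using gate_left[of "inv (r i) \<otimes> x" "inv (gate (\<Lambda> i) ?q)" "\<Lambda> i"] par_inv gate_par q r x by simp
    also have "inv (gate (\<Lambda> i) ?q) \<otimes> (inv (r i) \<otimes> x) = res (\<Lambda> i) ?q \<otimes> (inv z \<otimes> x)"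
      unfolding res_def using q r x z by (simp add: m_assoc)
    finally have "gate {v} (inv ?d) = gate {v} (res (\<Lambda> i) ?q \<otimes> (inv z \<otimes> x))"
      using gate_subset[of "res (\<Lambda> i) ?q \<otimes> (inv z \<otimes> x)" "{v}" "\<Lambda> i"] mv q z x by simp
    also have "\<dots> = \<one>" using gate_lk[of "inv z \<otimes> x" "res (\<Lambda> i) ?q" "{v}"] mv gv z x by simp
    finally have "len (?d \<otimes> s) = len ?d + 1" using len_mult_letter[OF d v s1] by simp
    then show ?thesis using disp_mult[of "r i" x z y "\<Lambda> i"] zy r x y z False by simp
  qed
  obtain j where j: "j \<in> I" "disp (\<Lambda> j) (r j) z y \<noteq> \<one>"
    using Suc.prems(2)[of z v s] z v s1 len us y yz by (auto simp: syl.wlen_one)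
  have "(\<Sum>i\<in>I. len (disp (\<Lambda> i) (r i) x z)) < (\<Sum>i\<in>I. len (disp (\<Lambda> i) (r i) x y))"
  proof (rule sum_strict_mono_ex1[OF assms(1)])
    show "\<forall>i\<in>I. len (disp (\<Lambda> i) (r i) x z) \<le> len (disp (\<Lambda> i) (r i) x y)" using step by simp
    have "len (disp (\<Lambda> j) (r j) x z) < len (disp (\<Lambda> j) (r j) x y)" using step[OF j(1)] j(2) by simp
    then show "\<exists>i\<in>I. len (disp (\<Lambda> i) (r i) x z) < len (disp (\<Lambda> i) (r i) x y)" using j(1) by blast
  qed
  then show ?case using IH len by simp
qed simp

end

context gated_group
begin

subsection \<open>Coning off the proper parabolic subgroups\<close>

text \<open>The second alternative only matters if \<open>\<Lambda>\<close> is a singleton, when it makes the metric bounded.\<close>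

definition cone :: "'v set \<Rightarrow> 'a set" where
  "cone \<Lambda> = {x \<in> par \<Lambda>. (\<exists>v\<in>\<Lambda>. x \<in> par (\<Lambda> - {v})) \<or> (\<exists>v\<in>\<Lambda> \<inter> V. x \<in> S v)}"

abbreviation cball :: "'v set \<Rightarrow> nat \<Rightarrow> 'a set" where
  "cball \<Lambda> \<equiv> word_metric.ball G (cone \<Lambda>)"

abbreviation clen :: "'v set \<Rightarrow> 'a \<Rightarrow> nat" where
  "clen \<Lambda> \<equiv> word_metric.wlen G (cone \<Lambda>)"

lemma cone_word_metric: assumes "\<Lambda> \<noteq> {}" shows "word_metric G (cone \<Lambda>)"
proof
  show "cone \<Lambda> \<subseteq> carrier G" unfolding cone_def using par_carrier by blast
  show "\<one> \<in> cone \<Lambda>" unfolding cone_def using assms par_one by blast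
  show "inv t \<in> cone \<Lambda>" if "t \<in> cone \<Lambda>" for t
    using that par_inv subgroup.m_inv_closed[OF S_subgroup] unfolding cone_def by blast
qed

lemma cone_subset: "\<Omega> \<subset> \<Lambda> \<Longrightarrow> x \<in> par \<Omega> \<Longrightarrow> x \<in> cone \<Lambda>"
proof -
  assume *: "\<Omega> \<subset> \<Lambda>" "x \<in> par \<Omega>"
  then obtain v where "v \<in> \<Lambda>" "\<Omega> \<subseteq> \<Lambda> - {v}" by blast
  then show ?thesis using par_mono[of \<Omega> \<Lambda> x] par_mono[of \<Omega> "\<Lambda> - {v}" x] * unfolding cone_def by blast
qed

lemma cone_letter: "v \<in> \<Lambda> \<Longrightarrow> v \<in> V \<Longrightarrow> s \<in> S v \<Longrightarrow> s \<in> cone \<Lambda>"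
  unfolding cone_def using par_letter by blast

lemma cone_E:
  assumes "x \<in> cone \<Lambda>" "v \<in> \<Lambda>" "w \<in> \<Lambda>" "v \<noteq> w"
  obtains u where "u \<in> \<Lambda>" "x \<in> par (\<Lambda> - {u})"
proof -
  consider u where "u \<in> \<Lambda>" "x \<in> par (\<Lambda> - {u})" | u where "u \<in> \<Lambda>" "u \<in> V" "x \<in> S u"
    using assms(1) unfolding cone_def by blast
  then show ?thesis
  proof cases
    case (2 u)
    then obtain u' where "u' \<in> \<Lambda>" "u' \<noteq> u" using assms by blast
    then show ?thesis using that par_letter[of u "\<Lambda> - {u'}" x] 2 by blast
  qed (use that in blast)
qed

lemma par_cball:
  assumes "\<Lambda> \<noteq> {}" "x \<in> par \<Lambda>"
  shows "\<exists>n. x \<in> cball \<Lambda> n"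
  using assms(2)
proof (induction rule: par.induct)
  interpret C: word_metric G "cone \<Lambda>" by (rule cone_word_metric) fact
  case par_one
  then show ?case by (intro exI[of _ 0]) simp
next
  interpret C: word_metric G "cone \<Lambda>" by (rule cone_word_metric) fact
  case (par_step x v s)
  then obtain n where "x \<in> cball \<Lambda> n" by blast
  then have "x \<otimes> s \<in> cball \<Lambda> (Suc n)" using C.ball_step cone_letter par_step by blast
  then show ?case by blast
qed

lemma cball_par:
  assumes "\<Lambda> \<noteq> {}" "x \<in> cball \<Lambda> n"
  shows "x \<in> par \<Lambda>"
  using assms(2)
proof (induction n arbitrary: x)
  interpret C: word_metric G "cone \<Lambda>" by (rule cone_word_metric) fact
  case 0
  then show ?case using par_one by simp
next
  interpret C: word_metric G "cone \<Lambda>" by (rule cone_word_metric) fact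
  case (Suc n)
  then obtain y t where "x = y \<otimes> t" "y \<in> cball \<Lambda> n" "t \<in> cone \<Lambda>" by auto
  moreover have "t \<in> par \<Lambda>" if "t \<in> cone \<Lambda>" for t using that by (simp add: cone_def)
  ultimately show ?case using Suc.IH par_mult by blast
qed

lemma clen_ball: "\<Lambda> \<noteq> {} \<Longrightarrow> x \<in> par \<Lambda> \<Longrightarrow> clen \<Lambda> x \<le> n \<Longrightarrow> x \<in> cball \<Lambda> n"
  using par_cball word_metric.ball_wlen[OF cone_word_metric] word_metric.ball_mono[OF cone_word_metric] by metis

lemma clen_mult: "\<Lambda> \<noteq> {} \<Longrightarrow> x \<in> par \<Lambda> \<Longrightarrow> y \<in> par \<Lambda> \<Longrightarrow> clen \<Lambda> (x \<otimes> y) \<le> clen \<Lambda> x + clen \<Lambda> y"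
  by (rule word_metric.wlen_mult[OF cone_word_metric clen_ball clen_ball]) auto

lemma clen_one: "\<Lambda> \<noteq> {} \<Longrightarrow> clen \<Lambda> \<one> = 0"
  by (rule word_metric.wlen_one[OF cone_word_metric])

lemma clen_eq_0: "\<Lambda> \<noteq> {} \<Longrightarrow> x \<in> par \<Lambda> \<Longrightarrow> clen \<Lambda> x = 0 \<longleftrightarrow> x = \<one>"
  by (rule word_metric.wlen_eq_0[OF cone_word_metric clen_ball]) auto

lemma clen_inv: "\<Lambda> \<noteq> {} \<Longrightarrow> x \<in> par \<Lambda> \<Longrightarrow> clen \<Lambda> (inv x) = clen \<Lambda> x"
  by (rule word_metric.wlen_inv[OF cone_word_metric par_carrier])

lemma clen_cone: "x \<in> cone \<Lambda> \<Longrightarrow> clen \<Lambda> x \<le> 1"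
proof -
  assume x: "x \<in> cone \<Lambda>"
  then have "\<Lambda> \<noteq> {}" unfolding cone_def by blast
  then interpret C: word_metric G "cone \<Lambda>" by (rule cone_word_metric)
  show ?thesis using C.wlen_le[OF C.ball_1[OF x]] by simp
qed

lemma cone_of_clen: "\<Lambda> \<noteq> {} \<Longrightarrow> x \<in> par \<Lambda> \<Longrightarrow> clen \<Lambda> x \<le> 1 \<Longrightarrow> x \<in> cone \<Lambda>"
proof -
  assume *: "\<Lambda> \<noteq> {}" "x \<in> par \<Lambda>" "clen \<Lambda> x \<le> 1"
  interpret C: word_metric G "cone \<Lambda>" by (rule cone_word_metric) fact
  have "x \<in> C.ball (Suc 0)" by (rule clen_ball[OF *(1,2)]) (use *(3) in simp)
  then obtain t where "t \<in> cone \<Lambda>" "x = \<one> \<otimes> t" by auto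
  then show ?thesis using C.T_carrier by auto
qed

text \<open>The parabolic subgroup of a join is the product of two proper parabolic subgroups, each
  of which is coned off.\<close>

lemma clen_join:
  assumes "\<Lambda> \<subseteq> A \<union> B" "A \<subset> \<Lambda>" "B \<subset> \<Lambda>" "\<And>v w. v \<in> A \<Longrightarrow> w \<in> B \<Longrightarrow> adj v w" "x \<in> par \<Lambda>"
  shows "clen \<Lambda> x \<le> 2"
proof -
  obtain a b where ab: "a \<in> par A" "b \<in> par B" "x = a \<otimes> b" using par_join[OF assms(5,1)] assms(4) by blast
  have *: "\<Lambda> \<noteq> {}" "a \<in> cone \<Lambda>" "b \<in> cone \<Lambda>" using assms ab cone_subset by auto
  then have "a \<in> par \<Lambda>" "b \<in> par \<Lambda>" by (auto simp: cone_def)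
  then show ?thesis using clen_mult[OF *(1)] clen_cone[OF *(2)] clen_cone[OF *(3)] ab(3) by fastforce
qed

lemma clen_disp_triangle:
  assumes "\<Lambda> \<noteq> {}" "g \<in> carrier G" "x \<in> carrier G" "y \<in> carrier G" "z \<in> carrier G"
  shows "clen \<Lambda> (disp \<Lambda> g x z) \<le> clen \<Lambda> (disp \<Lambda> g x y) + clen \<Lambda> (disp \<Lambda> g y z)"
  using clen_mult[OF assms(1) disp_par disp_par, of g x y g y z] disp_mult[of g x y z \<Lambda>] assms by simp

lemma clen_disp_commute:
  "\<Lambda> \<noteq> {} \<Longrightarrow> g \<in> carrier G \<Longrightarrow> x \<in> carrier G \<Longrightarrow> y \<in> carrier G \<Longrightarrow> clen \<Lambda> (disp \<Lambda> g x y) = clen \<Lambda> (disp \<Lambda> g y x)"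
  using clen_inv[OF _ disp_par, of \<Lambda> g x y] disp_inv[of g x y \<Lambda>] by simp

text \<open>A single syllable moves the gate by a letter of its own type or not at all, hence by at
  most one coned-off step.\<close>

lemma clen_disp_le_len:
  assumes \<Lambda>: "\<Lambda> \<noteq> {}" and gx: "g \<in> carrier G" "x \<in> carrier G" and "y \<in> carrier G"
  shows "clen \<Lambda> (disp \<Lambda> g x y) \<le> len (inv x \<otimes> y)"
proof -
  have "clen \<Lambda> (disp \<Lambda> g x (x \<otimes> t)) \<le> n" if "t \<in> syl.ball n" for t n
    using that
  proof (induction n arbitrary: t)
    case 0
    then show ?case using gx clen_one[OF \<Lambda>] disp_self by simp
  next
    case (Suc n)
    then obtain u s where u: "t = u \<otimes> s" "u \<in> syl.ball n" "s \<in> letters" by auto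
    have c: "u \<in> carrier G" "s \<in> carrier G" using u syl.ball_carrier syl.T_carrier by auto
    have t: "x \<otimes> t = x \<otimes> u \<otimes> s" using u c gx by (simp add: m_assoc)
    have "disp \<Lambda> g (x \<otimes> u) (x \<otimes> u \<otimes> s) \<in> cone \<Lambda>" using u(3)
    proof (cases rule: letter_E)
      case 1
      then show ?thesis using gx c disp_self word_metric.one_T[OF cone_word_metric[OF \<Lambda>]] by simp
    next
      case (2 v)
      then have "s \<in> par {v}" using par_letter by blast
      then have d: "disp \<Lambda> g (x \<otimes> u) (x \<otimes> u \<otimes> s) \<in> par (\<Lambda> \<inter> {v})" using disp_near gx c by simp
      show ?thesis
      proof (cases "v \<in> \<Lambda>")
        case True
        then show ?thesis using d cone_letter[OF True 2(1)] par_single 2(1) by simp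
      next
        case False
        then show ?thesis using d cone_subset[of "{}" \<Lambda>] \<Lambda> by auto
      qed
    qed
    then have "clen \<Lambda> (disp \<Lambda> g (x \<otimes> u) (x \<otimes> t)) \<le> 1" unfolding t by (rule clen_cone)
    then show ?case
      using clen_disp_triangle[OF \<Lambda> gx, of "x \<otimes> u" "x \<otimes> t"] Suc.IH[OF u(2)] c u(1) gx by fastforce
  qed
  then show ?thesis using len_ball[of "inv x \<otimes> y"] gx assms(4) by fastforce
qed

lemma cone_path_metric:
  assumes "\<Lambda> \<noteq> {}"
  shows "integer_path_metric (par \<Lambda>) (\<lambda>x y. clen \<Lambda> (inv x \<otimes> y))"
  by (rule word_metric.path_metric[OF cone_word_metric[OF assms] par_subgroup])
    (use par_cball[OF assms] in \<open>auto simp: cone_def\<close>)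

lemma syl_path_metric: "integer_path_metric (carrier G) (\<lambda>x y. len (inv x \<otimes> y))"
  by (rule syl.path_metric[OF subgroup_self syl.T_carrier carrier_ball])

subsection \<open>Distances are controlled by the coned-off distances\<close>

text \<open>A coned-off geodesic from \<open>x\<close> to \<open>y\<close> has at most
  \<open>r\<close> steps, the step at \<open>X i\<close> staying in a coset of
  \<open>par (\<Lambda> - {u i})\<close>. Every syllable of a geodesic from \<open>x\<close> to
  \<open>y\<close> moves the gate on one of these cosets, so \<open>len_le_sum_gates\<close>
  applies, and each summand is bounded by induction.\<close>

theorem len_le_of_clen_le:
  assumes "\<Lambda> \<subseteq> V" "x \<in> carrier G" "y \<in> carrier G" "inv x \<otimes> y \<in> par \<Lambda>"
    and "\<And>\<Lambda>' u. \<Lambda>' \<subseteq> \<Lambda> \<Longrightarrow> \<Lambda>' \<noteq> {} \<Longrightarrow> u \<in> carrier G \<Longrightarrow> inv x \<otimes> u \<in> par \<Lambda> \<Longrightarrow> clen \<Lambda>' (disp \<Lambda>' u x y) \<le> r"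
  shows "len (inv x \<otimes> y) \<le> (r + 1) ^ card \<Lambda>"
  using assms
proof (induction "card \<Lambda>" arbitrary: \<Lambda> x y)
  case 0
  then have "\<Lambda> = {}" using finite_subset[OF _ finite_V] by auto
  then have "inv x \<otimes> y = \<one>" using 0 par_empty by blast
  then show ?case using syl.wlen_one by simp
next
  case (Suc k)
  note xy = Suc.prems(2,3)
  have ne: "\<Lambda> \<noteq> {}" using Suc.hyps(2) by auto
  show ?case
  proof (cases "\<exists>v. \<Lambda> = {v}")
    case True
    then obtain v where v: "\<Lambda> = {v}" by blast
    then have "inv x \<otimes> y \<in> S v" using par_single Suc.prems by auto
    \<comment> \<open>A vertex group is coned off as a whole and not through smaller parabolic
      subgroups, but it has syllable diameter one, which the power of \<open>r + 1\<close> allows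
      even for \<open>r = 0\<close>.\<close>
    then have "len (inv x \<otimes> y) \<le> 1" using len_letter v Suc.prems by auto
    then show ?thesis using v by simp
  next
    case False
    then obtain v w where vw: "v \<in> \<Lambda>" "w \<in> \<Lambda>" "v \<noteq> w" using ne by blast
    have "disp \<Lambda> x x y = inv x \<otimes> y" unfolding disp_def using xy gate_id[OF Suc.prems(4)] by simp
    moreover have "inv x \<otimes> x \<in> par \<Lambda>" using xy par_one by simp
    ultimately have n: "clen \<Lambda> (inv x \<otimes> y) \<le> r" using Suc.prems(5)[OF subset_refl ne xy(1)] by simp
    interpret D: integer_path_metric "par \<Lambda>" "\<lambda>x y. clen \<Lambda> (inv x \<otimes> y)" using cone_path_metric[OF ne] .
    define n where "n = clen \<Lambda> (inv x \<otimes> y)"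
    have "inv \<one> \<otimes> (inv x \<otimes> y) = inv x \<otimes> y" using xy by simp
    then obtain p where p: "p 0 = \<one>" "p n = inv x \<otimes> y" "\<And>i. i \<le> n \<Longrightarrow> p i \<in> par \<Lambda>"
      "\<And>i j. i \<le> j \<Longrightarrow> j \<le> n \<Longrightarrow> clen \<Lambda> (inv (p i) \<otimes> p j) = j - i"
      using D.integer_geodesic[OF par_one Suc.prems(4)] unfolding n_def by auto
    have pc: "p i \<in> carrier G" if "i \<le> n" for i using p(3)[OF that] par_carrier by blast
    have "\<exists>u. u \<in> \<Lambda> \<and> inv (p i) \<otimes> p (Suc i) \<in> par (\<Lambda> - {u})" if "i < n" for i
    proof -
      have "inv (p i) \<otimes> p (Suc i) \<in> cone \<Lambda>"
        using cone_of_clen[OF ne] par_mult par_inv p(3)[of i] p(3)[of "Suc i"] p(4)[of i "Suc i"] that by simp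
      then show ?thesis using cone_E[OF _ vw] by blast
    qed
    then obtain u where u: "\<And>i. i < n \<Longrightarrow> u i \<in> \<Lambda>" "\<And>i. i < n \<Longrightarrow> inv (p i) \<otimes> p (Suc i) \<in> par (\<Lambda> - {u i})" by metis
    define X where "X i = x \<otimes> p i" for i
    have X: "X i \<in> carrier G" if "i \<le> n" for i unfolding X_def using pc[OF that] xy by simp
    have X0: "X 0 = x" "X n = y" unfolding X_def p using xy by simp_all
    have Xs: "inv (X i) \<otimes> X (Suc i) \<in> par (\<Lambda> - {u i})" if "i < n" for i
      unfolding X_def using u(2)[OF that] pc[of i] pc[of "Suc i"] xy that by simp
    have "len (inv x \<otimes> y) \<le> (\<Sum>i<n. len (disp (\<Lambda> - {u i}) (X i) x y))"
    proof (rule len_le_sum_gates[OF _ _ xy])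
      fix z v s
      assume z: "z \<in> carrier G" "v \<in> V" "s \<in> S v" "s \<noteq> \<one>"
        "len (inv x \<otimes> z) + 1 + len (inv (z \<otimes> s) \<otimes> y) = len (inv x \<otimes> y)"
      have s: "s \<in> carrier G" "s \<in> par {v}" using z par_letter by auto
      have "inv x \<otimes> y = (inv x \<otimes> z \<otimes> s) \<otimes> (inv (z \<otimes> s) \<otimes> y)" using xy z s by (simp add: inv_mult_group m_assoc)
      then have "len (inv x \<otimes> y) \<le> len (inv x \<otimes> z \<otimes> s) + len (inv (z \<otimes> s) \<otimes> y)"
        using len_mult[of "inv x \<otimes> z \<otimes> s" "inv (z \<otimes> s) \<otimes> y"] xy z s by simp
      then have "len (inv x \<otimes> z \<otimes> s) = len (inv x \<otimes> z) + 1"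
        using z(5) len_mult[of "inv x \<otimes> z" s] len_letter[OF z(2,3)] xy z s by simp
      then have "gate {v} (inv (inv x \<otimes> z)) = \<one>" using gate_of_long[of "inv x \<otimes> z" v s] xy z by simp
      then have gx: "gate {v} (inv z \<otimes> x) = \<one>" using xy z by (simp add: inv_mult_group)
      \<comment> \<open>If the gate were trivial, \<open>inv s\<close> would be a prefix of what
        remains after \<open>s\<close>, and skipping both would shorten the geodesic through
        \<open>z\<close> and \<open>z \<otimes> s\<close>.\<close>
      have gy: "gate {v} (inv z \<otimes> y) \<noteq> \<one>"
      proof
        define w where "w = inv (z \<otimes> s) \<otimes> y"
        have w: "w \<in> carrier G" "inv z \<otimes> y = s \<otimes> w" unfolding w_def using z s xy by (simp_all add: inv_mult_group m_assoc)
        assume g: "gate {v} (inv z \<otimes> y) = \<one>"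
        then have "s \<otimes> gate {v} w = \<one>" using gate_left[OF w(1) s(2)] w(2) by simp
        then have "inv s \<otimes> (s \<otimes> gate {v} w) = inv s" using s by simp
        then have "gate {v} w = inv s" using s w(1) by simp
        moreover have "res {v} w = inv z \<otimes> y"
          using res_left[OF w(1) s(2)] res_id[OF _ g] xy z unfolding w(2)[symmetric] by simp
        ultimately have e: "gate {v} w = inv s" "res {v} w = inv z \<otimes> y" by simp_all
        have "len s + len (inv z \<otimes> y) \<le> len w" using len_gate[OF w(1), of "{v}"] e syl.wlen_inv[OF s(1)] by simp
        moreover have "len s \<noteq> 0" using len_eq_0 s z by simp
        moreover have "len (inv x \<otimes> y) \<le> len (inv x \<otimes> z) + len (inv z \<otimes> y)"
          using len_mult[of "inv x \<otimes> z" "inv z \<otimes> y"] telescope[of x z y] xy z by simp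
        ultimately show False using z(5) unfolding w_def by simp
      qed
      \<comment> \<open>The gates of \<open>x\<close> and \<open>y\<close> on
        \<open>z \<cdot> par {v}\<close> differ, so the gate changes during some coned-off
        step.\<close>
      have "\<exists>i<n. disp {v} z (X i) (X (Suc i)) \<noteq> \<one>"
      proof (rule ccontr)
        assume *: "\<not> ?thesis"
        have "disp {v} z x (X i) = \<one>" if "i \<le> n" for i
          using that
        proof (induction i)
          case 0
          then show ?case using X0 disp_self z xy by simp
        next
          case (Suc i)
          have "disp {v} z x (X i) \<otimes> disp {v} z (X i) (X (Suc i)) = disp {v} z x (X (Suc i))"
            using disp_mult X Suc.prems z xy by simp
          then show ?case using Suc * by simp
        qed
        then have "disp {v} z x y = \<one>" using X0 by auto
        then show False using gx gy xy z by (simp add: disp_def)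
      qed
      then obtain i where i: "i < n" "disp {v} z (X i) (X (Suc i)) \<noteq> \<one>" by blast
      let ?\<Omega> = "\<Lambda> - {u i}"
      have Xi: "X i \<in> carrier G" "X (Suc i) = X i \<otimes> (inv (X i) \<otimes> X (Suc i))" using X[of i] X[of "Suc i"] i by auto
      have "disp {v} z (X i \<otimes> \<one>) (X i \<otimes> (inv (X i) \<otimes> X (Suc i))) \<noteq> \<one>" using i(2) Xi by simp
      \<comment> \<open>For a single vertex the first alternative of
        \<open>gate_coset_dichotomy\<close> means that the gate stands still. So a coset parallel to
        \<open>z \<cdot> par {v}\<close> lies in the coset of \<open>X i\<close>, and the gate on
        the latter moves along with \<open>s\<close>.\<close>
      then have "\<not> (\<exists>u\<in>{v}. disp {v} z (X i \<otimes> \<one>) (X i \<otimes> (inv (X i) \<otimes> X (Suc i))) \<in> par ({v} - {u}))"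
        using par_empty by auto
      then obtain c where c: "v \<in> ?\<Omega>" "c \<in> par ?\<Omega>" "inv z \<otimes> (X i \<otimes> c) \<in> par (st {v})"
        using gate_coset_dichotomy[of "{v}" z "X i" \<one> ?\<Omega> "inv (X i) \<otimes> X (Suc i)"] z Xi par_one Xs[OF i(1)] by auto
      have cc: "c \<in> carrier G" using c par_carrier by blast
      define q where "q = inv (inv z \<otimes> (X i \<otimes> c))"
      have q: "q \<in> par (st {v})" "q \<in> carrier G" unfolding q_def using par_inv[OF c(3)] par_carrier by auto
      have q': "inv (X i) \<otimes> z = c \<otimes> q" unfolding q_def using cc z Xi by (simp add: inv_mult_group m_assoc)
      have "res ?\<Omega> (c \<otimes> q) = inv (gate ?\<Omega> q) \<otimes> q" using res_left[OF q(2) c(2)] by (simp add: res_def)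
      also have "\<dots> \<in> par (st {v})"
        by (rule par_mult[OF q(1) par_inv]) (rule par_mono[OF Int_lower2 gate_in[OF q(1)]])
      finally have "gate ?\<Omega> (c \<otimes> q \<otimes> s) = gate ?\<Omega> (c \<otimes> q) \<otimes> s"
        using gate_step[of "c \<otimes> q" v s ?\<Omega>] c cc q z by simp
      moreover have "inv (X i) \<otimes> (z \<otimes> s) = c \<otimes> q \<otimes> s" unfolding q'[symmetric] using Xi z s by (simp add: m_assoc)
      ultimately have "disp ?\<Omega> (X i) z (z \<otimes> s) = s" unfolding disp_def q' using cc q s by simp
      then show "\<exists>i\<in>{..<n}. disp (\<Lambda> - {u i}) (X i) z (z \<otimes> s) \<noteq> \<one>"
        using z(4) i(1) by (intro bexI[of _ i]) simp_all
    qed (use X in auto)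
    also have "\<dots> \<le> (\<Sum>i<n. (r + 1) ^ k)"
    proof (rule sum_mono)
      fix i assume "i \<in> {..<n}"
      then have i: "i < n" by simp
      let ?\<Omega> = "\<Lambda> - {u i}"
      have Xi: "X i \<in> carrier G" using X i by simp
      define P where "P z = X i \<otimes> gate ?\<Omega> (inv (X i) \<otimes> z)" for z
      have P: "P z \<in> carrier G" if "z \<in> carrier G" for z unfolding P_def using that Xi by simp
      have e: "inv (P x) \<otimes> P y = disp ?\<Omega> (X i) x y" unfolding P_def disp_def using Xi xy by simp
      have k: "k = card ?\<Omega>" using Suc.hyps(2) u(1)[OF i] by simp
      have \<Omega>V: "?\<Omega> \<subseteq> V" using Suc.prems(1) by blast
      have ePar: "inv (P x) \<otimes> P y \<in> par ?\<Omega>" unfolding e using disp_par Xi xy by simp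
      \<comment> \<open>Replacing \<open>x\<close> and \<open>y\<close> by their gates on the coset
        of \<open>X i\<close> changes no displacement on a coset inside it, so the assumption on
        \<open>r\<close> passes to the gates.\<close>
      have bound: "clen \<Lambda>' (disp \<Lambda>' w (P x) (P y)) \<le> r"
        if w: "\<Lambda>' \<subseteq> ?\<Omega>" "\<Lambda>' \<noteq> {}" "w \<in> carrier G" "inv (P x) \<otimes> w \<in> par ?\<Omega>" for \<Lambda>' w
      proof -
        have g: "gate ?\<Omega> (inv (X i) \<otimes> x) \<in> par ?\<Omega>" using gate_par Xi xy by simp
        have "inv (X i) \<otimes> w = gate ?\<Omega> (inv (X i) \<otimes> x) \<otimes> (inv (P x) \<otimes> w)"
          unfolding P_def using Xi xy w by (simp add: inv_mult_group m_assoc)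
        then have Xw: "inv (X i) \<otimes> w \<in> par ?\<Omega>" using par_mult[OF w(4) g] by simp
        have wst: "inv w \<otimes> w \<in> par (st \<Lambda>')" "inv (X i) \<otimes> w \<in> par (st ?\<Omega>)"
          using w(3) par_one par_mono[OF _ Xw] by (auto simp: st_def)
        have same: "disp \<Lambda>' w z (P z) = \<one>" if "z \<in> carrier G" for z
          unfolding P_def by (rule disp_gate[OF w(1) Xi w(3,3) that wst])
        have "disp \<Lambda>' w x (P x) \<otimes> disp \<Lambda>' w (P x) (P y) = disp \<Lambda>' w x (P y)"
          by (rule disp_mult) (use w xy P in auto)
        moreover have "disp \<Lambda>' w x y \<otimes> disp \<Lambda>' w y (P y) = disp \<Lambda>' w x (P y)"
          by (rule disp_mult) (use w xy P in auto)
        ultimately have "disp \<Lambda>' w (P x) (P y) = disp \<Lambda>' w x y"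
          unfolding same[OF xy(1)] same[OF xy(2)] using disp_carrier[OF w(3) P[OF xy(1)] P[OF xy(2)]]
            disp_carrier[OF w(3) xy] by simp
        moreover have "inv x \<otimes> w = p i \<otimes> (inv (X i) \<otimes> w)"
          unfolding X_def using xy w pc[of i] i by (simp add: inv_mult_group m_assoc)
        then have "inv x \<otimes> w \<in> par \<Lambda>" using par_mult[OF par_mono[OF Diff_subset Xw] p(3)[of i]] i by simp
        then have "clen \<Lambda>' (disp \<Lambda>' w x y) \<le> r" by (intro Suc.prems(5)) (use w in auto)
        ultimately show ?thesis by simp
      qed
      have "len (inv (P x) \<otimes> P y) \<le> (r + 1) ^ card ?\<Omega>"
        by (rule Suc.hyps(1)[OF k \<Omega>V P[OF xy(1)] P[OF xy(2)] ePar bound])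
      then show "len (disp ?\<Omega> (X i) x y) \<le> (r + 1) ^ k" unfolding e k .
    qed
    also have "\<dots> = n * (r + 1) ^ k" by simp
    also have "\<dots> \<le> (r + 1) * (r + 1) ^ k" using n unfolding n_def by (intro mult_right_mono) auto
    finally show ?thesis unfolding Suc.hyps(2)[symmetric] by simp
  qed
qed

subsection \<open>Bounded geodesic images and hyperbolicity\<close>

text \<open>Read the cone elements of \<open>t\<close> until one of them moves the gate. Inside it,
  \<open>disp_change\<close> finds a point that differs from the smaller coset by an element of
  \<open>par (lk {v})\<close>, and such elements move the gate on
  \<open>g \<cdot> par \<Lambda>\<close> within the proper part
  \<open>\<Lambda> \<inter> lk {v}\<close>. The cost is at most \<open>n - 1\<close> full steps, one
  partial step and one step in the link direction.\<close>

lemma near_coset_of_disp: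
  assumes "\<Lambda>' \<subset> \<Lambda>" "\<Lambda>' \<noteq> {}" and gh: "g \<in> carrier G" "h \<in> carrier G"
    and "p \<in> par \<Lambda>" "t \<in> cball \<Lambda> n" "disp \<Lambda>' h (g \<otimes> p) (g \<otimes> p \<otimes> t) \<noteq> \<one>"
  shows "\<exists>a\<in>par \<Lambda>'. clen \<Lambda> (inv p \<otimes> gate \<Lambda> (inv g \<otimes> (h \<otimes> a))) \<le> n + 1"
  using assms(6,7)
proof (induction n arbitrary: t)
  have ne: "\<Lambda> \<noteq> {}" using assms by blast
  interpret C: word_metric G "cone \<Lambda>" by (rule cone_word_metric) fact
  case 0
  then show ?case using disp_self gh par_carrier[OF assms(5)] by simp
next
  have ne: "\<Lambda> \<noteq> {}" using assms by blast
  interpret C: word_metric G "cone \<Lambda>" by (rule cone_word_metric) fact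
  case (Suc n)
  have p: "p \<in> carrier G" using assms par_carrier by blast
  obtain t1 t2 where t: "t = t1 \<otimes> t2" "t1 \<in> cball \<Lambda> n" "t2 \<in> cone \<Lambda>" using Suc.prems by auto
  have t1: "t1 \<in> carrier G" using C.ball_carrier t by blast
  have t2: "t2 \<in> carrier G" using C.T_carrier t by blast
  show ?case
  proof (cases "disp \<Lambda>' h (g \<otimes> p) (g \<otimes> p \<otimes> t1) = \<one>")
    case False
    then obtain a where "a \<in> par \<Lambda>'" "clen \<Lambda> (inv p \<otimes> gate \<Lambda> (inv g \<otimes> (h \<otimes> a))) \<le> n + 1"
      using Suc.IH[OF t(2)] by blast
    then show ?thesis by (intro bexI[of _ a]) auto
  next
    case True
    let ?q = "p \<otimes> t1"
    have "t1 \<in> par \<Lambda>" by (rule cball_par[OF ne t(2)])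
    then have q: "?q \<in> par \<Lambda>" "?q \<in> carrier G" using par_mult assms(5) p t1 by auto
    have x: "g \<otimes> p \<otimes> t1 \<in> carrier G" "g \<otimes> p \<otimes> t = g \<otimes> p \<otimes> t1 \<otimes> t2" "g \<otimes> p \<otimes> t1 = g \<otimes> ?q"
      using gh p t1 t2 t by (simp_all add: m_assoc)
    have "disp \<Lambda>' h (g \<otimes> p) (g \<otimes> p \<otimes> t1) \<otimes> disp \<Lambda>' h (g \<otimes> p \<otimes> t1) (g \<otimes> p \<otimes> t) = disp \<Lambda>' h (g \<otimes> p) (g \<otimes> p \<otimes> t)"
      by (rule disp_mult) (use gh p t1 t2 t in auto)
    then have ch: "disp \<Lambda>' h (g \<otimes> ?q) (g \<otimes> ?q \<otimes> t2) \<noteq> \<one>" using True Suc.prems(2) x gh p t1 t2 t by auto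
    obtain v w where "v \<in> \<Lambda>'" "w \<in> \<Lambda>" "w \<notin> \<Lambda>'" using assms by blast
    then obtain u where u: "u \<in> \<Lambda>" "t2 \<in> par (\<Lambda> - {u})" using cone_E[OF t(3), of v w] assms(1) by blast
    obtain t' v a where a: "t' \<in> par (\<Lambda> - {u})" "v \<in> \<Lambda>'" "v \<in> V" "a \<in> par \<Lambda>'"
      "inv (g \<otimes> ?q \<otimes> t') \<otimes> (h \<otimes> a) \<in> par (lk {v})"
      using disp_change[OF gh(2) _ u(2), of "g \<otimes> ?q" \<Lambda>'] ch q gh by auto
    have ac: "a \<in> carrier G" "t' \<in> carrier G" "t' \<in> par \<Lambda>" using a par_carrier par_mono[of "\<Lambda> - {u}" \<Lambda>] by auto
    let ?y = "h \<otimes> a" and ?x = "g \<otimes> ?q \<otimes> t'"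
    have xy: "?x \<in> carrier G" "?y \<in> carrier G" using gh q ac by auto
    have "disp \<Lambda> g ?x (?x \<otimes> (inv ?x \<otimes> ?y)) \<in> par (\<Lambda> \<inter> lk {v})" by (rule disp_near[OF gh(1) xy(1) a(5)])
    moreover have "\<Lambda> \<inter> lk {v} \<subset> \<Lambda>" using a(2) assms(1) lk_disjoint[of "{v}"] by auto
    ultimately have d: "disp \<Lambda> g ?x ?y \<in> cone \<Lambda>" using cone_subset xy by simp
    have "inv g \<otimes> ?x = ?q \<otimes> t'" using gh q ac by (simp add: m_assoc)
    then have "gate \<Lambda> (inv g \<otimes> ?x) = ?q \<otimes> t'" using gate_id par_mult[OF ac(3) q(1)] by simp
    then have "disp \<Lambda> g ?x ?y = inv (?q \<otimes> t') \<otimes> gate \<Lambda> (inv g \<otimes> ?y)" by (simp add: disp_def)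
    then have e: "inv p \<otimes> gate \<Lambda> (inv g \<otimes> ?y) = t1 \<otimes> (t' \<otimes> disp \<Lambda> g ?x ?y)"
      using p t1 ac gh xy q by (simp add: inv_mult_group m_assoc)
    have "t' \<in> cone \<Lambda>" using cone_subset[OF _ a(1)] u(1) by blast
    then have "t' \<otimes> disp \<Lambda> g ?x ?y \<in> cball \<Lambda> (Suc 0 + Suc 0)" by (rule C.ball_add[OF C.ball_1 C.ball_1[OF d]])
    then have "t1 \<otimes> (t' \<otimes> disp \<Lambda> g ?x ?y) \<in> cball \<Lambda> (n + (Suc 0 + Suc 0))" by (rule C.ball_add[OF t(2)])
    then have "clen \<Lambda> (inv p \<otimes> gate \<Lambda> (inv g \<otimes> ?y)) \<le> n + (Suc 0 + Suc 0)" unfolding e by (rule C.wlen_le)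
    then show ?thesis using a(4) by (intro bexI[of _ a]) simp_all
  qed
qed

definition cspace :: "'v set \<Rightarrow> ('a \<Rightarrow> real) set" where
  "cspace \<Lambda> = integer_path_metric.realisation (par \<Lambda>) (\<lambda>x y. clen \<Lambda> (inv x \<otimes> y))"

definition cdist :: "'v set \<Rightarrow> ('a \<Rightarrow> real) \<Rightarrow> ('a \<Rightarrow> real) \<Rightarrow> real" where
  "cdist \<Lambda> = integer_path_metric.rdist (par \<Lambda>) (\<lambda>x y. clen \<Lambda> (inv x \<otimes> y))"

definition cpoint :: "'v set \<Rightarrow> 'a \<Rightarrow> 'a \<Rightarrow> real" where
  "cpoint \<Lambda> = integer_path_metric.vertex (par \<Lambda>) (\<lambda>x y. clen \<Lambda> (inv x \<otimes> y))"

lemma cspace_geodesic: "\<Lambda> \<noteq> {} \<Longrightarrow> geodesic_space (cspace \<Lambda>) (cdist \<Lambda>)"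
  unfolding cspace_def cdist_def by (rule integer_path_metric.realisation_geodesic[OF cone_path_metric])

lemma cspace_metric: "\<Lambda> \<noteq> {} \<Longrightarrow> Metric_space (cspace \<Lambda>) (cdist \<Lambda>)"
  using cspace_geodesic unfolding geodesic_space_def by blast

lemma cpoint_cspace: "\<Lambda> \<noteq> {} \<Longrightarrow> x \<in> par \<Lambda> \<Longrightarrow> cpoint \<Lambda> x \<in> cspace \<Lambda>"
  unfolding cspace_def cpoint_def by (rule integer_path_metric.vertex_realisation[OF cone_path_metric])

lemma cdist_cpoint: "\<Lambda> \<noteq> {} \<Longrightarrow> x \<in> par \<Lambda> \<Longrightarrow> y \<in> par \<Lambda> \<Longrightarrow>
    cdist \<Lambda> (cpoint \<Lambda> x) (cpoint \<Lambda> y) = real (clen \<Lambda> (inv x \<otimes> y))"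
  unfolding cdist_def cpoint_def by (rule integer_path_metric.rdist_vertices[OF cone_path_metric])

lemma cpoint_dense: "\<Lambda> \<noteq> {} \<Longrightarrow> f \<in> cspace \<Lambda> \<Longrightarrow> \<exists>u\<in>cpoint \<Lambda> ` par \<Lambda>. cdist \<Lambda> f u \<le> 1"
  using integer_path_metric.vertex_dense[OF cone_path_metric, of \<Lambda> f] unfolding cspace_def cdist_def cpoint_def by blast

lemma cpoint_inj: "\<Lambda> \<noteq> {} \<Longrightarrow> x \<in> par \<Lambda> \<Longrightarrow> y \<in> par \<Lambda> \<Longrightarrow> cpoint \<Lambda> x = cpoint \<Lambda> y \<Longrightarrow> x = y"
proof -
  assume *: "\<Lambda> \<noteq> {}" "x \<in> par \<Lambda>" "y \<in> par \<Lambda>" "cpoint \<Lambda> x = cpoint \<Lambda> y"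
  have "clen \<Lambda> (inv x \<otimes> y) = clen \<Lambda> (inv x \<otimes> x)" using cdist_cpoint[OF *(1,2)] * by (metis of_nat_eq_iff)
  also have "\<dots> = 0" using clen_one * par_carrier by simp
  finally have "inv x \<otimes> y = \<one>" using clen_eq_0 par_mult par_inv * by simp
  then show ?thesis using inv_eq_one_iff par_carrier[OF *(2)] par_carrier[OF *(3)] by blast
qed

text \<open>Somewhere along the chain the gate changes; \<open>near_coset_of_disp\<close> for that
  link, of length at most 3, gives 3 + 1.\<close>

lemma chain_near_coset:
  assumes "\<Lambda>' \<subset> \<Lambda>" "\<Lambda>' \<noteq> {}" and gh: "g \<in> carrier G" "h \<in> carrier G"
    and B: "B \<subseteq> cpoint \<Lambda> ` par \<Lambda>" and xy: "x \<in> par \<Lambda>" "y \<in> par \<Lambda>"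
    and chain: "(cpoint \<Lambda> x, cpoint \<Lambda> y) \<in> (chain_rel B (cdist \<Lambda>) 3)\<^sup>*"
    and ne: "disp \<Lambda>' h (g \<otimes> x) (g \<otimes> y) \<noteq> \<one>"
  shows "\<exists>a\<in>par \<Lambda>'. \<exists>b\<in>par \<Lambda>. cpoint \<Lambda> b \<in> B \<and> clen \<Lambda> (inv b \<otimes> gate \<Lambda> (inv g \<otimes> (h \<otimes> a))) \<le> 4"
proof -
  have \<Lambda>: "\<Lambda> \<noteq> {}" using assms by blast
  define P where "P u \<longleftrightarrow> (\<forall>b\<in>par \<Lambda>. u = cpoint \<Lambda> b \<longrightarrow> disp \<Lambda>' h (g \<otimes> x) (g \<otimes> b) = \<one>)" for u
  have xc: "x \<in> carrier G" using xy par_carrier by blast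
  have "P (cpoint \<Lambda> x)" unfolding P_def using cpoint_inj[OF \<Lambda> xy(1)] disp_self gh xc by fastforce
  moreover have "\<not> P (cpoint \<Lambda> y)" unfolding P_def using ne xy by blast
  ultimately obtain u u' where u: "(u, u') \<in> chain_rel B (cdist \<Lambda>) 3" "P u" "\<not> P u'"
    using rtrancl_crossing[OF chain] by blast
  then have uB: "u \<in> B" "cdist \<Lambda> u u' \<le> 3" by (auto simp: chain_rel_def)
  obtain b' where b': "b' \<in> par \<Lambda>" "u' = cpoint \<Lambda> b'" "disp \<Lambda>' h (g \<otimes> x) (g \<otimes> b') \<noteq> \<one>"
    using u(3) unfolding P_def by blast
  obtain b where b: "b \<in> par \<Lambda>" "u = cpoint \<Lambda> b" using uB B by blast
  have c: "b \<in> carrier G" "b' \<in> carrier G" using b b' par_carrier by auto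
  have "disp \<Lambda>' h (g \<otimes> x) (g \<otimes> b) \<otimes> disp \<Lambda>' h (g \<otimes> b) (g \<otimes> b') = disp \<Lambda>' h (g \<otimes> x) (g \<otimes> b')"
    by (rule disp_mult) (use gh xc c in auto)
  moreover have "disp \<Lambda>' h (g \<otimes> x) (g \<otimes> b) = \<one>" using u(2) b unfolding P_def by blast
  ultimately have "disp \<Lambda>' h (g \<otimes> b) (g \<otimes> b') \<noteq> \<one>" using b'(3) gh c by auto
  moreover have "g \<otimes> b' = g \<otimes> b \<otimes> (inv b \<otimes> b')" using gh c by (simp add: m_assoc)
  ultimately have d: "disp \<Lambda>' h (g \<otimes> b) (g \<otimes> b \<otimes> (inv b \<otimes> b')) \<noteq> \<one>" by simp
  have i: "inv b \<otimes> b' \<in> par \<Lambda>" using par_mult par_inv b b' by simp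
  have "clen \<Lambda> (inv b \<otimes> b') \<le> 3" using uB(2) cdist_cpoint[OF \<Lambda> b(1) b'(1)] b(2) b'(2) by simp
  then have "inv b \<otimes> b' \<in> cball \<Lambda> 3" by (rule clen_ball[OF \<Lambda> i])
  then obtain a where "a \<in> par \<Lambda>'" "clen \<Lambda> (inv b \<otimes> gate \<Lambda> (inv g \<otimes> (h \<otimes> a))) \<le> 3 + 1"
    using near_coset_of_disp[OF assms(1,2) gh b(1) _ d] by blast
  then show ?thesis using b uB by auto
qed

text \<open>Syllable geodesics in \<open>par \<Lambda>\<close> consist of bottlenecks: the syllable that starts at \<open>z\<close> is seen by
  the gate on \<open>z \<cdot> par {v}\<close>.\<close>

lemma cspace_hyperbolic:
  assumes \<Lambda>: "\<Lambda> \<noteq> {}" "\<Lambda> \<subseteq> V"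
  shows "hyperbolic 30 (cspace \<Lambda>) (cdist \<Lambda>)"
proof (rule hyperbolic_of_bottleneck[OF cspace_metric[OF \<Lambda>(1)], of "cpoint \<Lambda> ` par \<Lambda>"])
  show "cpoint \<Lambda> ` par \<Lambda> \<subseteq> cspace \<Lambda>" using cpoint_cspace[OF \<Lambda>(1)] by blast
  show "\<exists>u\<in>cpoint \<Lambda> ` par \<Lambda>. cdist \<Lambda> f u \<le> 1" if "f \<in> cspace \<Lambda>" for f using cpoint_dense[OF \<Lambda>(1) that] .
  fix f1 f2 assume "f1 \<in> cpoint \<Lambda> ` par \<Lambda>" "f2 \<in> cpoint \<Lambda> ` par \<Lambda>"
  then obtain x y where xy: "x \<in> par \<Lambda>" "y \<in> par \<Lambda>" and f: "f1 = cpoint \<Lambda> x" "f2 = cpoint \<Lambda> y" by blast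
  have xyc: "x \<in> carrier G" "y \<in> carrier G" using xy par_carrier by auto
  \<comment> \<open>The points on syllable geodesics from \<open>x\<close> to
    \<open>y\<close>.\<close>
  define Z where "Z = {z \<in> par \<Lambda>. len (inv x \<otimes> z) + len (inv z \<otimes> y) = len (inv x \<otimes> y)}"
  have xZ: "x \<in> Z" and yZ: "y \<in> Z" unfolding Z_def using xy xyc syl.wlen_one by auto
  have path: "(cpoint \<Lambda> x, cpoint \<Lambda> z) \<in> (chain_rel (cpoint \<Lambda> ` Z) (cdist \<Lambda>) 1)\<^sup>*"
    if "z \<in> Z" "len (inv x \<otimes> z) = k" for z k
    using that
  proof (induction k arbitrary: z)
    case 0
    then have z: "z \<in> carrier G" unfolding Z_def using par_carrier by blast
    then have "inv x \<otimes> z = \<one>" using len_eq_0[of "inv x \<otimes> z"] 0 xyc by simp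
    then have "z = x" using inv_eq_one_iff xyc z by blast
    then show ?case by simp
  next
    case (Suc k)
    have z: "z \<in> par \<Lambda>" "z \<in> carrier G" using Suc.prems par_carrier unfolding Z_def by auto
    have xz: "inv x \<otimes> z \<in> par \<Lambda>" using par_mult[OF z(1) par_inv[OF xy(1)]] .
    have "inv x \<otimes> z \<in> syl.ball (Suc k)" using len_ball[of "inv x \<otimes> z"] Suc.prems xyc z by simp
    then obtain u s where us: "inv x \<otimes> z = u \<otimes> s" "u \<in> syl.ball k" "s \<in> letters" "len u = k" "len s = 1"
      using Suc.prems(2) by (rule syl.ball_Suc_E)
    have u: "u \<in> carrier G" using us syl.ball_carrier by blast
    have "s \<noteq> \<one>" using us syl.wlen_one by auto
    then obtain v where v: "v \<in> V" "s \<in> S v" using us(3) by (auto elim: letter_E)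
    then have s: "s \<in> carrier G" by blast
    have v\<Lambda>: "v \<in> \<Lambda>"
    proof (rule ccontr)
      assume "v \<notin> \<Lambda>"
      then have "gate \<Lambda> (u \<otimes> s) = gate \<Lambda> u" using gate_unmoved[OF u v, of \<Lambda>] by blast
      then have "u \<otimes> s = gate \<Lambda> u" using gate_id[OF xz] us(1) by simp
      then show False using len_gate[OF u, of \<Lambda>] us Suc.prems by simp
    qed
    have sp: "s \<in> par \<Lambda>" "s \<in> cone \<Lambda>" using par_letter cone_letter v v\<Lambda> by auto
    have "u = (inv x \<otimes> z) \<otimes> inv s" using us(1) u s by (simp add: m_assoc)
    then have up: "u \<in> par \<Lambda>" using par_mult[OF par_inv[OF sp(1)] xz] by simp
    let ?z = "x \<otimes> u"
    have "x \<otimes> (inv x \<otimes> z) = z" using xyc z by simp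
    then have zs: "z = ?z \<otimes> s" unfolding us(1) using xyc u s by (simp add: m_assoc)
    have z'c: "?z \<in> carrier G" using xyc u by simp
    have "inv ?z \<otimes> y = s \<otimes> (inv z \<otimes> y)" unfolding zs using z'c s xyc by (simp add: inv_mult_group m_assoc)
    then have 1: "len (inv ?z \<otimes> y) \<le> 1 + len (inv z \<otimes> y)" using len_mult[of s "inv z \<otimes> y"] us s z xyc by simp
    have 2: "len (inv x \<otimes> y) \<le> len (inv x \<otimes> ?z) + len (inv ?z \<otimes> y)"
      using len_mult[of "inv x \<otimes> ?z" "inv ?z \<otimes> y"] telescope[of x ?z y] z'c xyc by simp
    have 3: "len (inv x \<otimes> ?z) = k" using us xyc u by simp
    have "len (inv x \<otimes> z) + len (inv z \<otimes> y) = len (inv x \<otimes> y)" using Suc.prems unfolding Z_def by simp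
    then have z'Z: "?z \<in> Z" unfolding Z_def using 1 2 3 Suc.prems(2) par_mult[OF up xy(1)] by simp
    have "cdist \<Lambda> (cpoint \<Lambda> ?z) (cpoint \<Lambda> z) = real (clen \<Lambda> s)"
      using cdist_cpoint[OF \<Lambda>(1) par_mult[OF up xy(1)] z(1)] unfolding zs using z'c s by simp
    then have "(cpoint \<Lambda> ?z, cpoint \<Lambda> z) \<in> chain_rel (cpoint \<Lambda> ` Z) (cdist \<Lambda>) 1"
      using clen_cone[OF sp(2)] z'Z Suc.prems(1) unfolding chain_rel_def by auto
    then show ?case using Suc.IH[OF z'Z 3] by (rule rtrancl_into_rtrancl[rotated])
  qed
  have neck: "\<exists>u\<in>B. cdist \<Lambda> (cpoint \<Lambda> z) u \<le> 6"
    if z: "z \<in> Z" and B: "B \<subseteq> cpoint \<Lambda> ` par \<Lambda>" "f1 \<in> B" and chain: "(f1, f2) \<in> (chain_rel B (cdist \<Lambda>) 3)\<^sup>*"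
    for z B
  \<comment> \<open>At \<open>y\<close> no further syllable starts. For a single vertex,
    \<open>{v}\<close> is not a proper subset to which \<open>chain_near_coset\<close> could apply,
    but the space is bounded.\<close>
  proof (cases "z = y \<or> (\<exists>v. \<Lambda> = {v})")
    case True
    have zp: "z \<in> par \<Lambda>" "z \<in> carrier G" using z par_carrier unfolding Z_def by auto
    show ?thesis
    proof (cases "z = y")
      case True
      have "f2 \<in> B" using chain B(2) by (cases rule: rtranclE) (auto simp: chain_rel_def)
      then show ?thesis using True f cdist_cpoint[OF \<Lambda>(1) xy(2,2)] clen_one[OF \<Lambda>(1)] xyc by (intro bexI[of _ f2]) auto
    next
      case False
      then obtain v where v: "\<Lambda> = {v}" using True by blast
      have i: "inv z \<otimes> x \<in> par \<Lambda>" using par_mult[OF xy(1) par_inv[OF zp(1)]] .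
      then have "inv z \<otimes> x \<in> cone \<Lambda>" using par_single[of "inv z \<otimes> x" v] cone_letter[of v \<Lambda>] v \<Lambda> by simp
      then show ?thesis using clen_cone[of "inv z \<otimes> x" \<Lambda>] cdist_cpoint[OF \<Lambda>(1) zp(1) xy(1)] f B by (intro bexI[of _ f1]) auto
    qed
  next
    case False
    have zp: "z \<in> par \<Lambda>" "z \<in> carrier G" and zl: "len (inv x \<otimes> z) + len (inv z \<otimes> y) = len (inv x \<otimes> y)"
      using z par_carrier unfolding Z_def by auto
    have "inv y \<otimes> z \<noteq> \<one>" using False inv_eq_one_iff[of y z] xyc zp by blast
    then obtain k where k: "len (inv y \<otimes> z) = Suc k" using len_eq_0[of "inv y \<otimes> z"] xyc zp by (cases "len (inv y \<otimes> z)") auto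
    have "inv y \<otimes> z \<in> syl.ball (Suc k)" using len_ball[of "inv y \<otimes> z"] k xyc zp by simp
    then obtain u s where us: "inv y \<otimes> z = u \<otimes> s" "u \<in> syl.ball k" "s \<in> letters" "len u = k" "len s = 1"
      using k by (rule syl.ball_Suc_E)
    have u: "u \<in> carrier G" using us syl.ball_carrier by blast
    have s1: "s \<noteq> \<one>" using us syl.wlen_one by auto
    then obtain v where v: "v \<in> V" "s \<in> S v" using us(3) by (auto elim: letter_E)
    then have s: "s \<in> carrier G" "inv s \<in> par {v}" "inv s \<in> S v"
      using par_letter par_inv subgroup.m_inv_closed[OF S_subgroup] by auto
    have iz: "inv (inv y \<otimes> z) = inv z \<otimes> y" using xyc zp by (simp add: inv_mult_group)
    then have zy: "inv z \<otimes> y = inv s \<otimes> inv u" unfolding us(1) using u s by (simp add: inv_mult_group)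
    have "gate {v} (inv u) = \<one>" using gate_of_long[OF u v] us k by simp
    then have gy: "gate {v} (inv z \<otimes> y) = inv s" unfolding zy using gate_left[of "inv u" "inv s" "{v}"] u s by simp
    have "len (inv (inv y \<otimes> z)) = Suc k" using syl.wlen_inv[of "inv y \<otimes> z"] k xyc zp by simp
    then have lzy: "len (inv z \<otimes> y) = Suc (len u)" using iz us(4) by simp
    have "inv x \<otimes> y = (inv x \<otimes> z) \<otimes> (inv z \<otimes> y)" using telescope[of x z y] xyc zp by simp
    then have "inv x \<otimes> y = (inv x \<otimes> z \<otimes> inv s) \<otimes> inv u" unfolding zy using xyc zp u s by (simp add: m_assoc)
    then have "len (inv x \<otimes> y) \<le> len (inv x \<otimes> z \<otimes> inv s) + len u"
      using len_mult[of "inv x \<otimes> z \<otimes> inv s" "inv u"] syl.wlen_inv[OF u] xyc zp u s by simp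
    then have "len (inv x \<otimes> z \<otimes> inv s) = len (inv x \<otimes> z) + 1"
      using zl lzy len_mult[of "inv x \<otimes> z" "inv s"] len_letter[OF v(1) s(3)] xyc zp s by simp
    then have "gate {v} (inv (inv x \<otimes> z)) = \<one>" using gate_of_long[OF _ v(1) s(3)] xyc zp by simp
    then have gx: "gate {v} (inv z \<otimes> x) = \<one>" using xyc zp by (simp add: inv_mult_group)
    \<comment> \<open>The gate on \<open>z \<cdot> par {v}\<close> sends \<open>x\<close> to
      \<open>z\<close> and \<open>y\<close> to \<open>z \<otimes> inv s\<close>, so every chain from
      \<open>x\<close> to \<open>y\<close> has to change it.\<close>
    have d: "disp {v} z (\<one> \<otimes> x) (\<one> \<otimes> y) \<noteq> \<one>"
      unfolding disp_def using gx gy s s1 xyc by (auto simp: inv_eq_1_iff)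
    have v\<Lambda>: "v \<in> \<Lambda>"
    proof (rule ccontr)
      assume "v \<notin> \<Lambda>"
      moreover have "gate {v} (inv z \<otimes> y) \<in> par ({v} \<inter> \<Lambda>)" using gate_in[OF par_mult[OF xy(2) par_inv[OF zp(1)]]] .
      ultimately have "inv s = \<one>" using gy par_empty by simp
      then show False using s1 s by (simp add: inv_eq_1_iff)
    qed
    then have "{v} \<subset> \<Lambda>" using False by blast
    then obtain a b where ab: "a \<in> par {v}" "b \<in> par \<Lambda>" "cpoint \<Lambda> b \<in> B" "clen \<Lambda> (inv b \<otimes> gate \<Lambda> (inv \<one> \<otimes> (z \<otimes> a))) \<le> 4"
      using chain_near_coset[OF _ _ one_closed zp(2) B(1) xy chain[unfolded f] d] by blast
    have a: "a \<in> par \<Lambda>" "a \<in> cone \<Lambda>" "a \<in> carrier G"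
      using ab(1) par_mono[of "{v}" \<Lambda>] v\<Lambda> cone_letter[OF v\<Lambda> v(1)] par_single[OF _ v(1)] par_carrier by auto
    have b: "b \<in> carrier G" using ab par_carrier by blast
    have "gate \<Lambda> (inv \<one> \<otimes> (z \<otimes> a)) = z \<otimes> a" using gate_id par_mult[OF a(1) zp(1)] zp a by simp
    then have 1: "clen \<Lambda> (inv b \<otimes> (z \<otimes> a)) \<le> 4" using ab by simp
    have "inv z \<otimes> b = a \<otimes> inv (inv b \<otimes> (z \<otimes> a))" using zp b a by (simp add: inv_mult_group m_assoc)
    moreover have ib: "inv b \<otimes> (z \<otimes> a) \<in> par \<Lambda>" using par_mult par_inv ab a zp by simp
    ultimately have "clen \<Lambda> (inv z \<otimes> b) \<le> 1 + 4"
      using clen_mult[OF \<Lambda>(1) a(1) par_inv[OF ib]] clen_inv[OF \<Lambda>(1) ib] clen_cone[OF a(2)] 1 by simp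
    then show ?thesis using cdist_cpoint[OF \<Lambda>(1) zp(1) ab(2)] ab(3) by (intro bexI[of _ "cpoint \<Lambda> b"]) auto
  qed
  show "\<exists>Z\<subseteq>cpoint \<Lambda> ` par \<Lambda>. f1 \<in> Z \<and> (f1, f2) \<in> (chain_rel Z (cdist \<Lambda>) 1)\<^sup>* \<and>
      (\<forall>z\<in>Z. \<forall>B\<subseteq>cpoint \<Lambda> ` par \<Lambda>. f1 \<in> B \<longrightarrow> (f1, f2) \<in> (chain_rel B (cdist \<Lambda>) 3)\<^sup>* \<longrightarrow> (\<exists>u\<in>B. cdist \<Lambda> z u \<le> 6))"
  proof (intro exI[of _ "cpoint \<Lambda> ` Z"] conjI ballI allI impI)
    show "cpoint \<Lambda> ` Z \<subseteq> cpoint \<Lambda> ` par \<Lambda>" unfolding Z_def by blast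
    show "f1 \<in> cpoint \<Lambda> ` Z" using xZ f by blast
    show "(f1, f2) \<in> (chain_rel (cpoint \<Lambda> ` Z) (cdist \<Lambda>) 1)\<^sup>*" using path[OF yZ HOL.refl] f by simp
    fix z B assume "z \<in> cpoint \<Lambda> ` Z" "B \<subseteq> cpoint \<Lambda> ` par \<Lambda>" "f1 \<in> B" "(f1, f2) \<in> (chain_rel B (cdist \<Lambda>) 3)\<^sup>*"
    then show "\<exists>u\<in>B. cdist \<Lambda> z u \<le> 6" using neck by blast
  qed
qed

end

section \<open>The hierarchy of parallelism classes\<close>

lemma set_dist_singletons: "set_dist d {a} {b} = d a b"
  by (simp add: set_dist_def)

lemma set_dist_le:
  assumes "Metric_space M d" "a \<in> A" "b \<in> B"
  shows "set_dist d A B \<le> d a b"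
proof -
  have "bdd_below ((\<lambda>(a, b). d a b) ` (A \<times> B))"
    using Metric_space.nonneg[OF assms(1)] by (intro bdd_belowI[of _ 0]) auto
  then have "(INF (a, b)\<in>A \<times> B. d a b) \<le> (case (a, b) of (a, b) \<Rightarrow> d a b)"
    by (rule cINF_lower) (use assms in auto)
  then show ?thesis by (simp add: set_dist_def)
qed

lemma hyperbolic_mono:
  assumes "hyperbolic \<delta> M d" "\<delta> \<le> \<delta>'"
  shows "hyperbolic \<delta>' M d"
  unfolding hyperbolic_def
proof (intro ballI allI impI)
  fix x y z S T U p
  assume "x \<in> M" "y \<in> M" "z \<in> M" "p \<in> S"
    "geodesic_segment M d x y S \<and> geodesic_segment M d y z T \<and> geodesic_segment M d x z U"
  then have "\<exists>q\<in>T \<union> U. d p q \<le> \<delta>" using assms(1) unfolding hyperbolic_def by blast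
  then show "\<exists>q\<in>T \<union> U. d p q \<le> \<delta>'" using assms(2) by force
qed

text \<open>An index \<open>W\<close> stands for the class of the cosets of \<open>par (lam W)\<close> that are parallel to
  \<open>rep W \<cdot> par (lam W)\<close>; the union of these is the coset \<open>region W\<close> of \<open>par (st (lam W))\<close>.\<close>

locale parallelism_classes = gated_group G V adj S
  for G :: "('a, 'm) monoid_scheme" (structure) and V :: "'v set" and adj and S :: "'v \<Rightarrow> 'a set" +
  fixes I :: "'i set" and lam :: "'i \<Rightarrow> 'v set" and rep :: "'i \<Rightarrow> 'a"
  assumes V_nonempty: "V \<noteq> {}"
    and lam: "W \<in> I \<Longrightarrow> lam W \<subseteq> V" "W \<in> I \<Longrightarrow> lam W \<noteq> {}"
    and rep: "W \<in> I \<Longrightarrow> rep W \<in> carrier G"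
    and index_eq: "U \<in> I \<Longrightarrow> W \<in> I \<Longrightarrow> lam U = lam W \<Longrightarrow> inv (rep U) \<otimes> rep W \<in> par (st (lam U)) \<Longrightarrow> U = W"
    and index_exists: "\<Lambda> \<subseteq> V \<Longrightarrow> \<Lambda> \<noteq> {} \<Longrightarrow> g \<in> carrier G \<Longrightarrow>
      \<exists>W\<in>I. lam W = \<Lambda> \<and> inv g \<otimes> rep W \<in> par (st \<Lambda>)"
begin

section \<open>Relations, projections and constants of the hierarchy\<close>

definition region :: "'i \<Rightarrow> 'a set" where
  "region W = {x \<in> carrier G. inv (rep W) \<otimes> x \<in> par (st (lam W))}"

text \<open>Some coset of the class \<open>U\<close> lies in some coset of the class
  \<open>W\<close>, namely the cosets through a common point of the two regions.\<close>

definition nest :: "'i \<Rightarrow> 'i \<Rightarrow> bool" where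
  "nest U W \<longleftrightarrow> lam U \<subseteq> lam W \<and> region U \<inter> region W \<noteq> {}"

text \<open>Through a common point of the regions pass cosets of the two classes whose parabolic
  subgroups commute.\<close>

definition orth :: "'i \<Rightarrow> 'i \<Rightarrow> bool" where
  "orth U W \<longleftrightarrow> lam U \<subseteq> lk (lam W) \<and> region U \<inter> region W \<noteq> {}"

definition shadow :: "'i \<Rightarrow> 'a \<Rightarrow> 'a" where
  "shadow W x = gate (lam W) (inv (rep W) \<otimes> x)"

definition proj :: "'i \<Rightarrow> 'a \<Rightarrow> ('a \<Rightarrow> real) set" where
  "proj W x = {cpoint (lam W) (shadow W x)}"

text \<open>One formula serves nested and transverse pairs. A point of two regions projects into
  both of their relative projections, which settles nested consistency and the second half of
  partial realisation.\<close>

definition rel :: "'i \<Rightarrow> 'i \<Rightarrow> ('a \<Rightarrow> real) set" where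
  "rel U W = (\<Union>x\<in>region U. proj W x)"

abbreviation shift :: "'i \<Rightarrow> 'a \<Rightarrow> 'a \<Rightarrow> 'a" where
  "shift W \<equiv> disp (lam W) (rep W)"

text \<open>A chain of nested indices is mapped injectively into the subsets of \<open>V\<close>,
  whence the power of two; 40 leaves room for the hyperbolicity constant 30 and the smaller
  constants.\<close>

definition bound :: real where
  "bound = 2 ^ card V + 40"

lemma bound_ge: "bound \<ge> 40" "bound > 0"
  by (simp_all add: bound_def add_pos_pos)

lemma region_carrier: "x \<in> region W \<Longrightarrow> x \<in> carrier G"
  by (simp add: region_def)

section \<open>Product regions and the order axioms\<close>

lemma region_iff:
  assumes "W \<in> I" "x \<in> region W" "y \<in> carrier G"
  shows "y \<in> region W \<longleftrightarrow> inv x \<otimes> y \<in> par (st (lam W))"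
proof -
  have x: "x \<in> carrier G" "inv (rep W) \<otimes> x \<in> par (st (lam W))" using assms by (auto simp: region_def)
  note r = rep[OF assms(1)]
  have 1: "inv (rep W) \<otimes> y = (inv (rep W) \<otimes> x) \<otimes> (inv x \<otimes> y)" using telescope[OF r x(1) assms(3)] by (simp only:)
  have 2: "inv x \<otimes> y = inv (inv (rep W) \<otimes> x) \<otimes> (inv (rep W) \<otimes> y)" using r x assms(3) by simp
  show ?thesis
  proof
    assume "y \<in> region W"
    then show "inv x \<otimes> y \<in> par (st (lam W))" unfolding 2 using par_mult par_inv[OF x(2)] by (simp add: region_def)
  next
    assume "inv x \<otimes> y \<in> par (st (lam W))"
    then have "inv (rep W) \<otimes> y \<in> par (st (lam W))" unfolding 1 using par_mult x(2) by blast
    then show "y \<in> region W" using assms(3) by (simp add: region_def)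
  qed
qed

lemma region_extend:
  assumes "W \<in> I" "x \<in> region W" "y \<in> par \<Omega>" "\<Omega> \<subseteq> st (lam W)"
  shows "x \<otimes> y \<in> region W"
proof -
  have "x \<in> carrier G" "y \<in> carrier G" using assms region_carrier par_carrier by auto
  then show ?thesis using region_iff[OF assms(1,2), of "x \<otimes> y"] par_mono[OF assms(4,3)] by simp
qed

lemma rep_region: "W \<in> I \<Longrightarrow> rep W \<in> region W"
  using rep par_one by (simp add: region_def)

lemma coset_region: "W \<in> I \<Longrightarrow> a \<in> par (lam W) \<Longrightarrow> rep W \<otimes> a \<in> region W"
  by (rule region_extend[OF _ rep_region]) (auto simp: st_def)

lemma index_eqI:
  assumes "U \<in> I" "W \<in> I" "lam U = lam W" "region U \<inter> region W \<noteq> {}"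
  shows "U = W"
proof -
  obtain x where x: "x \<in> region U" "x \<in> region W" using assms by blast
  note c = region_carrier[OF x(1)] rep[OF assms(1)] rep[OF assms(2)]
  have "inv (rep U) \<otimes> rep W = (inv (rep U) \<otimes> x) \<otimes> inv (inv (rep W) \<otimes> x)"
    using c by (simp add: inv_mult_group m_assoc)
  also have "\<dots> \<in> par (st (lam U))"
    by (rule par_mult[OF par_inv]) (use x assms(3) in \<open>simp_all add: region_def\<close>)
  finally show ?thesis using index_eq assms by blast
qed

lemma shadow_par: "W \<in> I \<Longrightarrow> x \<in> carrier G \<Longrightarrow> shadow W x \<in> par (lam W)"
  unfolding shadow_def using gate_par rep by simp

lemma shadow_carrier: "W \<in> I \<Longrightarrow> x \<in> carrier G \<Longrightarrow> shadow W x \<in> carrier G"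
  using shadow_par par_carrier by blast

lemma shift_shadow: "shift W x y = inv (shadow W x) \<otimes> shadow W y"
  by (simp add: disp_def shadow_def)

lemma shift_par: "W \<in> I \<Longrightarrow> x \<in> carrier G \<Longrightarrow> y \<in> carrier G \<Longrightarrow> shift W x y \<in> par (lam W)"
  using disp_par rep by blast

lemma cdist_shadow:
  "W \<in> I \<Longrightarrow> x \<in> carrier G \<Longrightarrow> y \<in> carrier G \<Longrightarrow>
    cdist (lam W) (cpoint (lam W) (shadow W x)) (cpoint (lam W) (shadow W y)) = real (clen (lam W) (shift W x y))"
  using cdist_cpoint[OF lam(2) shadow_par shadow_par] by (simp add: shift_shadow)

lemma set_dist_proj:
  "W \<in> I \<Longrightarrow> x \<in> carrier G \<Longrightarrow> y \<in> carrier G \<Longrightarrow>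
    set_dist (cdist (lam W)) (proj W x) (proj W y) = real (clen (lam W) (shift W x y))"
  by (simp add: proj_def set_dist_singletons cdist_shadow)

lemma metric: "W \<in> I \<Longrightarrow> Metric_space (cspace (lam W)) (cdist (lam W))"
  using cspace_metric lam(2) by blast

lemma set_dist_proj_rel:
  assumes "W \<in> I" "x \<in> carrier G" "y \<in> region U"
  shows "set_dist (cdist (lam W)) (proj W x) (rel U W) \<le> real (clen (lam W) (shift W x y))"
proof -
  have "set_dist (cdist (lam W)) (proj W x) (rel U W)
      \<le> cdist (lam W) (cpoint (lam W) (shadow W x)) (cpoint (lam W) (shadow W y))"
    using assms by (intro set_dist_le[OF metric]) (auto simp: proj_def rel_def)
  then show ?thesis using cdist_shadow assms region_carrier by simp
qed

text \<open>Going from \<open>x\<close> to \<open>y\<close> inside \<open>region U\<close> splits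
  into a part along \<open>lam U\<close> and a part in its link. The link part does not leave
  \<open>region T\<close>, the other part, undone from \<open>y\<close>, does not leave
  \<open>region W\<close>, and the two meet. The last assumption covers both
  \<open>lam U \<subseteq> lam W\<close> and \<open>lam U \<subseteq> lk (lam W)\<close>, for
  transitivity and for orthogonality.\<close>

lemma meet_slide:
  assumes I: "T \<in> I" "U \<in> I" "W \<in> I"
    and "region T \<inter> region U \<noteq> {}" "region U \<inter> region W \<noteq> {}" "lam T \<subseteq> lam U" "lam U \<subseteq> st (lam W)"
  shows "region T \<inter> region W \<noteq> {}"
proof -
  obtain x y where x: "x \<in> region T" "x \<in> region U" and y: "y \<in> region U" "y \<in> region W" using assms by blast
  note c = region_carrier[OF x(1)] region_carrier[OF y(1)]
  have "inv x \<otimes> y \<in> par (st (lam U))" using region_iff[OF I(2) x(2) c(2)] y by blast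
  then obtain a b where ab: "a \<in> par (lam U)" "b \<in> par (lk (lam U))" "inv x \<otimes> y = a \<otimes> b" by (rule par_st)
  have abc: "a \<in> carrier G" "b \<in> carrier G" using ab par_carrier by auto
  have "lk (lam U) \<subseteq> st (lam T)" using lk_antimono[OF assms(6)] by (auto simp: st_def)
  then have "x \<otimes> b \<in> region T" by (rule region_extend[OF I(1) x(1) ab(2)])
  have "x \<otimes> (inv x \<otimes> y) = y" using c by simp
  then have "x \<otimes> (b \<otimes> a) = y" using ab(3) par_lk_comm[OF ab(1,2)] by simp
  then have "y \<otimes> inv a = x \<otimes> (b \<otimes> a) \<otimes> inv a" by simp
  then have "y \<otimes> inv a = x \<otimes> b" using abc c by (simp add: m_assoc)
  moreover have "y \<otimes> inv a \<in> region W" by (rule region_extend[OF I(3) y(2) par_inv[OF ab(1)] assms(7)])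
  ultimately show ?thesis using \<open>x \<otimes> b \<in> region T\<close> by auto
qed

lemma lk_sym: "\<Lambda> \<subseteq> lk \<Omega> \<Longrightarrow> \<Omega> \<subseteq> V \<Longrightarrow> \<Omega> \<subseteq> lk \<Lambda>"
  using adj_sym by (auto simp: lk_def)

lemma orth_commute: "U \<in> I \<Longrightarrow> W \<in> I \<Longrightarrow> orth U W \<Longrightarrow> orth W U"
  unfolding orth_def using lk_sym lam(1) by blast

lemma nest_reflexive: "W \<in> I \<Longrightarrow> nest W W"
  unfolding nest_def using rep_region by blast

lemma nest_antisymmetric: "U \<in> I \<Longrightarrow> W \<in> I \<Longrightarrow> nest U W \<Longrightarrow> nest W U \<Longrightarrow> U = W"
  unfolding nest_def using index_eqI by blast

lemma nest_transitive: "T \<in> I \<Longrightarrow> U \<in> I \<Longrightarrow> W \<in> I \<Longrightarrow> nest T U \<Longrightarrow> nest U W \<Longrightarrow> nest T W"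
  unfolding nest_def using meet_slide[of T U W] by (auto simp: st_def)

lemma nest_orthogonal: "T \<in> I \<Longrightarrow> U \<in> I \<Longrightarrow> W \<in> I \<Longrightarrow> nest T U \<Longrightarrow> orth U W \<Longrightarrow> orth T W"
  unfolding nest_def orth_def using meet_slide[of T U W] by (auto simp: st_def)

lemma orth_incomparable: "U \<in> I \<Longrightarrow> W \<in> I \<Longrightarrow> orth U W \<Longrightarrow> \<not> nest U W \<and> \<not> nest W U"
  using lam(2)[of U] lam(2)[of W] lk_disjoint[of "lam W"] lam(1)[of W]
  unfolding orth_def nest_def by blast

lemma strict_nest: "U \<in> I \<Longrightarrow> W \<in> I \<Longrightarrow> nest U W \<Longrightarrow> U \<noteq> W \<Longrightarrow> lam U \<subset> lam W"
  unfolding nest_def using index_eqI by blast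

lemma maximal_index: "\<exists>!M. M \<in> I \<and> (\<forall>W\<in>I. nest M W \<longrightarrow> W = M)"
proof -
  obtain M where M: "M \<in> I" "lam M = V" using index_exists[OF subset_refl V_nonempty one_closed] by blast
  have inM: "x \<in> region M" if "x \<in> carrier G" for x
  proof -
    have "inv (rep M) \<otimes> x \<in> par V" using that rep[OF M(1)] generated by (metis inv_closed m_closed)
    then show ?thesis using that par_mono[of V "st V"] by (simp add: region_def M(2) st_def)
  qed
  then have top: "nest W M" if "W \<in> I" for W
    unfolding nest_def using rep_region[OF that] inM[OF rep[OF that]] lam(1)[OF that] M(2) by blast
  have "W = M" if "W \<in> I" "nest M W" for W using nest_antisymmetric[OF M(1) that(1) that(2)] top that by simp
  then show ?thesis using M(1) top by (intro ex1I[of _ M]) auto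
qed

text \<open>\<open>region U\<close> is itself a coset, so the dichotomy applies. Either the
  displacement is coned off, or the regions meet and \<open>lam W\<close> lies in the star of
  \<open>lam U\<close>. In the latter case \<open>lam W\<close> is the join of its parts in
  \<open>lam U\<close> and in the link, both proper because \<open>W\<close> is neither nested in
  nor orthogonal to \<open>U\<close>.\<close>

lemma region_shadow_bound:
  assumes I: "U \<in> I" "W \<in> I" and "\<not> orth W U" "\<not> nest W U" and xy: "x \<in> region U" "y \<in> region U"
  shows "clen (lam W) (shift W x y) \<le> 2"
proof -
  note c = region_carrier[OF xy(1)] region_carrier[OF xy(2)] rep[OF I(1)] rep[OF I(2)]
  have p: "inv (rep U) \<otimes> x \<in> par (st (lam U))" "inv (rep U) \<otimes> y \<in> par (st (lam U))"
    using xy by (auto simp: region_def)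
  have e: "rep U \<otimes> (inv (rep U) \<otimes> x) = x" "rep U \<otimes> (inv (rep U) \<otimes> y) = y" using c by simp_all
  show ?thesis
    using gate_coset_dichotomy[OF lam(1)[OF I(2)] c(4) c(3) p]
  proof (elim disjE bexE conjE)
    fix v assume v: "v \<in> lam W" "shift W (rep U \<otimes> (inv (rep U) \<otimes> x)) (rep U \<otimes> (inv (rep U) \<otimes> y)) \<in> par (lam W - {v})"
    then have "shift W x y \<in> cone (lam W)" unfolding e using cone_subset[of "lam W - {v}"] by blast
    then show ?thesis using clen_cone[of "shift W x y" "lam W"] by simp
  next
    fix k assume k: "lam W \<subseteq> st (lam U)" "k \<in> par (st (lam U))" "inv (rep W) \<otimes> (rep U \<otimes> k) \<in> par (st (lam W))"
    have kc: "rep U \<otimes> k \<in> carrier G" using c par_carrier[OF k(2)] by simp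
    have "rep U \<otimes> k \<in> region U" by (rule region_extend[OF I(1) rep_region[OF I(1)] k(2) subset_refl])
    moreover have "rep U \<otimes> k \<in> region W" using k(3) kc by (simp add: region_def)
    ultimately have meet: "region W \<inter> region U \<noteq> {}" by blast
    show ?thesis
    proof (rule clen_join)
      show "lam W \<subseteq> (lam W \<inter> lam U) \<union> (lam W \<inter> lk (lam U))" using k(1) by (auto simp: st_def)
      show "lam W \<inter> lam U \<subset> lam W" using assms(4) meet unfolding nest_def by blast
      show "lam W \<inter> lk (lam U) \<subset> lam W" using assms(3) meet unfolding orth_def by blast
      show "adj v w" if "v \<in> lam W \<inter> lam U" "w \<in> lam W \<inter> lk (lam U)" for v w using that by (auto simp: lk_def)
      show "shift W x y \<in> par (lam W)" using shift_par I c by simp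
    qed
  qed
qed

lemma rel_props:
  assumes "U \<in> I" "W \<in> I" "\<not> orth W U" "\<not> nest W U"
  shows "rel U W \<subseteq> cspace (lam W) \<and> rel U W \<noteq> {} \<and> diam_le (cdist (lam W)) (rel U W) bound"
proof (intro conjI)
  show "rel U W \<subseteq> cspace (lam W)"
    using cpoint_cspace[OF lam(2) shadow_par] assms region_carrier by (auto simp: rel_def proj_def)
  show "rel U W \<noteq> {}" using rep_region[OF assms(1)] by (auto simp: rel_def proj_def)
  have "cdist (lam W) (cpoint (lam W) (shadow W x)) (cpoint (lam W) (shadow W y)) \<le> bound"
    if "x \<in> region U" "y \<in> region U" for x y
    using region_shadow_bound[OF assms that] cdist_shadow[OF assms(2)] that[THEN region_carrier] bound_ge by simp
  then show "diam_le (cdist (lam W)) (rel U W) bound" by (auto simp: diam_le_def rel_def proj_def)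
qed

section \<open>Bounded geodesic images, consistency and large links\<close>

lemma shift_through_shadow:
  assumes "U \<in> I" "W \<in> I" "nest U W" "x \<in> carrier G"
  shows "shift U x (rep W \<otimes> shadow W x) = \<one>"
proof -
  obtain c where c: "c \<in> region U" "c \<in> region W" using assms(3) unfolding nest_def by blast
  show ?thesis
    unfolding shadow_def
    by (rule disp_gate) (use assms c rep in \<open>auto simp: nest_def region_def\<close>)
qed

text \<open>Classes nested in \<open>W\<close> do not distinguish a point from its gate on the coset
  of \<open>W\<close>; so a path between the two shadows in the space of \<open>W\<close> suffices
  to study them.\<close>

lemma shift_shadows:
  assumes "U \<in> I" "W \<in> I" "nest U W" "x \<in> carrier G" "y \<in> carrier G"
  shows "shift U (rep W \<otimes> shadow W x) (rep W \<otimes> shadow W y) = shift U x y"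
proof -
  note c = rep[OF assms(1)] rep[OF assms(2)] shadow_carrier[OF assms(2)] assms(4,5)
  have "shift U x (rep W \<otimes> shadow W x) \<otimes> shift U (rep W \<otimes> shadow W x) (rep W \<otimes> shadow W y)
      = shift U x (rep W \<otimes> shadow W y)" by (rule disp_mult) (use c in auto)
  moreover have "shift U x y \<otimes> shift U y (rep W \<otimes> shadow W y) = shift U x (rep W \<otimes> shadow W y)"
    by (rule disp_mult) (use c in auto)
  ultimately show ?thesis
    unfolding shift_through_shadow[OF assms(1-4)] shift_through_shadow[OF assms(1-3,5)] using c by simp
qed

text \<open>The vertices near the geodesic form a chain along which the gate on the coset of
  \<open>U\<close> changes. One of them is thus within 4 of the shadow of that coset, and the
  geodesic is within 1 more.\<close>

lemma bounded_image:
  assumes I: "U \<in> I" "W \<in> I" and UW: "nest U W" "U \<noteq> W" and xy: "x \<in> carrier G" "y \<in> carrier G"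
    and ne: "shift U x y \<noteq> \<one>"
    and P: "geodesic_segment (cspace (lam W)) (cdist (lam W)) (cpoint (lam W) (shadow W x)) (cpoint (lam W) (shadow W y)) P"
  shows "P \<inter> nbhd bound (cspace (lam W)) (cdist (lam W)) (rel U W) \<noteq> {}"
proof -
  interpret M: Metric_space "cspace (lam W)" "cdist (lam W)" using metric I by blast
  let ?A = "cpoint (lam W) ` par (lam W)"
  let ?B = "{a \<in> ?A. \<exists>s\<in>P. cdist (lam W) s a \<le> 1}"
  have A: "?A \<subseteq> cspace (lam W)" using cpoint_cspace lam(2) I by blast
  note sh = shadow_par[OF I(2) xy(1)] shadow_par[OF I(2) xy(2)]
  have chain: "(cpoint (lam W) (shadow W x), cpoint (lam W) (shadow W y)) \<in> (chain_rel ?B (cdist (lam W)) 3)\<^sup>*"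
  proof (rule geodesic_segment_chain[OF metric[OF I(2)] P A])
    show "\<exists>a\<in>?A. cdist (lam W) z a \<le> 1" if "z \<in> cspace (lam W)" for z using cpoint_dense[OF lam(2)[OF I(2)] that] .
  qed (use sh A in auto)
  have "shift U (rep W \<otimes> shadow W x) (rep W \<otimes> shadow W y) \<noteq> \<one>" using shift_shadows[OF I UW(1) xy] ne by simp
  then obtain a b where ab: "a \<in> par (lam U)" "b \<in> par (lam W)" "cpoint (lam W) b \<in> ?B"
      "clen (lam W) (inv b \<otimes> gate (lam W) (inv (rep W) \<otimes> (rep U \<otimes> a))) \<le> 4"
    using chain_near_coset[OF strict_nest[OF I UW] lam(2)[OF I(1)] rep[OF I(2)] rep[OF I(1)] _ sh chain] by blast
  let ?y = "rep U \<otimes> a"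
  have y: "?y \<in> region U" by (rule coset_region[OF I(1) ab(1)])
  note yc = region_carrier[OF y]
  have "cdist (lam W) (cpoint (lam W) b) (cpoint (lam W) (shadow W ?y)) \<le> 4"
    using cdist_cpoint[OF lam(2)[OF I(2)] ab(2) shadow_par[OF I(2) yc]] ab(4) by (simp add: shadow_def)
  moreover obtain s where s: "s \<in> P" "cdist (lam W) s (cpoint (lam W) b) \<le> 1" using ab(3) by blast
  moreover have m: "s \<in> cspace (lam W)" "cpoint (lam W) b \<in> cspace (lam W)" "cpoint (lam W) (shadow W ?y) \<in> cspace (lam W)"
    using geodesic_segment_subset[OF P] s(1) A ab(2) shadow_par[OF I(2) yc] by auto
  ultimately have "cdist (lam W) s (cpoint (lam W) (shadow W ?y)) \<le> bound"
    using M.triangle[OF m] bound_ge by linarith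
  moreover have "cpoint (lam W) (shadow W ?y) \<in> rel U W" using y by (auto simp: rel_def proj_def)
  ultimately have "s \<in> nbhd bound (cspace (lam W)) (cdist (lam W)) (rel U W)" using m(1) unfolding nbhd_def by blast
  then show ?thesis using s(1) by blast
qed

text \<open>Walk from the gate of \<open>x\<close> on \<open>h \<cdot> par \<Lambda>'\<close> back to \<open>x\<close>: if the gate on \<open>g \<cdot> par \<Lambda>\<close> moves in the
  direction \<open>v\<close>, then at that moment the walk is in the product region of the hyperplane.\<close>

lemma walk_crosses:
  assumes c: "g \<in> carrier G" "q \<in> carrier G" and v: "v \<in> \<Lambda>"
    and m: "m \<in> syl.ball n" "len m = n" "gate \<Lambda>' m = \<one>"
  shows "disp \<Lambda> g q (q \<otimes> m) \<in> par (\<Lambda> - {v}) \<or>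
    (\<exists>m'\<in>carrier G. gate \<Lambda>' m' = \<one> \<and> (\<exists>a\<in>par \<Lambda>. inv (g \<otimes> a) \<otimes> (q \<otimes> m') \<in> par (lk {v})))"
  using m
proof (induction n arbitrary: m)
  case 0
  then show ?case using disp_self c par_one by simp
next
  case (Suc n)
  obtain m' s where ms: "m = m' \<otimes> s" "m' \<in> syl.ball n" "s \<in> letters" "len m' = n" "len s = 1"
    using Suc.prems(1,2) by (rule syl.ball_Suc_E)
  have m'c: "m' \<in> carrier G" using ms syl.ball_carrier by blast
  have "s \<noteq> \<one>" using ms syl.wlen_one by auto
  then obtain w where w: "w \<in> V" "s \<in> S w" using ms(3) by (auto elim: letter_E)
  then have s: "s \<in> carrier G" by blast
  have g1: "gate \<Lambda>' m' = \<one>" using gate_prefix[OF m'c s, of \<Lambda>'] ms Suc.prems by simp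
  show ?case
    using Suc.IH[OF ms(2,4) g1]
  proof (elim disjE)
    assume IH: "disp \<Lambda> g q (q \<otimes> m') \<in> par (\<Lambda> - {v})"
    let ?z = "inv g \<otimes> (q \<otimes> m')"
    have z: "?z \<in> carrier G" "inv g \<otimes> (q \<otimes> m) = ?z \<otimes> s" using c m'c s ms(1) by (simp_all add: m_assoc)
    show ?thesis
    proof (cases "w \<in> \<Lambda> \<and> res \<Lambda> ?z \<in> par (lk {w})")
      case mv: True
      show ?thesis
      proof (cases "w = v")
        case True
        have "inv (g \<otimes> gate \<Lambda> ?z) \<otimes> (q \<otimes> m') = res \<Lambda> ?z"
          unfolding res_def using c m'c z(1) by (simp add: inv_mult_group m_assoc)
        then have "inv (g \<otimes> gate \<Lambda> ?z) \<otimes> (q \<otimes> m') \<in> par (lk {v})" using mv True by simp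
        then show ?thesis using gate_par[OF z(1), of \<Lambda>] g1 m'c by blast
      next
        case False
        then have "s \<in> par (\<Lambda> - {v})" using mv w par_letter[of w "\<Lambda> - {v}" s] by simp
        moreover have "disp \<Lambda> g q (q \<otimes> m) = disp \<Lambda> g q (q \<otimes> m') \<otimes> s"
          unfolding disp_def z(2) using gate_moved(1)[OF z(1) w, of \<Lambda>] mv c m'c s z(1) by (simp add: m_assoc)
        ultimately show ?thesis using par_mult[OF _ IH] by simp
      qed
    next
      case False
      then have "disp \<Lambda> g q (q \<otimes> m) = disp \<Lambda> g q (q \<otimes> m')"
        unfolding disp_def z(2) using gate_unmoved(1)[OF z(1) w] by simp
      then show ?thesis using IH by simp
    qed
  qed blast
qed

text \<open>Suppose \<open>x\<close> is far from both relative projections, and walk from the gate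
  \<open>q\<close> of \<open>x\<close> on the coset of \<open>U\<close> back to \<open>x\<close>.
  The gate on the coset of \<open>W\<close> must move in every direction of \<open>lam W\<close>.
  When it moves in direction \<open>v\<close>, distance from \<open>rel W U\<close> and the
  dichotomy force \<open>lam U \<subseteq> lk {v}\<close>. Over all \<open>v\<close> this makes
  \<open>lam U\<close> linked to \<open>lam W\<close>, and \<open>cosets_meet\<close> makes the
  regions meet, so the classes are orthogonal.\<close>

lemma transverse_consistent:
  assumes I: "U \<in> I" "W \<in> I" and no: "\<not> orth U W" and x: "x \<in> carrier G"
  shows "set_dist (cdist (lam W)) (proj W x) (rel U W) \<le> 1 \<or> set_dist (cdist (lam U)) (proj U x) (rel W U) \<le> 1"
proof (rule ccontr)
  assume neg: "\<not> ?thesis"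
  note rc = rep[OF I(1)] rep[OF I(2)]
  define q where "q = rep U \<otimes> shadow U x"
  have qU: "q \<in> region U" unfolding q_def by (rule coset_region[OF I(1) shadow_par[OF I(1) x]])
  note qc = region_carrier[OF qU]
  define b where "b = res (lam U) (inv (rep U) \<otimes> x)"
  have b: "b \<in> carrier G" "gate (lam U) b = \<one>" unfolding b_def using gate_of_res rc x by simp_all
  have "shadow U x \<otimes> b = inv (rep U) \<otimes> x" unfolding shadow_def b_def using gate_res rc x by simp
  then have "rep U \<otimes> (shadow U x \<otimes> b) = x" using rc x by simp
  then have xq: "x = q \<otimes> b" unfolding q_def using rc b shadow_carrier[OF I(1) x] by (simp add: m_assoc)
  have far: "shift W q x \<notin> cone (lam W)"
  proof
    assume "shift W q x \<in> cone (lam W)"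
    then have "clen (lam W) (shift W x q) \<le> 1"
      using clen_cone clen_disp_commute[OF lam(2)[OF I(2)] rc(2) qc x] by metis
    then show False using neg set_dist_proj_rel[OF I(2) x qU] by simp
  qed
  have crossing: "lam U \<subseteq> lk {v} \<and> (\<exists>a\<in>par (lam W). \<exists>c\<in>par (lk {v}). inv (rep U) \<otimes> (rep W \<otimes> a \<otimes> c) \<in> par (st (lam U)))"
    if v: "v \<in> lam W" for v
  proof -
    \<comment> \<open>A direction in which the gate never moved would leave the displacement in a
      proper parabolic subgroup, against \<open>far\<close>.\<close>
    have "shift W q (q \<otimes> b) \<notin> par (lam W - {v})"
      using far cone_subset[of "lam W - {v}" "lam W" "shift W q x"] v unfolding xq[symmetric] by blast
    then obtain m a where m: "m \<in> carrier G" "gate (lam U) m = \<one>" "a \<in> par (lam W)"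
        "inv (rep W \<otimes> a) \<otimes> (q \<otimes> m) \<in> par (lk {v})"
      using walk_crosses[OF rc(2) qc v len_ball[OF b(1)] HOL.refl b(2)] by blast
    have aW: "rep W \<otimes> a \<in> region W" by (rule coset_region[OF I(2) m(3)])
    note ac = region_carrier[OF aW]
    have z: "q \<otimes> m \<in> carrier G" using qc m by simp
    have "inv (rep U) \<otimes> (q \<otimes> m) = shadow U x \<otimes> m" unfolding q_def using rc m shadow_carrier[OF I(1) x] by (simp add: m_assoc)
    \<comment> \<open>Every point of the walk has gate \<open>q\<close>, so distances in the space
      of \<open>U\<close> may be measured from \<open>q \<otimes> m\<close> instead of
      \<open>x\<close>.\<close>
    then have "shadow U (q \<otimes> m) = shadow U x"
      using gate_left[OF m(1) shadow_par[OF I(1) x]] m(2) shadow_carrier[OF I(1) x] by (simp add: shadow_def)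
    then have same: "shift U x (rep W \<otimes> a) = shift U (q \<otimes> m) (rep W \<otimes> a)" by (simp add: shift_shadow)
    have e: "(rep W \<otimes> a) \<otimes> (inv (rep W \<otimes> a) \<otimes> (q \<otimes> m)) = q \<otimes> m" "(rep W \<otimes> a) \<otimes> \<one> = rep W \<otimes> a"
      using ac z by simp_all
    have "\<not> (\<exists>u\<in>lam U. shift U (q \<otimes> m) (rep W \<otimes> a) \<in> par (lam U - {u}))"
    proof
      assume "\<exists>u\<in>lam U. shift U (q \<otimes> m) (rep W \<otimes> a) \<in> par (lam U - {u})"
      then have "shift U x (rep W \<otimes> a) \<in> cone (lam U)" unfolding same using cone_subset[of "lam U - {_}" "lam U"] by blast
      then have "clen (lam U) (shift U x (rep W \<otimes> a)) \<le> 1" by (rule clen_cone)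
      then show False using neg set_dist_proj_rel[OF I(1) x aW] by simp
    qed
    then show ?thesis
      using gate_coset_dichotomy[OF lam(1)[OF I(1)] rc(1) ac m(4) par_one] m(3) unfolding e by blast
  qed
  then obtain y where "y \<in> carrier G" "inv (rep W) \<otimes> y \<in> par (st (lam W))" "inv (rep U) \<otimes> y \<in> par (st (lam U))"
    using cosets_meet[OF lam(1)[OF I(2)] rc(2,1), of "st (lam U)"] by blast
  then have "region U \<inter> region W \<noteq> {}" by (auto simp: region_def)
  moreover have "lam U \<subseteq> lk (lam W)" using crossing lam(1)[OF I(1)] by (auto simp: lk_def)
  ultimately show False using no by (simp add: orth_def)
qed

text \<open>\<open>T i\<close> is the class of the coset of \<open>par (lam W - {u i})\<close> that
  contains the \<open>i\<close>-th step of a coned-off geodesic. If \<open>U\<close> is nested in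
  none of them, every step moves the gate on \<open>U\<close> by at most one. The steps that move it
  all start close to the bounded projection of \<open>U\<close>, so on a geodesic there are few of
  them.\<close>

lemma few_large_links:
  assumes W: "W \<in> I" and xy: "x \<in> carrier G" "y \<in> carrier G"
  shows "\<exists>F. F \<subseteq> {U \<in> I. nest U W} - {W} \<and> finite F \<and> card F \<le> clen (lam W) (shift W x y) \<and>
    (\<forall>U\<in>{U \<in> I. nest U W} - {W}. (\<exists>T\<in>F. nest U T) \<or> clen (lam U) (shift U x y) \<le> 7)"
proof (cases "\<exists>v. lam W = {v}")
  case True
  then obtain v where v: "lam W = {v}" by blast
  \<comment> \<open>A class strictly below \<open>W\<close> would have empty support.\<close>
  have "U \<notin> {U \<in> I. nest U W} - {W}" for U
    using strict_nest[of U W] W lam(2)[of U] unfolding v psubset_eq subset_singleton_iff by blast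
  then have "{U \<in> I. nest U W} - {W} = {}" by blast
  then show ?thesis by (intro exI[of _ "{}"]) (simp only: ball_empty, simp)
next
  case False
  let ?\<Lambda> = "lam W" and ?g = "rep W"
  note ne = lam(2)[OF W] and g = rep[OF W]
  obtain v w where vw: "v \<in> ?\<Lambda>" "w \<in> ?\<Lambda>" "v \<noteq> w" using False ne by blast
  interpret D: integer_path_metric "par ?\<Lambda>" "\<lambda>x y. clen ?\<Lambda> (inv x \<otimes> y)" using cone_path_metric[OF ne] .
  define n where "n = clen ?\<Lambda> (shift W x y)"
  obtain p where p: "p 0 = shadow W x" "p n = shadow W y" "\<And>i. i \<le> n \<Longrightarrow> p i \<in> par ?\<Lambda>"
    "\<And>i j. i \<le> j \<Longrightarrow> j \<le> n \<Longrightarrow> clen ?\<Lambda> (inv (p i) \<otimes> p j) = j - i"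
    using D.integer_geodesic[OF shadow_par[OF W xy(1)] shadow_par[OF W xy(2)]] unfolding n_def shift_shadow by auto
  have pc: "p i \<in> carrier G" if "i \<le> n" for i using p(3)[OF that] par_carrier by blast
  define t where "t i = inv (p i) \<otimes> p (Suc i)" for i
  have t: "t i \<in> par ?\<Lambda>" "t i \<in> cone ?\<Lambda>" if "i < n" for i
  proof -
    show *: "t i \<in> par ?\<Lambda>" unfolding t_def using par_mult par_inv p(3) that by simp
    show "t i \<in> cone ?\<Lambda>" by (rule cone_of_clen[OF ne *]) (use p(4)[of i "Suc i"] that in \<open>simp add: t_def\<close>)
  qed
  have "\<exists>u. u \<in> ?\<Lambda> \<and> t i \<in> par (?\<Lambda> - {u})" if "i < n" for i using cone_E[OF t(2)[OF that] vw] by blast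
  then obtain u where u: "\<And>i. i < n \<Longrightarrow> u i \<in> ?\<Lambda>" "\<And>i. i < n \<Longrightarrow> t i \<in> par (?\<Lambda> - {u i})" by metis
  define X where "X i = ?g \<otimes> p i" for i
  have X: "X i \<in> carrier G" if "i \<le> n" for i unfolding X_def using pc[OF that] g by simp
  have Xt: "X (Suc i) = X i \<otimes> t i" if "i < n" for i
    unfolding X_def t_def using pc[of i] pc[of "Suc i"] g that by (simp add: m_assoc)
  have "\<exists>T. T \<in> I \<and> lam T = ?\<Lambda> - {u i} \<and> inv (X i) \<otimes> rep T \<in> par (st (?\<Lambda> - {u i}))" if "i < n" for i
  proof -
    have "?\<Lambda> - {u i} \<subseteq> V" "?\<Lambda> - {u i} \<noteq> {}" using lam(1)[OF W] vw by auto
    then show ?thesis using index_exists[of "?\<Lambda> - {u i}" "X i"] X[of i] that by auto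
  qed
  then obtain T where T: "\<And>i. i < n \<Longrightarrow> T i \<in> I" "\<And>i. i < n \<Longrightarrow> lam (T i) = ?\<Lambda> - {u i}"
    "\<And>i. i < n \<Longrightarrow> inv (X i) \<otimes> rep (T i) \<in> par (st (?\<Lambda> - {u i}))" by metis
  have XT: "X i \<in> region (T i)" if "i < n" for i
  proof -
    have "inv (inv (X i) \<otimes> rep (T i)) = inv (rep (T i)) \<otimes> X i"
      using X[of i] rep[OF T(1)[OF that]] that by (simp add: inv_mult_group)
    then show ?thesis using par_inv[OF T(3)[OF that]] X[of i] that T(2)[OF that] by (simp add: region_def)
  qed
  have sub: "T i \<in> {U \<in> I. nest U W} - {W}" if "i < n" for i
  proof -
    have "X i \<in> region W" unfolding X_def by (rule coset_region[OF W p(3)]) (use that in simp)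
    then have "nest (T i) W" unfolding nest_def using XT[OF that] T(2)[OF that] by blast
    moreover have "T i \<noteq> W" using T(2)[OF that] u(1)[OF that] by auto
    ultimately show ?thesis using T(1)[OF that] by blast
  qed
  have small: "clen (lam U) (shift U x y) \<le> 7" if U: "U \<in> I" "nest U W" "U \<noteq> W" and no: "\<And>i. i < n \<Longrightarrow> \<not> nest U (T i)" for U
  proof -
    note Une = lam(2)[OF U(1)] and h = rep[OF U(1)]
    have one: "clen (lam U) (shift U (X i) (X (Suc i))) \<le> 1" if i: "i < n" for i
    proof -
      have Xi: "X i \<in> carrier G" using X i by simp
      have e: "X i \<otimes> \<one> = X i" using Xi by simp
      have "\<not> (lam U \<subseteq> ?\<Lambda> - {u i} \<and> (\<exists>c\<in>par (?\<Lambda> - {u i}). inv (rep U) \<otimes> (X i \<otimes> c) \<in> par (st (lam U))))"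
      proof
        assume "lam U \<subseteq> ?\<Lambda> - {u i} \<and> (\<exists>c\<in>par (?\<Lambda> - {u i}). inv (rep U) \<otimes> (X i \<otimes> c) \<in> par (st (lam U)))"
        then obtain c where c: "lam U \<subseteq> ?\<Lambda> - {u i}" "c \<in> par (?\<Lambda> - {u i})" "inv (rep U) \<otimes> (X i \<otimes> c) \<in> par (st (lam U))" by blast
        have "X i \<otimes> c \<in> region (T i)"
          by (rule region_extend[OF T(1)[OF i] XT[OF i] c(2)]) (use T(2)[OF i] in \<open>auto simp: st_def\<close>)
        moreover have "X i \<otimes> c \<in> region U" using c Xi par_carrier[OF c(2)] by (simp add: region_def)
        ultimately have "nest U (T i)" unfolding nest_def using c(1) T(2)[OF i] by blast
        then show False using no i by blast
      qed
      then obtain v where "v \<in> lam U" "shift U (X i \<otimes> \<one>) (X i \<otimes> t i) \<in> par (lam U - {v})"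
        using gate_coset_dichotomy[OF lam(1)[OF U(1)] h Xi par_one u(2)[OF i]] by blast
      then have "shift U (X i) (X (Suc i)) \<in> cone (lam U)"
        unfolding e Xt[OF i] using cone_subset[of "lam U - {v}" "lam U"] by blast
      then show ?thesis by (rule clen_cone)
    qed
    define J where "J k = {i. i < k \<and> shift U (X i) (X (Suc i)) \<noteq> \<one>}" for k
    have "clen (lam U) (shift U (X 0) (X k)) \<le> card (J k)" if "k \<le> n" for k
      using that
    proof (induction k)
      case 0
      then show ?case using disp_self h X clen_one[OF Une] by simp
    next
      case (Suc k)
      have tri: "clen (lam U) (shift U (X 0) (X (Suc k))) \<le> clen (lam U) (shift U (X 0) (X k)) + clen (lam U) (shift U (X k) (X (Suc k)))"
        by (rule clen_disp_triangle[OF Une h]) (use X Suc.prems in auto)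
      have fin: "finite (J k)" unfolding J_def by simp
      show ?case
      proof (cases "shift U (X k) (X (Suc k)) = \<one>")
        case True
        then have "J (Suc k) = J k" unfolding J_def by (auto simp: less_Suc_eq)
        then show ?thesis using tri Suc True clen_one[OF Une] by simp
      next
        case False
        then have "J (Suc k) = insert k (J k)" unfolding J_def by (auto simp: less_Suc_eq)
        moreover have "k \<notin> J k" unfolding J_def by simp
        ultimately have "card (J (Suc k)) = Suc (card (J k))" using fin by simp
        then show ?thesis using tri Suc one[of k] by simp
      qed
    qed
    then have 1: "clen (lam U) (shift U (X 0) (X n)) \<le> card (J n)" by blast
    have near: "\<exists>a\<in>par (lam U). clen ?\<Lambda> (inv (p i) \<otimes> shadow W (rep U \<otimes> a)) \<le> 2" if "i \<in> J n" for i
    proof -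
      have i: "i < n" "shift U (X i) (X (Suc i)) \<noteq> \<one>" using that unfolding J_def by auto
      then have d: "shift U (?g \<otimes> p i) (?g \<otimes> p i \<otimes> t i) \<noteq> \<one>" using Xt[OF i(1)] unfolding X_def by simp
      have ti: "t i \<in> cball ?\<Lambda> (Suc 0)" by (rule word_metric.ball_1[OF cone_word_metric[OF ne] t(2)[OF i(1)]])
      have "i \<le> n" using i(1) by simp
      then have "\<exists>a\<in>par (lam U). clen ?\<Lambda> (inv (p i) \<otimes> gate ?\<Lambda> (inv ?g \<otimes> (rep U \<otimes> a))) \<le> Suc 0 + 1"
        by (rule near_coset_of_disp[OF strict_nest[OF U(1) W U(2,3)] Une g h p(3) ti d])
      then show ?thesis by (simp add: shadow_def numeral_2_eq_2)
    qed
    \<comment> \<open>From \<open>p i\<close> to the projection of \<open>U\<close>, across it and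
      back to \<open>p j\<close>: 2 + 2 + 2. The path is a geodesic, so this bounds the difference
      of the indices.\<close>
    have apart: "j - i \<le> 6" if ij: "i \<in> J n" "j \<in> J n" "i \<le> j" for i j
    proof -
      have jn: "i \<le> n" "j \<le> n" using ij unfolding J_def by auto
      obtain a a' where a: "a \<in> par (lam U)" "clen ?\<Lambda> (inv (p i) \<otimes> shadow W (rep U \<otimes> a)) \<le> 2"
        and a': "a' \<in> par (lam U)" "clen ?\<Lambda> (inv (p j) \<otimes> shadow W (rep U \<otimes> a')) \<le> 2" using near ij by meson
      have r: "rep U \<otimes> a \<in> region U" "rep U \<otimes> a' \<in> region U" using coset_region[OF U(1)] a a' by auto
      let ?s = "shadow W (rep U \<otimes> a)" and ?s' = "shadow W (rep U \<otimes> a')"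
      have s: "?s \<in> par ?\<Lambda>" "?s' \<in> par ?\<Lambda>" using shadow_par[OF W] r region_carrier by auto
      have "\<not> orth W U" "\<not> nest W U"
        using orth_incomparable[OF W U(1)] nest_antisymmetric[OF U(1) W U(2)] U by auto
      then have ss: "clen ?\<Lambda> (inv ?s \<otimes> ?s') \<le> 2" using region_shadow_bound[OF U(1) W _ _ r] by (simp add: shift_shadow)
      have "clen ?\<Lambda> (inv (p i) \<otimes> p j) \<le> clen ?\<Lambda> (inv (p i) \<otimes> ?s) + clen ?\<Lambda> (inv ?s \<otimes> p j)"
        by (rule D.D_triangle) (use p(3) jn s in auto)
      also have "clen ?\<Lambda> (inv ?s \<otimes> p j) \<le> clen ?\<Lambda> (inv ?s \<otimes> ?s') + clen ?\<Lambda> (inv ?s' \<otimes> p j)"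
        by (rule D.D_triangle) (use p(3) jn s in auto)
      also have "clen ?\<Lambda> (inv ?s' \<otimes> p j) = clen ?\<Lambda> (inv (p j) \<otimes> ?s')"
        by (rule D.D_commute) (use p(3) jn s in auto)
      finally show ?thesis using ss a(2) a'(2) p(4)[OF ij(3) jn(2)] by simp
    qed
    have "card (J n) \<le> 7"
    proof (cases "J n = {}")
      case False
      have fin: "finite (J n)" unfolding J_def by simp
      define m where "m = Min (J n)"
      have m: "m \<in> J n" unfolding m_def using Min_in[OF fin False] .
      have "J n \<subseteq> {m..m + 6}"
      proof
        fix j assume j: "j \<in> J n"
        then have "m \<le> j" unfolding m_def using fin by simp
        then show "j \<in> {m..m + 6}" using apart[OF m j] by simp
      qed
      then have "card (J n) \<le> card {m..m + 6}" by (intro card_mono) auto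
      then show ?thesis by simp
    qed simp
    moreover have "shift U (X 0) (X n) = shift U x y"
      unfolding X_def p by (rule shift_shadows[OF U(1) W U(2) xy])
    ultimately show ?thesis using 1 by simp
  qed
  have "card (T ` {..<n}) \<le> n" using card_image_le[of "{..<n}" T] by simp
  then show ?thesis
    using sub small unfolding n_def[symmetric] by (intro exI[of _ "T ` {..<n}"]) blast
qed

text \<open>A Helly property. A point of the earlier regions is replaced by its gate on the new
  region, a coset of a star subgroup; by \<open>gate_keeps_coset\<close> it does not leave the
  others.\<close>

lemma common_point:
  assumes "finite F" "F \<subseteq> I" "\<And>U W. U \<in> F \<Longrightarrow> W \<in> F \<Longrightarrow> U \<noteq> W \<Longrightarrow> orth U W"
  shows "\<exists>x\<in>carrier G. \<forall>W\<in>F. x \<in> region W"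
  using assms
proof (induction F rule: finite_induct)
  case (insert W F)
  have W: "W \<in> I" using insert.prems by blast
  obtain x where x: "x \<in> carrier G" "\<forall>U\<in>F. x \<in> region U" using insert by (meson insertCI insert_subset)
  let ?y = "rep W \<otimes> gate (st (lam W)) (inv (rep W) \<otimes> x)"
  note r = rep[OF W]
  have y: "?y \<in> carrier G" using r x by simp
  have "gate (st (lam W)) (inv (rep W) \<otimes> x) \<in> par (st (lam W))" using gate_par r x by simp
  then have "?y \<in> region W" by (rule region_extend[OF W rep_region[OF W] _ subset_refl])
  moreover have "?y \<in> region U" if U: "U \<in> F" for U
  proof -
    have UI: "U \<in> I" using U insert.prems by blast
    have "orth W U" using insert U by blast
    then obtain z where z: "z \<in> region W" "z \<in> region U" unfolding orth_def by blast
    note zc = region_carrier[OF z(1)]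
    have "inv z \<otimes> ?y \<in> par (st (lam U))"
    proof (rule gate_keeps_coset[OF r x(1) zc])
      show "inv (rep W) \<otimes> z \<in> par (st (lam W))" using z(1) by (simp add: region_def)
      show "inv z \<otimes> x \<in> par (st (lam U))" using region_iff[OF UI z(2) x(1)] x(2) U by blast
    qed
    then show ?thesis using region_iff[OF UI z(2) y] by blast
  qed
  ultimately show ?case using y by (intro bexI[of _ ?y]) auto
qed (use one_closed in blast)

lemma shadow_move:
  assumes "W \<in> I" "x \<in> region W" "a \<in> par (lam W)"
  shows "shadow W (x \<otimes> a) = shadow W x \<otimes> a"
proof -
  note c = rep[OF assms(1)] region_carrier[OF assms(2)] par_carrier[OF assms(3)]
  have "inv (rep W) \<otimes> x \<in> par (st (lam W))" using assms(2) by (simp add: region_def)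
  then obtain b k where bk: "b \<in> par (lam W)" "k \<in> par (lk (lam W))" "inv (rep W) \<otimes> x = b \<otimes> k" by (rule par_st)
  have bc: "b \<in> carrier G" "k \<in> carrier G" using bk par_carrier by auto
  have "inv (rep W) \<otimes> (x \<otimes> a) = b \<otimes> k \<otimes> a" using bk(3) c by (metis inv_closed m_assoc)
  then have "shadow W (x \<otimes> a) = b \<otimes> a"
    unfolding shadow_def using gate_st[OF bk(1,2) c(3)] gate_id[OF assms(3)] by simp
  moreover have "shadow W x = b" unfolding shadow_def bk(3) using gate_st[OF bk(1,2) one_closed] bc by simp
  ultimately show ?thesis by simp
qed

text \<open>The coordinates are corrected one class at a time by a factor from
  \<open>par (lam W)\<close>, which is linked to all other supports and so disturbs no other shadow
  or region. \<open>F'\<close> collects the corrected classes, while the point stays in the regions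
  of all of \<open>F\<close>.\<close>

lemma realise_points:
  assumes "finite F'" "F' \<subseteq> F" "finite F" "F \<subseteq> I" "\<And>U W. U \<in> F \<Longrightarrow> W \<in> F \<Longrightarrow> U \<noteq> W \<Longrightarrow> orth U W"
    and p: "\<And>W. W \<in> F \<Longrightarrow> p W \<in> par (lam W)"
  shows "\<exists>x\<in>carrier G. (\<forall>W\<in>F. x \<in> region W) \<and> (\<forall>W\<in>F'. shadow W x = p W)"
  using assms(1,2)
proof (induction F' rule: finite_induct)
  case empty
  then show ?case using common_point[OF assms(3-5)] by auto
next
  case (insert W F')
  obtain x where x: "x \<in> carrier G" "\<And>U. U \<in> F \<Longrightarrow> x \<in> region U" "\<And>U. U \<in> F' \<Longrightarrow> shadow U x = p U"
    using insert by auto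
  have WF: "W \<in> F" "W \<in> I" using insert.prems assms(4) by auto
  define a where "a = inv (shadow W x) \<otimes> p W"
  note sc = shadow_carrier[OF WF(2) x(1)]
  have a: "a \<in> par (lam W)" unfolding a_def using par_mult[OF p[OF WF(1)] par_inv[OF shadow_par[OF WF(2) x(1)]]] .
  have ac: "a \<in> carrier G" using a par_carrier by blast
  have "shadow W (x \<otimes> a) = p W"
    unfolding shadow_move[OF WF(2) x(2)[OF WF(1)] a] unfolding a_def using sc par_carrier[OF p[OF WF(1)]] by simp
  moreover have "x \<otimes> a \<in> region U \<and> (U \<in> F' \<longrightarrow> shadow U (x \<otimes> a) = p U)" if U: "U \<in> F" for U
  proof (cases "U = W")
    case True
    then have "x \<otimes> a \<in> region U" using region_extend[OF WF(2) x(2)[OF WF(1)] a] by (auto simp: st_def)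
    then show ?thesis using insert.hyps(2) True by blast
  next
    case False
    have UI: "U \<in> I" using U assms(4) by blast
    have lk: "lam W \<subseteq> lk (lam U)" using assms(5)[OF WF(1) U] False unfolding orth_def by blast
    then have "lam U \<inter> lam W = {}" using lk_disjoint[of "lam U"] by blast
    then have "shift U x (x \<otimes> a) \<in> par {}" using disp_near[OF rep[OF UI] x(1) a, of "lam U"] by simp
    then have "shift U x (x \<otimes> a) = \<one>" by (rule par_empty)
    then have "shadow U (x \<otimes> a) = shadow U x"
      using inv_eq_one_iff[OF shadow_carrier[OF UI x(1)] shadow_carrier[OF UI]] x(1) ac by (simp add: shift_shadow)
    moreover have "x \<otimes> a \<in> region U" by (rule region_extend[OF UI x(2)[OF U] a]) (use lk in \<open>auto simp: st_def\<close>)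
    ultimately show ?thesis using x(3) by simp
  qed
  ultimately show ?case using x(1) ac insert.prems by (intro bexI[of _ "x \<otimes> a"]) auto
qed

text \<open>The group is discrete, so a geodesic of group elements is run through with time rounded
  down, at the cost of an additive constant one.\<close>

lemma quasi_geodesic_syllable:
  assumes M: "Metric_space (carrier G) dX"
    and d: "\<And>x y. x \<in> carrier G \<Longrightarrow> y \<in> carrier G \<Longrightarrow> dX x y = real (len (inv x \<otimes> y))"
  shows "quasi_geodesic_space (carrier G) dX"
proof -
  interpret D: integer_path_metric "carrier G" "\<lambda>x y. len (inv x \<otimes> y)" by (rule syl_path_metric)
  interpret M: Metric_space "carrier G" dX by fact
  have "\<exists>L\<ge>0. \<exists>\<gamma>::real \<Rightarrow> 'a. \<gamma> 0 = x \<and> \<gamma> L = y \<and> \<gamma> ` {0..L} \<subseteq> carrier G \<and>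
        (\<forall>s\<in>{0..L}. \<forall>t\<in>{0..L}. \<bar>s - t\<bar> / 1 - 1 \<le> dX (\<gamma> s) (\<gamma> t) \<and> dX (\<gamma> s) (\<gamma> t) \<le> 1 * \<bar>s - t\<bar> + 1)"
    if xy: "x \<in> carrier G" "y \<in> carrier G" for x y
  proof -
    define n where "n = len (inv x \<otimes> y)"
    obtain z where z: "z 0 = x" "z n = y" "\<And>i. i \<le> n \<Longrightarrow> z i \<in> carrier G"
      "\<And>i j. i \<le> j \<Longrightarrow> j \<le> n \<Longrightarrow> len (inv (z i) \<otimes> z j) = j - i"
      using D.integer_geodesic[OF xy] unfolding n_def by blast
    define \<gamma> where "\<gamma> t = z (nat \<lfloor>t\<rfloor>)" for t :: real
    have fl: "nat \<lfloor>t\<rfloor> \<le> n" "real (nat \<lfloor>t\<rfloor>) \<le> t" "t < real (nat \<lfloor>t\<rfloor>) + 1" if "t \<in> {0..real n}" for t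
      using that by (auto simp: nat_le_iff floor_le_iff)
    have *: "\<bar>s - t\<bar> - 1 \<le> dX (\<gamma> s) (\<gamma> t) \<and> dX (\<gamma> s) (\<gamma> t) \<le> \<bar>s - t\<bar> + 1"
      if st: "s \<in> {0..real n}" "t \<in> {0..real n}" "s \<le> t" for s t
    proof -
      have "nat \<lfloor>s\<rfloor> \<le> nat \<lfloor>t\<rfloor>" using st(3) by (simp add: floor_mono nat_mono)
      then have "dX (\<gamma> s) (\<gamma> t) = real (nat \<lfloor>t\<rfloor>) - real (nat \<lfloor>s\<rfloor>)"
        unfolding \<gamma>_def using d z(3,4) fl(1)[OF st(1)] fl(1)[OF st(2)] by (simp add: of_nat_diff)
      then show ?thesis using fl[OF st(1)] fl[OF st(2)] st(3) by linarith
    qed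
    have "\<bar>s - t\<bar> / 1 - 1 \<le> dX (\<gamma> s) (\<gamma> t) \<and> dX (\<gamma> s) (\<gamma> t) \<le> 1 * \<bar>s - t\<bar> + 1"
      if "s \<in> {0..real n}" "t \<in> {0..real n}" for s t
      using *[of s t] *[of t s] that M.commute[of "\<gamma> s" "\<gamma> t"] by (cases "s \<le> t") auto
    moreover have "\<gamma> 0 = x" "\<gamma> (real n) = y" unfolding \<gamma>_def using z by simp_all
    moreover have "\<gamma> ` {0..real n} \<subseteq> carrier G" unfolding \<gamma>_def using z(3) fl(1) by blast
    ultimately show ?thesis by (intro exI[of _ "real n"] conjI exI[of _ \<gamma>]) auto
  qed
  then show ?thesis unfolding quasi_geodesic_space_def using M by (intro conjI exI[of _ 1] exI[of _ 1]) auto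
qed

lemma uniqueness_bound:
  assumes xy: "x \<in> carrier G" "y \<in> carrier G" and r: "\<And>W. W \<in> I \<Longrightarrow> clen (lam W) (shift W x y) \<le> r"
  shows "len (inv x \<otimes> y) \<le> (r + 1) ^ card V"
proof (rule len_le_of_clen_le[OF subset_refl xy])
  show "inv x \<otimes> y \<in> par V" using xy generated by (metis inv_closed m_closed)
  fix \<Lambda>' u assume u: "\<Lambda>' \<subseteq> V" "\<Lambda>' \<noteq> {}" "u \<in> carrier G"
  then obtain W where W: "W \<in> I" "lam W = \<Lambda>'" "inv u \<otimes> rep W \<in> par (st \<Lambda>')" using index_exists by blast
  then have "disp \<Lambda>' u x y = shift W x y" using disp_rep[OF u(3) rep[OF W(1)] xy W(3)] by simp
  then show "clen \<Lambda>' (disp \<Lambda>' u x y) \<le> r" using r[OF W(1)] W(2) by simp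
qed

section \<open>Assembling the axioms\<close>

lemma proto_hierarchy:
  assumes M: "Metric_space (carrier G) dX"
    and d: "\<And>x y. x \<in> carrier G \<Longrightarrow> y \<in> carrier G \<Longrightarrow> dX x y = real (len (inv x \<otimes> y))"
  shows "proto_hierarchy_structure (carrier G) dX bound I (\<lambda>W. cspace (lam W)) (\<lambda>W. cdist (lam W)) proj nest orth rel"
proof
  show "quasi_geodesic_space (carrier G) dX" by (rule quasi_geodesic_syllable[OF M d])
  show "bound > 0" by (rule bound_ge)
  show "reflp_on I nest" using nest_reflexive by (auto simp: reflp_on_def)
  show "antisymp_on I nest" using nest_antisymmetric by (auto simp: antisymp_on_def)
  show "transp_on I nest" by (rule transp_onI) (rule nest_transitive)
  show "symp_on I orth" using orth_commute by (auto simp: symp_on_def)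
  show "\<exists>!M. M \<in> I \<and> (\<forall>W\<in>I. nest M W \<longrightarrow> W = M)" by (rule maximal_index)
  fix W assume W: "W \<in> I"
  show "geodesic_space (cspace (lam W)) (cdist (lam W))" using cspace_geodesic lam(2)[OF W] .
  interpret MW: Metric_space "cspace (lam W)" "cdist (lam W)" by (rule metric[OF W])
  show "cspace (lam W) \<subseteq> nbhd bound (cspace (lam W)) (cdist (lam W)) (\<Union>x\<in>carrier G. proj W x)"
  proof
    fix f assume f: "f \<in> cspace (lam W)"
    then obtain a where a: "a \<in> par (lam W)" "cdist (lam W) f (cpoint (lam W) a) \<le> 1"
      using cpoint_dense[OF lam(2)[OF W]] by blast
    have "shadow W (rep W \<otimes> a) = a" unfolding shadow_def using rep[OF W] par_carrier[OF a(1)] gate_id[OF a(1)] by simp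
    moreover have "rep W \<otimes> a \<in> carrier G" using rep[OF W] par_carrier[OF a(1)] by simp
    ultimately have "cpoint (lam W) a \<in> (\<Union>x\<in>carrier G. proj W x)" unfolding proj_def by (metis UN_iff singletonI)
    then show "f \<in> nbhd bound (cspace (lam W)) (cdist (lam W)) (\<Union>x\<in>carrier G. proj W x)"
      unfolding nbhd_def using f a(2) bound_ge(1) by force
  qed
  fix x assume x: "x \<in> carrier G"
  show "proj W x \<subseteq> cspace (lam W)" using cpoint_cspace[OF lam(2) shadow_par] W x by (simp add: proj_def)
  show "proj W x \<noteq> {}" by (simp add: proj_def)
  show "diam_le (cdist (lam W)) (proj W x) bound"
    using cdist_shadow[OF W x x] disp_self[OF rep[OF W] x] clen_one[OF lam(2)[OF W]] bound_ge(2) by (simp add: diam_le_def proj_def)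
  fix y assume y: "y \<in> carrier G"
  have "real (clen (lam W) (shift W x y)) \<le> dX x y"
    using clen_disp_le_len[OF lam(2)[OF W] rep[OF W] x y] d[OF x y] by simp
  also have "\<dots> \<le> bound * dX x y + bound"
    using mult_right_mono[of 1 bound "dX x y"] bound_ge Metric_space.nonneg[OF M, of x y] by simp
  finally show "set_dist (cdist (lam W)) (proj W x) (proj W y) \<le> bound * dX x y + bound"
    using set_dist_proj[OF W x y] by simp
next
  fix U W assume I: "U \<in> I" "W \<in> I"
  show "rel U W \<subseteq> cspace (lam W) \<and> rel U W \<noteq> {} \<and> diam_le (cdist (lam W)) (rel U W) bound" if "nest U W" "U \<noteq> W"
    using rel_props[OF I] orth_incomparable[OF I(2,1)] nest_antisymmetric[OF I] that by blast
  show "\<not> nest U W \<and> \<not> nest W U" if "orth U W" using orth_incomparable[OF I that] .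
  show "rel U W \<subseteq> cspace (lam W) \<and> rel U W \<noteq> {} \<and> diam_le (cdist (lam W)) (rel U W) bound \<and>
      rel W U \<subseteq> cspace (lam U) \<and> rel W U \<noteq> {} \<and> diam_le (cdist (lam U)) (rel W U) bound"
    if "\<not> orth U W" "\<not> nest U W" "\<not> nest W U"
    using rel_props[OF I] rel_props[OF I(2,1)] orth_commute[OF I(2,1)] that by blast
  show "orth U T" if "T \<in> I" "nest U W" "orth W T" for T using nest_orthogonal[OF I that(1-3)] .
qed

theorem hierarchically_hyperbolic:
  assumes M: "Metric_space (carrier G) dX"
    and d: "\<And>x y. x \<in> carrier G \<Longrightarrow> y \<in> carrier G \<Longrightarrow> dX x y = real (len (inv x \<otimes> y))"
  shows "HHS_structure (carrier G) dX bound I (\<lambda>W. cspace (lam W)) (\<lambda>W. cdist (lam W)) proj nest orth rel"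
proof -
  interpret P: proto_hierarchy_structure "carrier G" dX bound I "\<lambda>W. cspace (lam W)" "\<lambda>W. cdist (lam W)" proj nest orth rel
    by (rule proto_hierarchy[OF M d])
  have pd: "P.proj_dist W x y = real (clen (lam W) (shift W x y))" if "W \<in> I" "x \<in> carrier G" "y \<in> carrier G" for W x y
    unfolding P.proj_dist_def using set_dist_proj[OF that] .
  show ?thesis
  proof
    fix W assume W: "W \<in> I"
    have "hyperbolic 30 (cspace (lam W)) (cdist (lam W))" by (rule cspace_hyperbolic[OF lam(2,1)[OF W]])
    then show "hyperbolic bound (cspace (lam W)) (cdist (lam W))" by (rule hyperbolic_mono) (use bound_ge in simp)
    fix U assume U: "U \<in> P.nested_in W" "P.nested_in W \<inter> P.orthogonal_to U \<noteq> {}"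
    \<comment> \<open>The container may be \<open>W\<close> itself.\<close>
    show "\<exists>Q\<in>P.nested_in W. \<forall>T\<in>P.nested_in W \<inter> P.orthogonal_to U. nest T Q"
      using W nest_reflexive by (intro bexI[of _ W]) (auto simp: P.nested_in_def)
  next
    fix T assume T: "T \<subseteq> I" "\<And>U W. U \<in> T \<Longrightarrow> W \<in> T \<Longrightarrow> nest U W \<or> nest W U"
    have inj: "inj_on lam T"
    proof (rule inj_onI)
      fix U W assume UW: "U \<in> T" "W \<in> T" "lam U = lam W"
      then have "region U \<inter> region W \<noteq> {}" using T(2)[OF UW(1,2)] unfolding nest_def by blast
      then show "U = W" using index_eqI UW T(1) by blast
    qed
    have sub: "lam ` T \<subseteq> Pow V" using lam(1) T(1) by blast
    have "finite T" using finite_imageD[OF finite_subset[OF sub] inj] finite_V by simp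
    moreover have "card T \<le> 2 ^ card V"
      using card_mono[OF _ sub] card_image[OF inj] card_Pow[OF finite_V] finite_V by simp
    then have "real (card T) \<le> bound" unfolding bound_def by (metis add_increasing2 of_nat_le_iff of_nat_numeral of_nat_power zero_le_numeral)
    ultimately show "finite T \<and> real (card T) \<le> bound" by blast
  next
    \<comment> \<open>The final \<open>+ 1\<close> makes the threshold exceed every length that
      \<open>uniqueness_bound\<close> permits.\<close>
    define \<theta> :: "real \<Rightarrow> real" where "\<theta> r = real ((nat \<lceil>r\<rceil> + 1) ^ card V) + 1" for r
    have "\<exists>W\<in>I. P.proj_dist W x y \<ge> r" if xy: "x \<in> carrier G" "y \<in> carrier G" and far: "dX x y \<ge> \<theta> r" for r x y
    proof (rule ccontr)
      assume "\<not> ?thesis"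
      then have *: "real (clen (lam W) (shift W x y)) < r" if "W \<in> I" for W using pd[OF that xy] that by force
      have "clen (lam W) (shift W x y) \<le> nat \<lceil>r\<rceil>" if "W \<in> I" for W using *[OF that] by linarith
      then have "len (inv x \<otimes> y) \<le> (nat \<lceil>r\<rceil> + 1) ^ card V" by (rule uniqueness_bound[OF xy])
      then have "real (len (inv x \<otimes> y)) \<le> real ((nat \<lceil>r\<rceil> + 1) ^ card V)" by (simp only: of_nat_le_iff)
      then show False using far d[OF xy] unfolding \<theta>_def by linarith
    qed
    moreover have "\<theta> r \<ge> 0" for r unfolding \<theta>_def by simp
    ultimately show "\<exists>\<theta>::real \<Rightarrow> real. (\<forall>r\<ge>0. \<theta> r \<ge> 0) \<and>
      (\<forall>r\<ge>0. \<forall>x\<in>carrier G. \<forall>y\<in>carrier G. dX x y \<ge> \<theta> r \<longrightarrow> (\<exists>W\<in>I. P.proj_dist W x y \<ge> r))" by blast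
  next
    fix U W x y a b S
    assume *: "U \<in> I" "W \<in> I" "nest U W" "U \<noteq> W" "x \<in> carrier G" "y \<in> carrier G" "P.proj_dist U x y \<ge> bound"
      "a \<in> proj W x" "b \<in> proj W y" "geodesic_segment (cspace (lam W)) (cdist (lam W)) a b S"
    \<comment> \<open>The distance is at least \<open>bound\<close>, hence positive;
      \<open>bounded_image\<close> only asks that the gate moves at all.\<close>
    have "shift U x y \<noteq> \<one>" using *(7) pd[OF *(1,5,6)] clen_one[OF lam(2)[OF *(1)]] bound_ge by auto
    then show "S \<inter> nbhd bound (cspace (lam W)) (cdist (lam W)) (rel U W) \<noteq> {}"
      using bounded_image[OF *(1-6)] *(8-10) by (simp add: proj_def)
  next
    fix W x y assume W: "W \<in> I" and xy: "x \<in> carrier G" "y \<in> carrier G"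
    obtain F where F: "F \<subseteq> {U \<in> I. nest U W} - {W}" "finite F" "card F \<le> clen (lam W) (shift W x y)"
      "\<And>U. U \<in> {U \<in> I. nest U W} - {W} \<Longrightarrow> (\<exists>T\<in>F. nest U T) \<or> clen (lam U) (shift U x y) \<le> 7"
      using few_large_links[OF W xy] by blast
    have "real (card F) \<le> P.proj_dist W x y" using F(3) pd[OF W xy] by simp
    also have "\<dots> \<le> bound * P.proj_dist W x y + bound"
      using mult_right_mono[of 1 bound "P.proj_dist W x y"] bound_ge pd[OF W xy] by simp
    finally have 1: "real (card F) \<le> bound * P.proj_dist W x y + bound" .
    have "(\<exists>T\<in>F. nest U T) \<or> P.proj_dist U x y \<le> bound" if "U \<in> P.nested_in W - {W}" for U
      using F(4)[of U] that pd[of U, OF _ xy] bound_ge(1) by (force simp: P.nested_in_def)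
    then show "\<exists>F\<subseteq>P.nested_in W - {W}. finite F \<and> real (card F) \<le> bound * P.proj_dist W x y + bound \<and>
        (\<forall>U\<in>P.nested_in W - {W}. (\<exists>T\<in>F. nest U T) \<or> P.proj_dist U x y \<le> bound)"
      using F(1,2) 1 by (intro exI[of _ F]) (auto simp: P.nested_in_def)
  next
    fix U W x assume *: "U \<in> I" "W \<in> I" "P.transverse U W" "x \<in> carrier G"
    then show "min (set_dist (cdist (lam W)) (proj W x) (rel U W)) (set_dist (cdist (lam U)) (proj U x) (rel W U)) \<le> bound"
      using transverse_consistent[OF *(1,2) _ *(4)] bound_ge(1) by (auto simp: P.transverse_def)
  next
    fix U T W assume *: "U \<in> I" "T \<in> I" "W \<in> I" "nest U T"
    \<comment> \<open>The projection of a common point of the two regions lies in both relative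
      projections.\<close>
    obtain c where c: "c \<in> region U" "c \<in> region T" using *(4) unfolding nest_def by blast
    have "set_dist (cdist (lam W)) (rel U W) (rel T W)
        \<le> cdist (lam W) (cpoint (lam W) (shadow W c)) (cpoint (lam W) (shadow W c))"
      using c by (intro set_dist_le[OF metric[OF *(3)]]) (auto simp: rel_def proj_def)
    also have "\<dots> = 0"
      using Metric_space.mdist_zero[OF metric[OF *(3)]] cpoint_cspace[OF lam(2) shadow_par, OF *(3) *(3) region_carrier[OF c(1)]] by simp
    finally show "set_dist (cdist (lam W)) (rel U W) (rel T W) \<le> bound" using bound_ge by simp
  next
    fix F and p :: "'i \<Rightarrow> 'a \<Rightarrow> real"
    assume F: "F \<subseteq> I" "finite F" "\<And>U W. U \<in> F \<Longrightarrow> W \<in> F \<Longrightarrow> U \<noteq> W \<Longrightarrow> orth U W" "\<And>U. U \<in> F \<Longrightarrow> p U \<in> cspace (lam U)"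
    have "\<exists>a. a \<in> par (lam U) \<and> cdist (lam U) (p U) (cpoint (lam U) a) \<le> 1" if "U \<in> F" for U
      using cpoint_dense[OF lam(2) F(4)[OF that]] that F(1) by blast
    then obtain a where a: "\<And>U. U \<in> F \<Longrightarrow> a U \<in> par (lam U)" "\<And>U. U \<in> F \<Longrightarrow> cdist (lam U) (p U) (cpoint (lam U) (a U)) \<le> 1"
      by metis
    obtain x where x: "x \<in> carrier G" "\<And>U. U \<in> F \<Longrightarrow> x \<in> region U" "\<And>U. U \<in> F \<Longrightarrow> shadow U x = a U"
      using realise_points[OF F(2) subset_refl F(2,1,3) a(1)] by blast
    have 1: "set_dist (cdist (lam U)) (proj U x) {p U} \<le> bound" if U: "U \<in> F" for U
    proof -
      have "U \<in> I" using U F(1) by blast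
      then interpret MU: Metric_space "cspace (lam U)" "cdist (lam U)" by (rule metric)
      show ?thesis using x(3)[OF U] a(2)[OF U] bound_ge(1) MU.commute[of "p U"] by (simp add: proj_def set_dist_singletons)
    qed
    have 2: "set_dist (cdist (lam W)) (proj W x) (rel U W) \<le> bound" if "U \<in> F" "W \<in> I" for U W
      using set_dist_proj_rel[OF that(2) x(1) x(2)[OF that(1)]] disp_self[OF rep[OF that(2)] x(1)]
        clen_one[OF lam(2)[OF that(2)]] bound_ge(2) by simp
    show "\<exists>x\<in>carrier G. \<forall>U\<in>F. set_dist (cdist (lam U)) (proj U x) {p U} \<le> bound \<and>
        (\<forall>W\<in>I. (nest U W \<and> U \<noteq> W) \<or> P.transverse W U \<longrightarrow> set_dist (cdist (lam W)) (proj W x) (rel U W) \<le> bound)"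
      using x(1) 1 2 by blast
  qed
qed

end

section \<open>Parallelism classes as sets of cosets\<close>

context gated_group
begin

definition left_coset :: "'v set \<Rightarrow> 'a \<Rightarrow> 'a set" where
  "left_coset \<Lambda> g = (\<lambda>y. g \<otimes> y) ` par \<Lambda>"

text \<open>The class is taken as an actual set of cosets, so that parallel descriptions yield one
  and the same index.\<close>

definition parallel_class :: "'v set \<Rightarrow> 'a \<Rightarrow> 'a set set" where
  "parallel_class \<Lambda> g = {left_coset \<Lambda> (g \<otimes> c) |c. c \<in> par (st \<Lambda>)}"

lemma parallel_class_shift:
  assumes g: "g \<in> carrier G" and k: "k \<in> par (st \<Lambda>)"
  shows "parallel_class \<Lambda> (g \<otimes> k) = parallel_class \<Lambda> g"
proof -
  have sub: "parallel_class \<Lambda> (g \<otimes> k) \<subseteq> parallel_class \<Lambda> g" if g: "g \<in> carrier G" and k: "k \<in> par (st \<Lambda>)" for g k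
  proof
    fix X assume "X \<in> parallel_class \<Lambda> (g \<otimes> k)"
    then obtain c where c: "c \<in> par (st \<Lambda>)" "X = left_coset \<Lambda> (g \<otimes> k \<otimes> c)" unfolding parallel_class_def by blast
    have "g \<otimes> k \<otimes> c = g \<otimes> (k \<otimes> c)" using g par_carrier[OF k] par_carrier[OF c(1)] by (simp add: m_assoc)
    then show "X \<in> parallel_class \<Lambda> g" unfolding parallel_class_def using c(2) par_mult[OF c(1) k] by auto
  qed
  have kc: "k \<in> carrier G" using par_carrier k by blast
  have "g \<otimes> k \<otimes> inv k = g" using g kc by (simp add: m_assoc)
  then have "parallel_class \<Lambda> g \<subseteq> parallel_class \<Lambda> (g \<otimes> k)" using sub[of "g \<otimes> k" "inv k"] par_inv[OF k] g kc by simp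
  then show ?thesis using sub[OF g k] by blast
qed

text \<open>Equal cosets have equal parabolic subgroups, and a nontrivial letter of type
  \<open>v\<close> in \<open>par \<Omega>\<close> forces \<open>v \<in> \<Omega>\<close>. So an
  index determines its support.\<close>

lemma parallel_class_eq:
  assumes nontrivial: "\<And>v. v \<in> V \<Longrightarrow> S v \<noteq> {\<one>}"
    and \<Lambda>: "\<Lambda> \<subseteq> V" "\<Omega> \<subseteq> V" and gh: "g \<in> carrier G" "h \<in> carrier G"
    and eq: "parallel_class \<Lambda> g = parallel_class \<Omega> h"
  shows "\<Lambda> = \<Omega> \<and> inv h \<otimes> g \<in> par (st \<Omega>)"
proof -
  have "left_coset \<Lambda> (g \<otimes> \<one>) \<in> parallel_class \<Lambda> g" unfolding parallel_class_def using par_one by blast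
  then obtain c where c: "c \<in> par (st \<Omega>)" "left_coset \<Lambda> g = left_coset \<Omega> (h \<otimes> c)"
    unfolding eq using gh by (auto simp: parallel_class_def)
  have cc: "c \<in> carrier G" using c par_carrier by blast
  have "g \<otimes> \<one> \<in> left_coset \<Lambda> g" unfolding left_coset_def using par_one by blast
  then have "g \<in> left_coset \<Omega> (h \<otimes> c)" using c(2) gh by simp
  then obtain y where y: "y \<in> par \<Omega>" "g = h \<otimes> c \<otimes> y" unfolding left_coset_def by blast
  have yc: "y \<in> carrier G" using y par_carrier by blast
  have 1: "z \<in> par \<Omega>" if z: "z \<in> par \<Lambda>" for z
  proof -
    have zc: "z \<in> carrier G" using z par_carrier by blast
    have "g \<otimes> z \<in> left_coset \<Lambda> g" unfolding left_coset_def using z by blast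
    then have "g \<otimes> z \<in> left_coset \<Omega> (h \<otimes> c)" unfolding c(2) .
    then obtain y2 where y2: "y2 \<in> par \<Omega>" "g \<otimes> z = h \<otimes> c \<otimes> y2" unfolding left_coset_def by blast
    have "h \<otimes> c \<otimes> (y \<otimes> z) = h \<otimes> c \<otimes> y2" using y2(2) y gh cc yc zc by (simp add: m_assoc)
    then have "y \<otimes> z = y2" using gh cc yc zc par_carrier[OF y2(1)] by simp
    then have "z = inv y \<otimes> y2" using yc zc by auto
    then show ?thesis using par_mult[OF y2(1) par_inv[OF y(1)]] by simp
  qed
  have 2: "z \<in> par \<Lambda>" if z: "z \<in> par \<Omega>" for z
  proof -
    have zc: "z \<in> carrier G" using z par_carrier by blast
    have "g \<otimes> z = h \<otimes> c \<otimes> (y \<otimes> z)" using y gh cc yc zc by (simp add: m_assoc)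
    then have "g \<otimes> z \<in> left_coset \<Omega> (h \<otimes> c)" unfolding left_coset_def using par_mult[OF z y(1)] by blast
    then have "g \<otimes> z \<in> left_coset \<Lambda> g" unfolding c(2) .
    then obtain z' where "z' \<in> par \<Lambda>" "g \<otimes> z = g \<otimes> z'" unfolding left_coset_def by blast
    then show ?thesis using gh zc par_carrier by auto
  qed
  have sub: "\<Lambda> \<subseteq> \<Omega>" if par: "\<And>z. z \<in> par \<Lambda> \<Longrightarrow> z \<in> par \<Omega>" and \<Lambda>V: "\<Lambda> \<subseteq> V" for \<Lambda> \<Omega>
  proof (rule ccontr)
    assume "\<not> \<Lambda> \<subseteq> \<Omega>"
    then obtain v where v: "v \<in> \<Lambda>" "v \<notin> \<Omega>" "v \<in> V" using \<Lambda>V by blast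
    have "s = \<one>" if s: "s \<in> S v" for s
    proof -
      have "s \<in> par ({v} \<inter> \<Omega>)"
        using par_inter[of s "{v}" \<Omega>] par_letter[of v "{v}" s] par_letter[of v \<Lambda> s] s v par[of s] by simp
      then show ?thesis using v(2) par_empty by simp
    qed
    then show False using nontrivial[OF v(3)] subgroup.one_closed[OF S_subgroup[OF v(3)]] by blast
  qed
  have "\<Lambda> = \<Omega>" using sub[OF 1 \<Lambda>(1)] sub[OF 2 \<Lambda>(2)] by blast
  moreover have "inv h \<otimes> g = c \<otimes> y" using y(2) gh cc yc by (simp add: m_assoc)
  then have "inv h \<otimes> g \<in> par (st \<Omega>)" using par_mult[OF par_mono[OF _ y(1)] c(1)] by (simp add: st_def)
  ultimately show ?thesis by blast
qed

definition parallel_classes :: "'a set set set" where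
  "parallel_classes = {parallel_class \<Lambda> g |\<Lambda> g. \<Lambda> \<subseteq> V \<and> \<Lambda> \<noteq> {} \<and> g \<in> carrier G}"

definition class_data :: "'a set set \<Rightarrow> 'v set \<times> 'a" where
  "class_data W = (SOME p. fst p \<subseteq> V \<and> fst p \<noteq> {} \<and> snd p \<in> carrier G \<and> W = parallel_class (fst p) (snd p))"

lemma class_data:
  assumes "W \<in> parallel_classes"
  shows "fst (class_data W) \<subseteq> V" "fst (class_data W) \<noteq> {}" "snd (class_data W) \<in> carrier G"
    "W = parallel_class (fst (class_data W)) (snd (class_data W))"
proof -
  have "\<exists>p. fst p \<subseteq> V \<and> fst p \<noteq> {} \<and> snd p \<in> carrier G \<and> W = parallel_class (fst p) (snd p)"
    using assms unfolding parallel_classes_def by auto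
  from someI_ex[OF this] show "fst (class_data W) \<subseteq> V" "fst (class_data W) \<noteq> {}" "snd (class_data W) \<in> carrier G"
    "W = parallel_class (fst (class_data W)) (snd (class_data W))" unfolding class_data_def by blast+
qed

lemma classes_parallelism_classes:
  assumes "V \<noteq> {}" and nontrivial: "\<And>v. v \<in> V \<Longrightarrow> S v \<noteq> {\<one>}"
  shows "parallelism_classes G V adj S parallel_classes (fst \<circ> class_data) (snd \<circ> class_data)"
proof
  show "V \<noteq> {}" by fact
  fix W assume W: "W \<in> parallel_classes"
  show "(fst \<circ> class_data) W \<subseteq> V" "(fst \<circ> class_data) W \<noteq> {}" "(snd \<circ> class_data) W \<in> carrier G"
    using class_data[OF W] by simp_all
  fix U assume U: "U \<in> parallel_classes" and lam: "(fst \<circ> class_data) U = (fst \<circ> class_data) W"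
    and rep: "inv ((snd \<circ> class_data) U) \<otimes> (snd \<circ> class_data) W \<in> par (st ((fst \<circ> class_data) U))"
  let ?g = "snd (class_data U)" and ?h = "snd (class_data W)" and ?\<Lambda> = "fst (class_data U)"
  have "parallel_class ?\<Lambda> (?g \<otimes> (inv ?g \<otimes> ?h)) = parallel_class ?\<Lambda> ?g"
    by (rule parallel_class_shift[OF class_data(3)[OF U]]) (use rep in simp)
  then have h: "parallel_class ?\<Lambda> ?h = parallel_class ?\<Lambda> ?g" using class_data(3)[OF U] class_data(3)[OF W] by simp
  have "U = parallel_class ?\<Lambda> ?g" by (rule class_data(4)[OF U])
  also have "\<dots> = parallel_class (fst (class_data W)) ?h" unfolding h[symmetric] using lam by simp
  also have "\<dots> = W" by (rule class_data(4)[OF W, symmetric])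
  finally show "U = W" .
next
  fix \<Lambda> g assume \<Lambda>: "\<Lambda> \<subseteq> V" "\<Lambda> \<noteq> {}" and g: "g \<in> carrier G"
  let ?W = "parallel_class \<Lambda> g"
  have W: "?W \<in> parallel_classes" unfolding parallel_classes_def using \<Lambda> g by blast
  have "fst (class_data ?W) = \<Lambda> \<and> inv g \<otimes> snd (class_data ?W) \<in> par (st \<Lambda>)"
    by (rule parallel_class_eq[OF nontrivial class_data(1)[OF W] \<Lambda>(1) class_data(3)[OF W] g class_data(4)[OF W, symmetric]])
  then show "\<exists>W\<in>parallel_classes. (fst \<circ> class_data) W = \<Lambda> \<and> inv g \<otimes> (snd \<circ> class_data) W \<in> par (st \<Lambda>)" using W by auto
qed

subsection \<open>The path metric of the syllable graph\<close>

definition syllable_graph :: "'a rel" where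
  "syllable_graph = {(x, y). x \<in> carrier G \<and> y \<in> carrier G \<and> x \<noteq> y \<and> (\<exists>v\<in>V. inv x \<otimes> y \<in> S v)}"

definition graph_dist :: "'a \<Rightarrow> 'a \<Rightarrow> real" where
  "graph_dist x y = real (LEAST n. (x, y) \<in> syllable_graph ^^ n)"

lemma syllable_path_ball:
  "(x, y) \<in> syllable_graph ^^ n \<Longrightarrow> x \<in> carrier G \<Longrightarrow> y \<in> carrier G \<and> inv x \<otimes> y \<in> syl.ball n"
proof (induction n arbitrary: y)
  case (Suc n)
  then obtain z where z: "(x, z) \<in> syllable_graph ^^ n" "(z, y) \<in> syllable_graph" by auto
  have IH: "z \<in> carrier G" "inv x \<otimes> z \<in> syl.ball n" using Suc.IH[OF z(1) Suc.prems(2)] by auto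
  have y: "y \<in> carrier G" "inv z \<otimes> y \<in> letters" using z(2) by (auto simp: syllable_graph_def letters_def)
  have "(inv x \<otimes> z) \<otimes> (inv z \<otimes> y) \<in> syl.ball (Suc n)" by (rule syl.ball_step[OF IH(2) y(2)])
  then show ?case unfolding telescope[OF Suc.prems(2) IH(1) y(1)] using y(1) by blast
qed simp

lemma ball_syllable_path:
  "t \<in> syl.ball n \<Longrightarrow> x \<in> carrier G \<Longrightarrow> \<exists>m\<le>n. (x, x \<otimes> t) \<in> syllable_graph ^^ m"
proof (induction n arbitrary: t)
  case 0
  then show ?case by (intro exI[of _ 0]) simp
next
  case (Suc n)
  then obtain u s where us: "t = u \<otimes> s" "u \<in> syl.ball n" "s \<in> letters" by auto
  obtain m where m: "m \<le> n" "(x, x \<otimes> u) \<in> syllable_graph ^^ m" using Suc.IH[OF us(2) Suc.prems(2)] by blast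
  have c: "x \<in> carrier G" "u \<in> carrier G" "s \<in> carrier G" using Suc.prems us syl.ball_carrier syl.T_carrier by auto
  show ?case
  proof (cases "s = \<one>")
    case True
    then show ?thesis using m us c by (intro exI[of _ m]) auto
  next
    case False
    then obtain v where v: "v \<in> V" "s \<in> S v" using us(3) by (auto elim: letter_E)
    have e: "x \<otimes> t = x \<otimes> u \<otimes> s" using us(1) c by (simp add: m_assoc)
    have "x \<otimes> u \<noteq> x \<otimes> u \<otimes> s" using False c by (metis l_cancel_one m_closed)
    moreover have "inv (x \<otimes> u) \<otimes> (x \<otimes> u \<otimes> s) = s" using c by simp
    ultimately have "(x \<otimes> u, x \<otimes> t) \<in> syllable_graph" unfolding e syllable_graph_def using v c by auto
    then show ?thesis using m by (intro exI[of _ "Suc m"]) auto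
  qed
qed

lemma graph_dist_len:
  assumes "x \<in> carrier G" "y \<in> carrier G"
  shows "graph_dist x y = real (len (inv x \<otimes> y))"
proof -
  have "inv x \<otimes> y \<in> syl.ball (len (inv x \<otimes> y))" using len_ball assms by simp
  then obtain m where m: "m \<le> len (inv x \<otimes> y)" "(x, y) \<in> syllable_graph ^^ m"
    using ball_syllable_path[of "inv x \<otimes> y" _ x] assms by auto
  have "(LEAST n. (x, y) \<in> syllable_graph ^^ n) = len (inv x \<otimes> y)"
  proof (rule antisym)
    show "(LEAST n. (x, y) \<in> syllable_graph ^^ n) \<le> len (inv x \<otimes> y)"
      using Least_le[of "\<lambda>n. (x, y) \<in> syllable_graph ^^ n", OF m(2)] m(1) by simp
    have "(x, y) \<in> syllable_graph ^^ (LEAST n. (x, y) \<in> syllable_graph ^^ n)"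
      using LeastI[of "\<lambda>n. (x, y) \<in> syllable_graph ^^ n", OF m(2)] .
    then show "len (inv x \<otimes> y) \<le> (LEAST n. (x, y) \<in> syllable_graph ^^ n)"
      using syllable_path_ball[OF _ assms(1)] syl.wlen_le by blast
  qed
  then show ?thesis by (simp add: graph_dist_def)
qed

text \<open>\<open>Metric_space\<close> wants symmetry also off the carrier, where
  \<open>graph_dist\<close> is no word length; it is therefore shown for the paths.\<close>

lemma syllable_graph_sym: "(x, y) \<in> syllable_graph ^^ n \<Longrightarrow> (y, x) \<in> syllable_graph ^^ n"
proof (induction n arbitrary: y)
  case (Suc n)
  then obtain z where z: "(x, z) \<in> syllable_graph ^^ n" "(z, y) \<in> syllable_graph" by auto
  have "inv y \<otimes> z \<in> S v" if "inv z \<otimes> y \<in> S v" "v \<in> V" "z \<in> carrier G" "y \<in> carrier G" for v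
    using subgroup.m_inv_closed[OF S_subgroup that(1), OF that(2)] that(3,4) by (simp add: inv_mult_group)
  then have "(y, z) \<in> syllable_graph" using z(2) unfolding syllable_graph_def by auto
  then show ?case using Suc.IH[OF z(1)] by (rule relpow_Suc_I2)
qed simp

lemma graph_dist_metric: "Metric_space (carrier G) graph_dist"
proof
  interpret D: integer_path_metric "carrier G" "\<lambda>x y. len (inv x \<otimes> y)" by (rule syl_path_metric)
  fix x y
  show "0 \<le> graph_dist x y" by (simp add: graph_dist_def)
  have "(x, y) \<in> syllable_graph ^^ n \<longleftrightarrow> (y, x) \<in> syllable_graph ^^ n" for n using syllable_graph_sym by blast
  then show "graph_dist x y = graph_dist y x" by (simp add: graph_dist_def)
  show "graph_dist x y = 0 \<longleftrightarrow> x = y" if "x \<in> carrier G" "y \<in> carrier G"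
    using D.D_zero[OF that] graph_dist_len[OF that] by simp
  fix z
  show "graph_dist x z \<le> graph_dist x y + graph_dist y z" if "x \<in> carrier G" "y \<in> carrier G" "z \<in> carrier G"
    using D.D_triangle[OF that] graph_dist_len that by simp
qed

theorem syllable_graph_hierarchically_hyperbolic:
  assumes "V \<noteq> {}" "\<And>v. v \<in> V \<Longrightarrow> S v \<noteq> {\<one>}"
  shows "hierarchically_hyperbolic_space TYPE('a set set) TYPE('a \<Rightarrow> real) (carrier G) graph_dist"
proof -
  interpret C: parallelism_classes G V adj S parallel_classes "fst \<circ> class_data" "snd \<circ> class_data"
    by (rule classes_parallelism_classes[OF assms])
  show ?thesis
    unfolding hierarchically_hyperbolic_space_def
    using C.hierarchically_hyperbolic[OF graph_dist_metric graph_dist_len] by blast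
qed

end

section \<open>Graph products have gates\<close>

locale group_family =
  fixes V :: "'v set" and Ed :: "'v set set" and G :: "'v \<Rightarrow> ('g, 'm) monoid_scheme"
  assumes graph: "simplicial_graph V Ed" and groups: "v \<in> V \<Longrightarrow> group (G v)"
begin

abbreviation "W \<equiv> group_words V G"
abbreviation "R \<equiv> free_product_rel V G"
abbreviation "F \<equiv> free_product V G"
abbreviation "N \<equiv> normal_closure F (edge_commutators V Ed G)"
abbreviation "Q \<equiv> graph_product V Ed G"

definition cls :: "('v \<times> 'g) list \<Rightarrow> ('v \<times> 'g) list set" where
  "cls w = R `` {w}"

definition winv :: "('v \<times> 'g) list \<Rightarrow> ('v \<times> 'g) list" where
  "winv w = rev (map (\<lambda>(v, g). (v, inv\<^bsub>G v\<^esub> g)) w)"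

definition quot :: "('v \<times> 'g) list \<Rightarrow> ('v \<times> 'g) list set set" where
  "quot w = N #>\<^bsub>F\<^esub> cls w"

lemma edge_vertices: "{v, w} \<in> Ed \<Longrightarrow> v \<in> V \<and> w \<in> V \<and> v \<noteq> w"
  using graph unfolding simplicial_graph_def by fastforce

section \<open>Words, the free product and its quotient\<close>

lemma Nil_words [simp]: "[] \<in> W"
  by (simp add: group_words_def)

lemma Cons_words [simp]: "x # w \<in> W \<longleftrightarrow> fst x \<in> V \<and> snd x \<in> carrier (G (fst x)) \<and> w \<in> W"
  by (cases x) (auto simp: group_words_def)

lemma append_words [simp]: "u @ w \<in> W \<longleftrightarrow> u \<in> W \<and> w \<in> W"
  by (auto simp: group_words_def)

lemma winv_words: "w \<in> W \<Longrightarrow> winv w \<in> W"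
  by (induction w) (auto simp: winv_def group.inv_closed[OF groups])

lemma rel_mult: "v \<in> V \<Longrightarrow> g \<in> carrier (G v) \<Longrightarrow> h \<in> carrier (G v) \<Longrightarrow>
    ([(v, g), (v, h)], [(v, g \<otimes>\<^bsub>G v\<^esub> h)]) \<in> R"
  by (rule free_product_rel.mult)

lemma rel_words: "(u, w) \<in> R \<Longrightarrow> u \<in> W \<and> w \<in> W"
proof (induction rule: free_product_rel.induct)
  case (one v)
  then interpret Gv: group "G v" by (intro groups)
  show ?case using one by simp
next
  case (mult v g h)
  then interpret Gv: group "G v" by (intro groups)
  show ?case using mult by simp
qed auto

lemma rel_equiv: "equiv W R"
proof (rule equivI)
  show "R \<subseteq> W \<times> W" using rel_words by auto
  show "refl_on W R" using free_product_rel.refl by (auto simp: refl_on_def)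
  show "Relation.sym R" by (rule symI) (rule free_product_rel.sym)
  show "Relation.trans R" by (rule transI) (rule free_product_rel.trans)
qed

lemma cls_eq: "(u, w) \<in> R \<Longrightarrow> cls u = cls w"
  unfolding cls_def by (rule equiv_class_eq[OF rel_equiv])

lemma cls_eq_iff: "u \<in> W \<Longrightarrow> w \<in> W \<Longrightarrow> cls u = cls w \<longleftrightarrow> (u, w) \<in> R"
  unfolding cls_def using eq_equiv_class_iff[OF rel_equiv] by simp

lemma cls_carrier: "w \<in> W \<Longrightarrow> cls w \<in> carrier F"
  unfolding cls_def by (simp add: free_product_def quotientI)

lemma carrier_cls: "A \<in> carrier F \<Longrightarrow> \<exists>w\<in>W. A = cls w"
  unfolding cls_def by (auto simp: free_product_def quotient_def)

lemma cls_mult: assumes "u \<in> W" "w \<in> W" shows "cls u \<otimes>\<^bsub>F\<^esub> cls w = cls (u @ w)"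
proof -
  have "cls (a @ b) = cls (u @ w)" if "a \<in> cls u" "b \<in> cls w" for a b
  proof -
    have "(u @ w, a @ b) \<in> R" using that free_product_rel.append by (auto simp: cls_def)
    then show ?thesis using cls_eq by blast
  qed
  moreover have "u \<in> cls u" "w \<in> cls w" using assms free_product_rel.refl by (auto simp: cls_def)
  ultimately have "(\<Union>a\<in>cls u. \<Union>b\<in>cls w. cls (a @ b)) = cls (u @ w)" by blast
  then show ?thesis by (simp add: free_product_def flip: cls_def)
qed

lemma cls_one: "\<one>\<^bsub>F\<^esub> = cls []"
  by (simp add: free_product_def cls_def)

lemma winv_left: "w \<in> W \<Longrightarrow> (winv w @ w, []) \<in> R"
proof (induction w)
  case Nil
  then show ?case using free_product_rel.refl[of "[]" V G] by (simp add: winv_def)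
next
  case (Cons x w)
  obtain v g where x: "x = (v, g)" by (cases x)
  have vg: "v \<in> V" "g \<in> carrier (G v)" and w: "w \<in> W" using Cons.prems x by auto
  interpret Gv: group "G v" using groups vg by blast
  have 1: "([(v, inv\<^bsub>G v\<^esub> g), (v, g)], [(v, \<one>\<^bsub>G v\<^esub>)]) \<in> R"
    using rel_mult[OF vg(1) Gv.inv_closed[OF vg(2)] vg(2)] vg by simp
  have 2: "([(v, inv\<^bsub>G v\<^esub> g), (v, g)], []) \<in> R" using free_product_rel.trans[OF 1 free_product_rel.one[OF vg(1)]] .
  have "(winv w @ [(v, inv\<^bsub>G v\<^esub> g), (v, g)] @ w, winv w @ [] @ w) \<in> R"
    using free_product_rel.append[OF free_product_rel.refl[OF winv_words[OF w]] free_product_rel.append[OF 2 free_product_rel.refl[OF w]]] .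
  then have "(winv (x # w) @ x # w, winv w @ w) \<in> R" using x by (simp add: winv_def)
  then show ?case using free_product_rel.trans Cons.IH[OF w] by blast
qed

lemma free_product_group: "group F"
proof (rule groupI)
  show "\<one>\<^bsub>F\<^esub> \<in> carrier F" using cls_one cls_carrier by simp
  fix A B assume "A \<in> carrier F" "B \<in> carrier F"
  then obtain a b where ab: "a \<in> W" "b \<in> W" "A = cls a" "B = cls b" using carrier_cls by blast
  show "A \<otimes>\<^bsub>F\<^esub> B \<in> carrier F" using ab cls_mult cls_carrier by simp
  show "\<one>\<^bsub>F\<^esub> \<otimes>\<^bsub>F\<^esub> A = A" using ab cls_mult[of "[]" a] cls_one by simp
  show "\<exists>y\<in>carrier F. y \<otimes>\<^bsub>F\<^esub> A = \<one>\<^bsub>F\<^esub>"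
    using cls_mult[OF winv_words[OF ab(1)] ab(1)] cls_eq[OF winv_left[OF ab(1)]] cls_carrier[OF winv_words[OF ab(1)]] ab cls_one
    by (intro bexI[of _ "cls (winv a)"]) auto
  fix C assume "C \<in> carrier F"
  then obtain c where c: "c \<in> W" "C = cls c" using carrier_cls by blast
  show "A \<otimes>\<^bsub>F\<^esub> B \<otimes>\<^bsub>F\<^esub> C = A \<otimes>\<^bsub>F\<^esub> (B \<otimes>\<^bsub>F\<^esub> C)" using ab c cls_mult by simp
qed

sublocale F: group F by (rule free_product_group)

lemma cls_inv: "w \<in> W \<Longrightarrow> inv\<^bsub>F\<^esub> cls w = cls (winv w)"
  using cls_mult[OF winv_words] cls_eq[OF winv_left] cls_one
  by (intro F.inv_equality) (auto intro: cls_carrier winv_words)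

lemma winv_right: "w \<in> W \<Longrightarrow> (w @ winv w, []) \<in> R"
  using F.r_inv[OF cls_carrier[of w]] cls_inv[of w] cls_mult[of w "winv w"] winv_words[of w] cls_one
    cls_eq_iff[of "w @ winv w" "[]"] by simp

lemma commutator_cls:
  assumes "v \<in> V" "w \<in> V" "g \<in> carrier (G v)" "h \<in> carrier (G w)"
  shows "commutator F (free_product_incl V G v g) (free_product_incl V G w h)
    = cls [(v, g), (w, h), (v, inv\<^bsub>G v\<^esub> g), (w, inv\<^bsub>G w\<^esub> h)]"
proof -
  have "free_product_incl V G u k = cls [(u, k)]" for u k by (simp add: free_product_incl_def cls_def)
  then show ?thesis
    using assms group.inv_closed[OF groups] by (simp add: commutator_def cls_inv cls_mult winv_def)
qed

lemma edge_commutators_carrier: "edge_commutators V Ed G \<subseteq> carrier F"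
proof
  fix A assume "A \<in> edge_commutators V Ed G"
  then obtain v w g h where *: "{v, w} \<in> Ed" "g \<in> carrier (G v)" "h \<in> carrier (G w)"
    "A = commutator F (free_product_incl V G v g) (free_product_incl V G w h)" unfolding edge_commutators_def by blast
  then show "A \<in> carrier F"
    using edge_vertices[OF *(1)] commutator_cls[of v w g h] by (auto intro!: cls_carrier group.inv_closed[OF groups])
qed

lemma N_normal: "N \<lhd> F"
proof -
  let ?NN = "{M. M \<lhd> F \<and> edge_commutators V Ed G \<subseteq> M}"
  have "carrier F \<lhd> F" using F.normal_inv_iff F.subgroup_self by simp
  then have ne: "carrier F \<in> ?NN" using edge_commutators_carrier by blast
  have "subgroup N F"
    unfolding normal_closure_def using ne by (intro F.subgroups_Inter) (auto simp: normal_def)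
  moreover have "x \<otimes>\<^bsub>F\<^esub> h \<otimes>\<^bsub>F\<^esub> inv\<^bsub>F\<^esub> x \<in> N" if "x \<in> carrier F" "h \<in> N" for x h
    using that F.normal_inv_iff unfolding normal_closure_def by blast
  ultimately show ?thesis using F.normal_inv_iff by blast
qed

lemma commutators_in_N: "edge_commutators V Ed G \<subseteq> N"
  unfolding normal_closure_def by blast

lemma quot_group: "group Q"
  unfolding graph_product_def by (rule normal.factorgroup_is_group[OF N_normal])

sublocale Q: group Q by (rule quot_group)

lemma coset_hom: "(\<lambda>A. N #>\<^bsub>F\<^esub> A) \<in> hom F Q"
  unfolding graph_product_def by (rule normal.r_coset_hom_Mod[OF N_normal])

lemma quot_carrier: "w \<in> W \<Longrightarrow> quot w \<in> carrier Q"
  unfolding quot_def using hom_in_carrier[OF coset_hom] cls_carrier by blast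

lemma carrier_quot: "q \<in> carrier Q \<Longrightarrow> \<exists>w\<in>W. q = quot w"
  unfolding graph_product_def quot_def using carrier_cls by (auto simp: FactGroup_def RCOSETS_def)

lemma quot_append: "u \<in> W \<Longrightarrow> w \<in> W \<Longrightarrow> quot (u @ w) = quot u \<otimes>\<^bsub>Q\<^esub> quot w"
  unfolding quot_def using hom_mult[OF coset_hom cls_carrier cls_carrier] cls_mult by simp

lemma quot_Nil: "quot [] = \<one>\<^bsub>Q\<^esub>"
  unfolding quot_def using hom_one[OF coset_hom F.is_group Q.is_group] cls_one by simp

lemma quot_rel: "(u, w) \<in> R \<Longrightarrow> quot u = quot w"
  unfolding quot_def using cls_eq by simp

lemma quot_letter_hom: "v \<in> V \<Longrightarrow> (\<lambda>g. quot [(v, g)]) \<in> hom (G v) Q"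
proof (rule homI)
  assume v: "v \<in> V"
  fix g h assume g: "g \<in> carrier (G v)" and h: "h \<in> carrier (G v)"
  show "quot [(v, g)] \<in> carrier Q" by (rule quot_carrier) (use v g in simp)
  show "quot [(v, g \<otimes>\<^bsub>G v\<^esub> h)] = quot [(v, g)] \<otimes>\<^bsub>Q\<^esub> quot [(v, h)]"
    using quot_rel[OF rel_mult[OF v g h]] quot_append[of "[(v, g)]" "[(v, h)]"] v g h by simp
qed

lemma quot_letter_group_hom: "v \<in> V \<Longrightarrow> group_hom (G v) Q (\<lambda>g. quot [(v, g)])"
  by (intro group_hom.intro group_hom_axioms.intro groups Q.is_group quot_letter_hom)

lemma vertex_subgroup_quot: "vertex_subgroup V Ed G v = (\<lambda>g. quot [(v, g)]) ` carrier (G v)"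
  by (simp add: vertex_subgroup_def quot_def cls_def free_product_incl_def)

lemma quot_commute:
  assumes "{v, w} \<in> Ed" "g \<in> carrier (G v)" "h \<in> carrier (G w)"
  shows "quot [(v, g)] \<otimes>\<^bsub>Q\<^esub> quot [(w, h)] = quot [(w, h)] \<otimes>\<^bsub>Q\<^esub> quot [(v, g)]"
proof -
  have vw: "v \<in> V" "w \<in> V" using edge_vertices[OF assms(1)] by auto
  interpret Gv: group "G v" using groups vw by blast
  interpret Gw: group "G w" using groups vw by blast
  have N: "subgroup N F" using N_normal normal_imp_subgroup by blast
  let ?a = "quot [(v, g)]" and ?b = "quot [(w, h)]"
  have ab: "?a \<in> carrier Q" "?b \<in> carrier Q" using quot_carrier vw assms by simp_all
  have i: "quot [(v, inv\<^bsub>G v\<^esub> g)] = inv\<^bsub>Q\<^esub> ?a" "quot [(w, inv\<^bsub>G w\<^esub> h)] = inv\<^bsub>Q\<^esub> ?b"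
    using group_hom.hom_inv[OF quot_letter_group_hom[OF vw(1)] assms(2)]
      group_hom.hom_inv[OF quot_letter_group_hom[OF vw(2)] assms(3)] by simp_all
  have "commutator F (free_product_incl V G v g) (free_product_incl V G w h) \<in> edge_commutators V Ed G"
    unfolding edge_commutators_def
    by (intro CollectI exI[of _ v] exI[of _ w] exI[of _ g] exI[of _ h]) (use assms in simp)
  then have c: "cls [(v, g), (w, h), (v, inv\<^bsub>G v\<^esub> g), (w, inv\<^bsub>G w\<^esub> h)] \<in> N"
    using commutators_in_N commutator_cls[OF vw assms(2,3)] by auto
  then have "quot [(v, g), (w, h), (v, inv\<^bsub>G v\<^esub> g), (w, inv\<^bsub>G w\<^esub> h)] = \<one>\<^bsub>Q\<^esub>"
    unfolding quot_def using F.coset_join2[OF subgroup.mem_carrier[OF N c] N c]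
    by (simp add: graph_product_def FactGroup_def)
  moreover have "quot [(v, g), (w, h), (v, inv\<^bsub>G v\<^esub> g), (w, inv\<^bsub>G w\<^esub> h)] = ?a \<otimes>\<^bsub>Q\<^esub> (?b \<otimes>\<^bsub>Q\<^esub> (inv\<^bsub>Q\<^esub> ?a \<otimes>\<^bsub>Q\<^esub> inv\<^bsub>Q\<^esub> ?b))"
    using quot_append[of "[(v, g)]" "[(w, h), (v, inv\<^bsub>G v\<^esub> g), (w, inv\<^bsub>G w\<^esub> h)]"]
      quot_append[of "[(w, h)]" "[(v, inv\<^bsub>G v\<^esub> g), (w, inv\<^bsub>G w\<^esub> h)]"]
      quot_append[of "[(v, inv\<^bsub>G v\<^esub> g)]" "[(w, inv\<^bsub>G w\<^esub> h)]"] vw assms i by simp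
  ultimately have "(?a \<otimes>\<^bsub>Q\<^esub> ?b) \<otimes>\<^bsub>Q\<^esub> inv\<^bsub>Q\<^esub> (?b \<otimes>\<^bsub>Q\<^esub> ?a) = \<one>\<^bsub>Q\<^esub>"
    using ab by (simp add: Q.m_assoc Q.inv_mult_group)
  then have "?a \<otimes>\<^bsub>Q\<^esub> ?b = inv\<^bsub>Q\<^esub> (inv\<^bsub>Q\<^esub> (?b \<otimes>\<^bsub>Q\<^esub> ?a))" using ab by (intro Q.inv_equality[symmetric]) auto
  then show ?thesis using ab by simp
qed

end

text \<open>The universal property of the graph product, for right actions on a set.\<close>

locale word_action = group_family V Ed G
  for V :: "'v set" and Ed and G :: "'v \<Rightarrow> ('g, 'm) monoid_scheme" +
  fixes Y :: "'y set" and act :: "'v \<times> 'g \<Rightarrow> 'y \<Rightarrow> 'y"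
  assumes act_in: "v \<in> V \<Longrightarrow> g \<in> carrier (G v) \<Longrightarrow> y \<in> Y \<Longrightarrow> act (v, g) y \<in> Y"
    and act_one: "v \<in> V \<Longrightarrow> y \<in> Y \<Longrightarrow> act (v, \<one>\<^bsub>G v\<^esub>) y = y"
    and act_mult: "v \<in> V \<Longrightarrow> g \<in> carrier (G v) \<Longrightarrow> h \<in> carrier (G v) \<Longrightarrow> y \<in> Y \<Longrightarrow>
      act (v, h) (act (v, g) y) = act (v, g \<otimes>\<^bsub>G v\<^esub> h) y"
    and act_comm: "{v, w} \<in> Ed \<Longrightarrow> g \<in> carrier (G v) \<Longrightarrow> h \<in> carrier (G w) \<Longrightarrow> y \<in> Y \<Longrightarrow>
      act (w, h) (act (v, g) y) = act (v, g) (act (w, h) y)"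
begin

lemma run_in: "w \<in> W \<Longrightarrow> y \<in> Y \<Longrightarrow> fold act w y \<in> Y"
  by (induction w arbitrary: y) (auto simp: act_in)

lemma run_rel: "(u, w) \<in> R \<Longrightarrow> y \<in> Y \<Longrightarrow> fold act u y = fold act w y"
proof (induction arbitrary: y rule: free_product_rel.induct)
  case (sym u w)
  then show ?case by metis
next
  case (trans u w z)
  then show ?case by metis
next
  case (append u u' w w')
  have "fold act u y \<in> Y" using append run_in rel_words by blast
  then show ?case using append by simp
qed (simp_all add: act_one act_mult)

lemma run_winv: "w \<in> W \<Longrightarrow> y \<in> Y \<Longrightarrow> fold act (winv w) (fold act w y) = y"
  "w \<in> W \<Longrightarrow> y \<in> Y \<Longrightarrow> fold act w (fold act (winv w) y) = y"
  using run_rel[OF winv_right, of w y] run_rel[OF winv_left, of w y] by simp_all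

text \<open>A normal subgroup that contains the edge commutators and therefore \<open>N\<close>;
  this lets the action descend to the graph product.\<close>

definition kernel :: "('v \<times> 'g) list set set" where
  "kernel = {A \<in> carrier F. \<forall>w\<in>A. \<forall>y\<in>Y. fold act w y = y}"

lemma kernel_cls: "w \<in> W \<Longrightarrow> cls w \<in> kernel \<longleftrightarrow> (\<forall>y\<in>Y. fold act w y = y)"
proof -
  assume w: "w \<in> W"
  have "fold act u y = fold act w y" if "u \<in> cls w" "y \<in> Y" for u y
    using that run_rel[of w u y] by (simp add: cls_def)
  moreover have "w \<in> cls w" using w free_product_rel.refl by (simp add: cls_def)
  ultimately show ?thesis
    unfolding kernel_def using cls_carrier[OF w] by (intro iffI CollectI conjI ballI) (blast, blast, metis)
qed

lemma kernel_normal: "kernel \<lhd> F"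
proof -
  have "subgroup kernel F"
  proof (rule F.subgroupI)
    show "kernel \<subseteq> carrier F" by (auto simp: kernel_def)
    show "kernel \<noteq> {}" using kernel_cls[of "[]"] by auto
    fix A assume A: "A \<in> kernel"
    then obtain a where a: "a \<in> W" "A = cls a" using carrier_cls unfolding kernel_def by blast
    have ka: "fold act a y = y" if "y \<in> Y" for y using A a kernel_cls that by blast
    have "fold act (winv a) y = y" if "y \<in> Y" for y using run_winv(1)[OF a(1) that] ka[OF that] by simp
    then show "inv\<^bsub>F\<^esub> A \<in> kernel" using a cls_inv kernel_cls[OF winv_words[OF a(1)]] by simp
    fix B assume B: "B \<in> kernel"
    then obtain b where b: "b \<in> W" "B = cls b" using carrier_cls unfolding kernel_def by blast
    have kb: "fold act b y = y" if "y \<in> Y" for y using B b kernel_cls that by blast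
    show "A \<otimes>\<^bsub>F\<^esub> B \<in> kernel" using a b cls_mult kernel_cls[of "a @ b"] ka kb by simp
  qed
  moreover have "X \<otimes>\<^bsub>F\<^esub> A \<otimes>\<^bsub>F\<^esub> inv\<^bsub>F\<^esub> X \<in> kernel" if X: "X \<in> carrier F" and A: "A \<in> kernel" for X A
  proof -
    obtain x where x: "x \<in> W" "X = cls x" using carrier_cls[OF X] by blast
    have "A \<in> carrier F" using A by (simp add: kernel_def)
    then obtain a where a: "a \<in> W" "A = cls a" using carrier_cls by blast
    have ka: "fold act a y = y" if "y \<in> Y" for y using A a kernel_cls that by blast
    have "X \<otimes>\<^bsub>F\<^esub> A \<otimes>\<^bsub>F\<^esub> inv\<^bsub>F\<^esub> X = cls ((x @ a) @ winv x)" using x a cls_inv cls_mult winv_words by simp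
    moreover have "fold act ((x @ a) @ winv x) y = y" if "y \<in> Y" for y
      using ka[OF run_in[OF x(1) that]] run_winv(1)[OF x(1) that] by simp
    ultimately show ?thesis using kernel_cls[of "(x @ a) @ winv x"] x a winv_words by simp
  qed
  ultimately show ?thesis using F.normal_inv_iff by blast
qed

lemma N_kernel: "N \<subseteq> kernel"
proof -
  have "edge_commutators V Ed G \<subseteq> kernel"
  proof
    fix A assume "A \<in> edge_commutators V Ed G"
    then obtain v w g h where *: "{v, w} \<in> Ed" "g \<in> carrier (G v)" "h \<in> carrier (G w)"
      "A = commutator F (free_product_incl V G v g) (free_product_incl V G w h)" unfolding edge_commutators_def by blast
    have vw: "v \<in> V" "w \<in> V" using edge_vertices[OF *(1)] by auto
    interpret Gv: group "G v" using groups vw by blast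
    interpret Gw: group "G w" using groups vw by blast
    let ?c = "[(v, g), (w, h), (v, inv\<^bsub>G v\<^esub> g), (w, inv\<^bsub>G w\<^esub> h)]"
    have "fold act ?c y = y" if y: "y \<in> Y" for y
    proof -
      have "fold act ?c y = act (w, inv\<^bsub>G w\<^esub> h) (act (v, inv\<^bsub>G v\<^esub> g) (act (v, g) (act (w, h) y)))"
        using act_comm[OF *(1-3) y] by simp
      also have "\<dots> = y" using y vw *(2,3) by (simp add: act_mult act_one act_in)
      finally show ?thesis .
    qed
    then have "cls ?c \<in> kernel" using vw *(2,3) kernel_cls[of ?c] by simp
    then show "A \<in> kernel" using commutator_cls[OF vw *(2,3)] *(4) by simp
  qed
  then show ?thesis unfolding normal_closure_def using kernel_normal by blast
qed

lemma run_quot: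
  assumes "u \<in> W" "w \<in> W" "quot u = quot w" "y \<in> Y"
  shows "fold act u y = fold act w y"
proof -
  have N: "subgroup N F" using N_normal normal_imp_subgroup by blast
  have "cls u \<in> N #>\<^bsub>F\<^esub> cls w"
    using F.rcos_self[OF cls_carrier[OF assms(1)] N] assms(3) unfolding quot_def by simp
  then obtain A where A: "A \<in> N" "cls u = A \<otimes>\<^bsub>F\<^esub> cls w" unfolding r_coset_def by blast
  then have "A \<in> kernel" using N_kernel by blast
  then obtain a where a: "a \<in> W" "A = cls a" using carrier_cls unfolding kernel_def by blast
  have "cls u = cls (a @ w)" using A a cls_mult assms by simp
  then have "(u, a @ w) \<in> R" using cls_eq_iff assms a by simp
  then have "fold act u y = fold act (a @ w) y" using run_rel assms by blast
  also have "\<dots> = fold act w y" using kernel_cls[OF a(1)] \<open>A \<in> kernel\<close> a(2) assms(4) by simp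
  finally show ?thesis .
qed

end

section \<open>Gates from actions of the graph product\<close>

context group_family
begin

abbreviation "edge_rel v w \<equiv> {v, w} \<in> Ed"
abbreviation "sub v \<equiv> vertex_subgroup V Ed G v"

lemma quot_sub: "v \<in> V \<Longrightarrow> g \<in> carrier (G v) \<Longrightarrow> quot [(v, g)] \<in> sub v"
  unfolding vertex_subgroup_quot by blast

text \<open>A nontrivial letter at \<open>v0\<close> is detected by letting \<open>G v0\<close>
  translate itself while all other vertices act trivially. This respects the commutations because
  the ends of an edge are distinct.\<close>

lemma sub_nontrivial:
  assumes v0: "v0 \<in> V" and ne: "carrier (G v0) \<noteq> {\<one>\<^bsub>G v0\<^esub>}"
  shows "sub v0 \<noteq> {\<one>\<^bsub>Q\<^esub>}"
proof
  interpret G0: group "G v0" using groups v0 by blast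
  interpret A: word_action V Ed G "carrier (G v0)" "\<lambda>(v, g) y. if v = v0 then y \<otimes>\<^bsub>G v0\<^esub> g else y"
    by unfold_locales (use edge_vertices in \<open>auto simp: G0.m_assoc\<close>)
  assume triv: "sub v0 = {\<one>\<^bsub>Q\<^esub>}"
  obtain g where g: "g \<in> carrier (G v0)" "g \<noteq> \<one>\<^bsub>G v0\<^esub>" using ne G0.one_closed by blast
  have "quot [(v0, g)] = quot []" using triv quot_sub[OF v0 g(1)] quot_Nil by simp
  then have "\<one>\<^bsub>G v0\<^esub> \<otimes>\<^bsub>G v0\<^esub> g = \<one>\<^bsub>G v0\<^esub>" using A.run_quot[of "[(v0, g)]" "[]" "\<one>\<^bsub>G v0\<^esub>"] v0 g by simp
  then show False using g by simp
qed

lemma quot_vertex_subgroups: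
  assumes "finite V"
  shows "vertex_subgroups Q V edge_rel sub"
proof (rule vertex_subgroups.intro[OF Q.is_group vertex_subgroups_axioms.intro[OF assms]])
  show "{u, v} \<in> Ed \<Longrightarrow> {v, u} \<in> Ed" for u v by (simp add: insert_commute)
  show "{v, v} \<notin> Ed" for v using edge_vertices by blast
  show "subgroup (sub v) Q" if "v \<in> V" for v
    unfolding vertex_subgroup_quot
    by (rule group_hom.img_is_subgroup[OF quot_letter_group_hom[OF that]])
  show "s \<otimes>\<^bsub>Q\<^esub> t = t \<otimes>\<^bsub>Q\<^esub> s" if "{u, v} \<in> Ed" "s \<in> sub u" "t \<in> sub v" for u v s t
    using that quot_commute unfolding vertex_subgroup_quot by blast
qed

text \<open>The gate is read off the action of the graph product on pairs \<open>(a, x)\<close> in which a letter of \<open>\<Lambda>\<close>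
  also multiplies \<open>a\<close> if it can be shuffled past \<open>inv a \<cdot> x\<close>; the star instead of the link makes the
  condition invariant under the letter itself.\<close>

lemma graph_product_gated:
  assumes "finite V"
  shows "gated_group Q V edge_rel sub"
proof -
  interpret vertex_subgroups Q V edge_rel sub by (rule quot_vertex_subgroups[OF assms])
  have par: "quot w \<in> par V" if "w \<in> W" for w
    using that
  proof (induction w rule: rev_induct)
    case Nil
    then show ?case using par_one quot_Nil by simp
  next
    case (snoc x w)
    then show ?case using par_step[of "quot w" V "fst x" "quot [x]"] quot_sub[of "fst x" "snd x"] quot_append[of w "[x]"] by simp
  qed
  have gate: "\<exists>\<gamma>. \<gamma> \<one>\<^bsub>Q\<^esub> = \<one>\<^bsub>Q\<^esub> \<and> (\<forall>x\<in>carrier Q. \<forall>v\<in>V. \<forall>s\<in>sub v. \<gamma> (x \<otimes>\<^bsub>Q\<^esub> s) =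
      (if v \<in> \<Lambda> \<and> inv\<^bsub>Q\<^esub> (\<gamma> x) \<otimes>\<^bsub>Q\<^esub> x \<in> par (st {v}) then \<gamma> x \<otimes>\<^bsub>Q\<^esub> s else \<gamma> x))" for \<Lambda>
  proof -
    define C where "C v a x \<longleftrightarrow> v \<in> \<Lambda> \<and> inv\<^bsub>Q\<^esub> a \<otimes>\<^bsub>Q\<^esub> x \<in> par (st {v})" for v a x
    define act where "act = (\<lambda>(v, g) (a, x). (if C v a x then a \<otimes>\<^bsub>Q\<^esub> quot [(v, g)] else a, x \<otimes>\<^bsub>Q\<^esub> quot [(v, g)]))"
    \<comment> \<open>The test for \<open>v\<close> is blind to letters in the star of
      \<open>v\<close>, whether they reach only \<open>x\<close> or also \<open>a\<close>. For
      \<open>v\<close> itself this gives compatibility with products in \<open>G v\<close>, for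
      adjacent vertices it gives commutation.\<close>
    have C1: "C v a (x \<otimes>\<^bsub>Q\<^esub> s) = C v a x" "C v (a \<otimes>\<^bsub>Q\<^esub> s) (x \<otimes>\<^bsub>Q\<^esub> s) = C v a x"
      if s: "s \<in> par (st {v})" and ax: "a \<in> carrier Q" "x \<in> carrier Q" for v a x s
    proof -
      have sc: "s \<in> carrier Q" using par_carrier[OF s] .
      let ?b = "inv\<^bsub>Q\<^esub> a \<otimes>\<^bsub>Q\<^esub> x"
      have 1: "?b \<otimes>\<^bsub>Q\<^esub> s \<in> par (st {v}) \<longleftrightarrow> ?b \<in> par (st {v})"
      proof
        assume "?b \<otimes>\<^bsub>Q\<^esub> s \<in> par (st {v})"
        then have "?b \<otimes>\<^bsub>Q\<^esub> s \<otimes>\<^bsub>Q\<^esub> inv\<^bsub>Q\<^esub> s \<in> par (st {v})" by (rule par_mult[OF par_inv[OF s]])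
        then show "?b \<in> par (st {v})" using ax sc by (simp add: Q.m_assoc)
      qed (rule par_mult[OF s])
      have 2: "inv\<^bsub>Q\<^esub> s \<otimes>\<^bsub>Q\<^esub> (?b \<otimes>\<^bsub>Q\<^esub> s) \<in> par (st {v}) \<longleftrightarrow> ?b \<otimes>\<^bsub>Q\<^esub> s \<in> par (st {v})"
      proof
        assume "inv\<^bsub>Q\<^esub> s \<otimes>\<^bsub>Q\<^esub> (?b \<otimes>\<^bsub>Q\<^esub> s) \<in> par (st {v})"
        then have "s \<otimes>\<^bsub>Q\<^esub> (inv\<^bsub>Q\<^esub> s \<otimes>\<^bsub>Q\<^esub> (?b \<otimes>\<^bsub>Q\<^esub> s)) \<in> par (st {v})" using s by (rule par_mult)
        then show "?b \<otimes>\<^bsub>Q\<^esub> s \<in> par (st {v})" using ax sc by simp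
      qed (rule par_mult[OF _ par_inv[OF s]])
      have "inv\<^bsub>Q\<^esub> a \<otimes>\<^bsub>Q\<^esub> (x \<otimes>\<^bsub>Q\<^esub> s) = ?b \<otimes>\<^bsub>Q\<^esub> s" using ax sc by (simp add: Q.m_assoc)
      then show "C v a (x \<otimes>\<^bsub>Q\<^esub> s) = C v a x" unfolding C_def using 1 by simp
      have "inv\<^bsub>Q\<^esub> (a \<otimes>\<^bsub>Q\<^esub> s) \<otimes>\<^bsub>Q\<^esub> (x \<otimes>\<^bsub>Q\<^esub> s) = inv\<^bsub>Q\<^esub> s \<otimes>\<^bsub>Q\<^esub> (?b \<otimes>\<^bsub>Q\<^esub> s)"
        using ax sc by (simp add: Q.m_assoc Q.inv_mult_group)
      then show "C v (a \<otimes>\<^bsub>Q\<^esub> s) (x \<otimes>\<^bsub>Q\<^esub> s) = C v a x" unfolding C_def using 1 2 by simp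
    qed
    have self: "quot [(v, g)] \<in> par (st {v})" if "v \<in> V" "g \<in> carrier (G v)" for v g
      by (rule par_letter[OF _ that(1) quot_sub[OF that]]) (simp add: st_def)
    have linked: "quot [(w, h)] \<in> par (st {v})" if "{v, w} \<in> Ed" "h \<in> carrier (G w)" for v w h
      by (rule par_letter[of w]) (use that edge_vertices[OF that(1)] quot_sub in \<open>auto simp: st_def lk_def\<close>)
    have qc: "quot [(v, g)] \<in> carrier Q" if "v \<in> V" "g \<in> carrier (G v)" for v g
      by (rule quot_carrier) (use that in simp)
    interpret A: word_action V Ed G "carrier Q \<times> carrier Q" act
    proof unfold_locales
      fix v g y assume v: "v \<in> V" "g \<in> carrier (G v)" and y: "y \<in> carrier Q \<times> carrier Q"
      show "act (v, g) y \<in> carrier Q \<times> carrier Q" using v y qc[OF v] by (auto simp: act_def)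
      fix h assume h: "h \<in> carrier (G v)"
      have "quot [(v, g \<otimes>\<^bsub>G v\<^esub> h)] = quot [(v, g)] \<otimes>\<^bsub>Q\<^esub> quot [(v, h)]" using hom_mult[OF quot_letter_hom[OF v(1)] v(2) h] .
      then show "act (v, h) (act (v, g) y) = act (v, g \<otimes>\<^bsub>G v\<^esub> h) y"
        using y C1[OF self[OF v]] qc[OF v] qc[OF v(1) h] by (auto simp: act_def Q.m_assoc)
    next
      fix v y assume v: "v \<in> V" and y: "y \<in> carrier Q \<times> carrier Q"
      have "quot [(v, \<one>\<^bsub>G v\<^esub>)] = \<one>\<^bsub>Q\<^esub>" using quot_rel[OF free_product_rel.one[OF v]] quot_Nil by simp
      moreover obtain a x where "y = (a, x)" "a \<in> carrier Q" "x \<in> carrier Q" using y by blast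
      ultimately show "act (v, \<one>\<^bsub>G v\<^esub>) y = y" by (simp add: act_def)
    next
      fix v w g h y assume e: "{v, w} \<in> Ed" and gh: "g \<in> carrier (G v)" "h \<in> carrier (G w)" and y: "y \<in> carrier Q \<times> carrier Q"
      have vw: "v \<in> V" "w \<in> V" "{w, v} \<in> Ed" using edge_vertices[OF e] e by (auto simp: insert_commute)
      note c = qc[OF vw(1) gh(1)] qc[OF vw(2) gh(2)]
      have swap: "z \<otimes>\<^bsub>Q\<^esub> quot [(v, g)] \<otimes>\<^bsub>Q\<^esub> quot [(w, h)] = z \<otimes>\<^bsub>Q\<^esub> quot [(w, h)] \<otimes>\<^bsub>Q\<^esub> quot [(v, g)]" if "z \<in> carrier Q" for z
        using quot_commute[OF e gh] c that by (simp add: Q.m_assoc)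
      show "act (w, h) (act (v, g) y) = act (v, g) (act (w, h) y)"
        using y C1[OF linked[OF e gh(2)]] C1[OF linked[OF vw(3) gh(1)]] c swap by (auto simp: act_def)
    qed
    \<comment> \<open>By \<open>run_quot\<close> all words for \<open>q\<close> give the same
      result, so the choice is harmless.\<close>
    define \<gamma> where "\<gamma> q = fst (fold act (SOME w. w \<in> W \<and> quot w = q) (\<one>\<^bsub>Q\<^esub>, \<one>\<^bsub>Q\<^esub>))" for q
    have \<gamma>: "\<gamma> (quot w) = fst (fold act w (\<one>\<^bsub>Q\<^esub>, \<one>\<^bsub>Q\<^esub>))" if "w \<in> W" for w
    proof -
      have "(SOME u. u \<in> W \<and> quot u = quot w) \<in> W \<and> quot (SOME u. u \<in> W \<and> quot u = quot w) = quot w"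
        by (rule someI[of "\<lambda>u. u \<in> W \<and> quot u = quot w" w]) (use that in simp)
      then have "fold act (SOME u. u \<in> W \<and> quot u = quot w) (\<one>\<^bsub>Q\<^esub>, \<one>\<^bsub>Q\<^esub>) = fold act w (\<one>\<^bsub>Q\<^esub>, \<one>\<^bsub>Q\<^esub>)"
        using that by (intro A.run_quot) auto
      then show ?thesis by (simp add: \<gamma>_def)
    qed
    have snd: "snd (fold act w (\<one>\<^bsub>Q\<^esub>, \<one>\<^bsub>Q\<^esub>)) = quot w" if "w \<in> W" for w
      using that
    proof (induction w rule: rev_induct)
      case (snoc x w)
      have "snd (act x p) = snd p \<otimes>\<^bsub>Q\<^esub> quot [x]" for p by (cases x; cases p) (simp add: act_def)
      then show ?case using snoc quot_append[of w "[x]"] by simp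
    qed (simp add: quot_Nil)
    show ?thesis
    proof (intro exI[of _ \<gamma>] conjI ballI)
      show "\<gamma> \<one>\<^bsub>Q\<^esub> = \<one>\<^bsub>Q\<^esub>" using \<gamma>[of "[]"] quot_Nil by simp
      fix x v s assume x: "x \<in> carrier Q" and v: "v \<in> V" and s: "s \<in> sub v"
      obtain w where w: "w \<in> W" "x = quot w" using carrier_quot[OF x] by blast
      obtain g where g: "g \<in> carrier (G v)" "s = quot [(v, g)]" using s unfolding vertex_subgroup_quot by blast
      have "x \<otimes>\<^bsub>Q\<^esub> s = quot (w @ [(v, g)])" using quot_append[of w "[(v, g)]"] w g v by simp
      then have "\<gamma> (x \<otimes>\<^bsub>Q\<^esub> s) = fst (act (v, g) (fold act w (\<one>\<^bsub>Q\<^esub>, \<one>\<^bsub>Q\<^esub>)))" using \<gamma>[of "w @ [(v, g)]"] w v g by simp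
      also have "fold act w (\<one>\<^bsub>Q\<^esub>, \<one>\<^bsub>Q\<^esub>) = (\<gamma> x, x)" using \<gamma>[OF w(1)] snd[OF w(1)] w(2) by (simp add: prod_eq_iff)
      finally show "\<gamma> (x \<otimes>\<^bsub>Q\<^esub> s) = (if v \<in> \<Lambda> \<and> inv\<^bsub>Q\<^esub> (\<gamma> x) \<otimes>\<^bsub>Q\<^esub> x \<in> par (st {v}) then \<gamma> x \<otimes>\<^bsub>Q\<^esub> s else \<gamma> x)"
        using g by (simp add: act_def C_def)
    qed
  qed
  have "carrier Q = par V" using carrier_quot par par_carrier by blast
  then show ?thesis
    by (rule gated_group.intro[OF quot_vertex_subgroups[OF assms] gated_group_axioms.intro[OF _ gate]])
qed

end

theorem corollaryB:
  fixes V :: "'v set" and Ed :: "'v set set" and G :: "'v \<Rightarrow> ('g, 'm) monoid_scheme"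
  assumes "finite V" and "V \<noteq> {}" and "simplicial_graph V Ed"
    and "\<And>v. v \<in> V \<Longrightarrow> group (G v)"
    and "\<And>v. v \<in> V \<Longrightarrow> carrier (G v) \<noteq> {\<one>\<^bsub>G v\<^esub>}"
  shows "hierarchically_hyperbolic_space
           TYPE(('v, 'g) graph_product_elt set set) TYPE(('v, 'g) graph_product_elt \<Rightarrow> real)
           (carrier (graph_product V Ed G)) (syllable_dist V Ed G)"
proof -
  interpret group_family V Ed G by (rule group_family.intro) fact+
  interpret P: gated_group Q V edge_rel sub by (rule graph_product_gated) fact
  have "syllable_adj V Ed G = P.syllable_graph"
    by (simp add: syllable_adj_def P.syllable_graph_def)
  then have "syllable_dist V Ed G = P.graph_dist"
    by (simp add: fun_eq_iff syllable_dist_def P.graph_dist_def)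
  then show ?thesis
    using P.syllable_graph_hierarchically_hyperbolic[OF assms(2) sub_nontrivial[OF _ assms(5)]] by simp
qed

end
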